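(* Let $\mathcal{M} = ([n], \mathcal{I})$ be a matroid on ground set $[n]$ with family of independent sets $\mathcal{I}$, accessible through an independence oracle $\mathcal{O}_I$ (which, given $S \subseteq [n]$, answers whether $S \in \mathcal{I}$) that answers each query in time $t_{\mathcal{O}_I}$. There exists an algorithm that takes as input external fields $\boldsymbol{\lambda} = (\lambda_1,\dots,\lambda_n) \in \mathbb{R}_{>0}^n$ and $\epsilon \in (0,1)$, and outputs a random set $S \in \mathcal{I}$ whose distribution is within total variation distance at most $\epsilon$ of $\mu_{\mathcal{M},\boldsymbol{\lambda}}$. Its expected running time is $O\big((1+\lambda_{\max})\, n \log(n/\epsilon)\, (\log n + t_{\mathcal{O}_I})\big)$, where $\lambda_{\max} := \max_{i \in [n]} \lambda_i$.
   Context: The distribution $\mu_{\mathcal{M},\boldsymbol{\lambda}}$ on $\mathcal{I}$ is defined by $\mu_{\mathcal{M},\boldsymbol{\lambda}}(S) \propto \prod_{i \in S} \lambda_i$ for $S \in \mathcal{I}$. The total variation distance between distributions $\mu,\nu$ on a finite set $\Omega$ is $\frac12\sum_{X\in\Omega}|\mu(X)-\nu(X)|$. *)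

theory Defs
  imports "HOL-Probability.Probability"
begin

section \<open>Matroids and the weighted distribution on independent sets\<close>

locale matroid =
  fixes E :: "'a set" and \<I> :: "'a set set"
  assumes finite_ground: "finite E"
    and indep_subset: "X \<in> \<I> \<Longrightarrow> X \<subseteq> E"
    and indep_empty: "{} \<in> \<I>"
    and indep_mono: "\<lbrakk>X \<in> \<I>; Y \<subseteq> X\<rbrakk> \<Longrightarrow> Y \<in> \<I>"
    and augment: "\<lbrakk>X \<in> \<I>; Y \<in> \<I>; card X < card Y\<rbrakk> \<Longrightarrow> \<exists>y\<in>Y - X. insert y X \<in> \<I>"

definition indep_dist :: "'a set set \<Rightarrow> ('a \<Rightarrow> real) \<Rightarrow> 'a set \<Rightarrow> real" where
  "indep_dist \<I> lam S =
     (if S \<in> \<I> then (\<Prod>i\<in>S. lam i) / (\<Sum>T\<in>\<I>. \<Prod>i\<in>T. lam i) else 0)"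

definition tv_dist :: "'b set \<Rightarrow> ('b \<Rightarrow> real) \<Rightarrow> ('b \<Rightarrow> real) \<Rightarrow> real" where
  "tv_dist \<Omega> \<mu> \<nu> = 1 / 2 * (\<Sum>X\<in>\<Omega>. \<bar>\<mu> X - \<nu> X\<bar>)"


section \<open>Randomised oracle real RAM\<close>

text \<open>
  An algorithm is a program in a small imperative language, that is, a finite syntactic object
  that can depend neither on the matroid nor on the fields, the accuracy or the oracle time.
  A store has integer and real registers, which a program addresses only by constants, and an
  integer and a real memory, which it addresses by computed integers.

  The instruction set is the usual unit-cost one for exact real arithmetic: integers can be added,
  subtracted and compared (there is no unit-cost integer multiplication); reals can be added,
  subtracted, multiplied, divided and compared, and an integer can be cast to a real, but there is
  no rounding from reals to integers. Real constants in programs are rational combinations of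
  integer constants, so no information can be hidden in them. An expression in a fixed program has
  a fixed size, so evaluating it is charged as one step.
\<close>

record store =
  ireg :: "nat \<Rightarrow> int"
  rreg :: "nat \<Rightarrow> real"
  imem :: "int \<Rightarrow> int"
  rmem :: "int \<Rightarrow> real"

datatype iexp =
    IConst int
  | IReg nat
  | IMem iexp
  | IAdd iexp iexp
  | ISub iexp iexp

datatype rexp =
    OfInt iexp
  | RReg nat
  | RMem iexp
  | RAdd rexp rexp
  | RSub rexp rexp
  | RMul rexp rexp
  | RDiv rexp rexp

datatype bexp =
    ILess iexp iexp
  | RLess rexp rexp
  | BNot bexp
  | BAnd bexp bexp

text \<open>
  The command \<open>Flip r p\<close> tosses a coin of bias \<open>p\<close> (clipped to the unit interval), which amounts to
  comparing a uniform random real with \<open>p\<close>. Two fair coin tosses in expectation simulate it, so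
  charging one step for it does not affect expected running times beyond constant factors.

  The command \<open>Query r a\<close> asks the oracle about the set whose indicator array starts after address
  \<open>a\<close> in the integer memory. The set is passed by reference.
\<close>

datatype com =
    Skip
  | ISet nat iexp
  | RSet nat rexp
  | IStore iexp iexp
  | RStore iexp rexp
  | Flip nat rexp
  | Query nat iexp
  | Seq com com
  | Cond bexp com com
  | While bexp com

fun ival :: "iexp \<Rightarrow> store \<Rightarrow> int" where
  "ival (IConst k) s = k"
| "ival (IReg r) s = ireg s r"
| "ival (IMem a) s = imem s (ival a s)"
| "ival (IAdd a b) s = ival a s + ival b s"
| "ival (ISub a b) s = ival a s - ival b s"

fun rval :: "rexp \<Rightarrow> store \<Rightarrow> real" where
  "rval (OfInt a) s = real_of_int (ival a s)"
| "rval (RReg r) s = rreg s r"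
| "rval (RMem a) s = rmem s (ival a s)"
| "rval (RAdd a b) s = rval a s + rval b s"
| "rval (RSub a b) s = rval a s - rval b s"
| "rval (RMul a b) s = rval a s * rval b s"
| "rval (RDiv a b) s = rval a s / rval b s"

fun bval :: "bexp \<Rightarrow> store \<Rightarrow> bool" where
  "bval (ILess a b) s \<longleftrightarrow> ival a s < ival b s"
| "bval (RLess a b) s \<longleftrightarrow> rval a s < rval b s"
| "bval (BNot b) s \<longleftrightarrow> \<not> bval b s"
| "bval (BAnd b c) s \<longleftrightarrow> bval b s \<and> bval c s"

definition set_at :: "nat \<Rightarrow> int \<Rightarrow> store \<Rightarrow> nat set" where
  "set_at n a s = {i \<in> {1..n}. imem s (a + int i) \<noteq> 0}"

text \<open>
  Small-step semantics for ground set \<open>{1..n}\<close>, oracle \<open>orc\<close> and time \<open>t\<close> per oracle answer. The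
  third component of a result is the cost of the step. Terminated programs are \<open>Skip\<close>, which
  idles at no cost.
\<close>

fun step :: "nat \<Rightarrow> (nat set \<Rightarrow> bool) \<Rightarrow> real \<Rightarrow> com \<Rightarrow> store \<Rightarrow> (com \<times> store \<times> real) pmf" where
  "step n orc t Skip s = return_pmf (Skip, s, 0)"
| "step n orc t (ISet r a) s =
     return_pmf (Skip, s\<lparr>ireg := (ireg s)(r := ival a s)\<rparr>, 1)"
| "step n orc t (RSet r a) s =
     return_pmf (Skip, s\<lparr>rreg := (rreg s)(r := rval a s)\<rparr>, 1)"
| "step n orc t (IStore a b) s =
     return_pmf (Skip, s\<lparr>imem := (imem s)(ival a s := ival b s)\<rparr>, 1)"
| "step n orc t (RStore a b) s =
     return_pmf (Skip, s\<lparr>rmem := (rmem s)(ival a s := rval b s)\<rparr>, 1)"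
| "step n orc t (Flip r p) s =
     map_pmf (\<lambda>b. (Skip, s\<lparr>ireg := (ireg s)(r := of_bool b)\<rparr>, 1))
       (bernoulli_pmf (max 0 (min 1 (rval p s))))"
| "step n orc t (Query r a) s =
     return_pmf (Skip, s\<lparr>ireg := (ireg s)(r := of_bool (orc (set_at n (ival a s) s)))\<rparr>, 1 + t)"
| "step n orc t (Seq c d) s =
     (if c = Skip then return_pmf (d, s, 1)
      else map_pmf (\<lambda>(c', s', \<tau>). (Seq c' d, s', \<tau>)) (step n orc t c s))"
| "step n orc t (Cond b c d) s = return_pmf (if bval b s then c else d, s, 1)"
| "step n orc t (While b c) s =
     return_pmf (if bval b s then Seq c (While b c) else Skip, s, 1)"

text \<open>Configuration and elapsed time after \<open>k\<close> steps.\<close>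

primrec run ::
  "nat \<Rightarrow> (nat set \<Rightarrow> bool) \<Rightarrow> real \<Rightarrow> com \<Rightarrow> store \<Rightarrow> nat \<Rightarrow> (com \<times> store \<times> real) pmf" where
  "run n orc t c s 0 = return_pmf (c, s, 0)"
| "run n orc t c s (Suc k) =
     bind_pmf (run n orc t c s k)
       (\<lambda>(c', s', \<tau>). map_pmf (\<lambda>(c'', s'', \<delta>). (c'', s'', \<tau> + \<delta>)) (step n orc t c' s'))"

definition input :: "nat \<Rightarrow> (nat \<Rightarrow> real) \<Rightarrow> real \<Rightarrow> store" where
  "input n lam \<epsilon> =
     \<lparr>ireg = (\<lambda>r. if r = 0 then int n else 0),
      rreg = (\<lambda>r. if r = 0 then \<epsilon> else 0),
      imem = (\<lambda>_. 0),
      rmem = (\<lambda>a. if 1 \<le> a \<and> a \<le> int n then lam (nat a) else 0)\<rparr>"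

text \<open>
  The output is the set with indicator array at addresses \<open>1..n\<close>. As \<open>\<nu>\<close> has total mass one, a
  program with an output law terminates almost surely.
\<close>

definition output_law ::
  "nat \<Rightarrow> (nat set \<Rightarrow> bool) \<Rightarrow> real \<Rightarrow> com \<Rightarrow> store \<Rightarrow> nat set pmf \<Rightarrow> bool" where
  "output_law n orc t c s \<nu> \<longleftrightarrow>
     (\<forall>X. (\<lambda>k. measure_pmf.prob (run n orc t c s k)
                 {(c', s', \<tau>). c' = Skip \<and> set_at n 0 s' = X}) \<longlonglongrightarrow> pmf \<nu> X)"

text \<open>
  The elapsed time is nondecreasing in the number of steps, so by monotone convergence the
  supremum is the expectation of the total running time.
\<close>

definition expected_time ::
  "nat \<Rightarrow> (nat set \<Rightarrow> bool) \<Rightarrow> real \<Rightarrow> com \<Rightarrow> store \<Rightarrow> ennreal" where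
  "expected_time n orc t c s =
     (SUP k. \<integral>\<^sup>+ (c', s', \<tau>). ennreal \<tau> \<partial>measure_pmf (run n orc t c s k))"

end

theory Submission
  imports Defs
begin

text \<open>
  Pad an independent set \<open>S\<close> with \<open>n - card S\<close> stars and order the letters uniformly at random. This
  turns the target distribution into an exchangeable law on words of length \<open>n\<close>. For each prefix, the
  matrix of the probabilities of the next two letters satisfies a reverse Cauchy-Schwarz inequality: in
  codimension two because parallelism is an equivalence relation, and for shorter prefixes by the
  trickle-down argument on eigenvalues. With \<open>a ln (a / b) \<ge> a - b\<close> this makes the relative entropies of
  the marginals on prefixes of length \<open>0, ..., n\<close> a convex sequence, so deleting a letter loses at least
  a fraction \<open>1 / n\<close> of the entropy. A heat-bath update of a random letter performed only with
  probability at least \<open>1 / (1 + lmax)\<close> therefore contracts the entropy by \<open>1 - 1 / ((1 + lmax) n)\<close>, and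
  such a lazy update needs a single oracle call. As the entropy dominates the squared total variation
  distance, \<open>2 (1 + lmax) n ln (n / \<epsilon>)\<close> updates suffice from a start of entropy at most \<open>n\<^sup>2\<close>.
\<close>

section \<open>Coupling terminating programs with abstract distributions\<close>

text \<open>The time bound leaves a constant number of oracle calls and O(log n) other steps per
  update, so a heat-bath update can neither compute its normalising constant nor repeat proposals
  until one is accepted. Instead the probability of a real update varies with the set
  \<open>T\<close> left by the removal. Both ends of a move share the same \<open>T\<close>, so the
  chain stays reversible, and densities evolve under the same operator as functions. Stars give all
  words the common length \<open>n\<close>; removing a uniform letter then amounts to drawing a
  uniform ground element, whatever the size of the current set. Since
  \<open>ln (n^2 / \<epsilon>^2)\<close> is only twice \<open>ln (n / \<epsilon>)\<close>, a
  starting entropy as large as \<open>n^2\<close> is harmless, which leaves much freedom for the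
  start. On the program side every branch obeys one and the same time bound, so the expected time
  needs no probabilistic estimate. For \<open>n = 1\<close> the factor \<open>ln n + t\<close> may
  vanish, whence the separate bound in that case.\<close>

lemma run_Suc_step:
  "run n orc t c s (Suc k) =
     bind_pmf (step n orc t c s)
       (\<lambda>(c', s', \<delta>). map_pmf (\<lambda>(c'', s'', \<tau>). (c'', s'', \<delta> + \<tau>)) (run n orc t c' s' k))"
proof (induction k)
  case 0
  show ?case
    by (auto simp: bind_return_pmf case_prod_beta map_pmf_def intro!: bind_pmf_cong)
next
  case (Suc k)
  have "run n orc t c s (Suc (Suc k)) = bind_pmf (run n orc t c s (Suc k))
       (\<lambda>(c', s', \<tau>). map_pmf (\<lambda>(c'', s'', \<delta>). (c'', s'', \<tau> + \<delta>)) (step n orc t c' s'))"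
    by simp
  also have "\<dots> = bind_pmf (step n orc t c s)
       (\<lambda>(c', s', \<delta>). map_pmf (\<lambda>(c'', s'', \<tau>). (c'', s'', \<delta> + \<tau>)) (run n orc t c' s' (Suc k)))"
    unfolding Suc
    by (simp add: bind_assoc_pmf bind_map_pmf map_bind_pmf case_prod_beta' pmf.map_comp o_def add.assoc)
  finally show ?case .
qed

text \<open>Big-step law of the final store together with the total cost. The family
  \<open>\<mu>\<close> is indexed by the successor command and store but not by the cost
  \<open>\<delta>\<close>, because costs never influence what is executed.\<close>

inductive ev :: "nat \<Rightarrow> (nat set \<Rightarrow> bool) \<Rightarrow> real \<Rightarrow> com \<Rightarrow> store \<Rightarrow> (store \<times> real) pmf \<Rightarrow> bool"
  for n orc t where
  Skip: "ev n orc t Skip s (return_pmf (s, 0))"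
| Step: "c \<noteq> Skip \<Longrightarrow>
    (\<And>c' s' \<delta>. (c', s', \<delta>) \<in> set_pmf (step n orc t c s) \<Longrightarrow> ev n orc t c' s' (\<mu> c' s')) \<Longrightarrow>
    ev n orc t c s (bind_pmf (step n orc t c s)
      (\<lambda>(c', s', \<delta>). map_pmf (\<lambda>(s'', \<tau>). (s'', \<delta> + \<tau>)) (\<mu> c' s')))"

lemma ev_return_step:
  assumes "c \<noteq> Skip" "step n orc t c s = return_pmf (c', s', \<delta>)" "ev n orc t c' s' \<mu>"
  shows "ev n orc t c s (map_pmf (\<lambda>(s'', \<tau>). (s'', \<delta> + \<tau>)) \<mu>)"
  using ev.Step[of c n orc t s "\<lambda>_ _. \<mu>"] assms by (simp add: bind_return_pmf)

lemma ev_Seq: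
  assumes "ev n orc t c s \<mu>" "\<And>s' \<tau>. (s', \<tau>) \<in> set_pmf \<mu> \<Longrightarrow> ev n orc t d s' (\<nu> s')"
  shows "ev n orc t (Seq c d) s
    (bind_pmf \<mu> (\<lambda>(s', \<tau>). map_pmf (\<lambda>(s'', \<tau>'). (s'', \<tau> + 1 + \<tau>')) (\<nu> s')))"
  using assms
proof (induction rule: ev.induct)
  case (Skip s)
  then show ?case
    using ev_return_step[of "Seq Skip d" n orc t s d s 1 "\<nu> s"] by (simp add: bind_return_pmf)
next
  case (Step c s \<mu>)
  \<comment> \<open>\<open>ev.Step\<close> wants the law as a function of the successor command.
    Successors of \<open>Seq c d\<close> have the form \<open>Seq c' d\<close>, and the case
    expression recovers \<open>c'\<close>.\<close>
  define \<mu>' where "\<mu>' = (\<lambda>C s'. bind_pmf (\<mu> (case C of Seq c' _ \<Rightarrow> c' | _ \<Rightarrow> Skip) s')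
     (\<lambda>(s', \<tau>). map_pmf (\<lambda>(s'', \<tau>'). (s'', \<tau> + 1 + \<tau>')) (\<nu> s')))"
  have st: "step n orc t (Seq c d) s = map_pmf (\<lambda>(c', s', \<tau>). (Seq c' d, s', \<tau>)) (step n orc t c s)"
    using Step.hyps by simp
  have "ev n orc t (Seq c d) s (bind_pmf (step n orc t (Seq c d) s)
      (\<lambda>(c', s', \<delta>). map_pmf (\<lambda>(s'', \<tau>). (s'', \<delta> + \<tau>)) (\<mu>' c' s')))"
  proof (rule ev.Step)
    fix C s' \<delta> assume "(C, s', \<delta>) \<in> set_pmf (step n orc t (Seq c d) s)"
    then obtain c' where c': "C = Seq c' d" "(c', s', \<delta>) \<in> set_pmf (step n orc t c s)"
      unfolding st by auto
    show "ev n orc t C s' (\<mu>' C s')"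
      unfolding c'(1) \<mu>'_def com.case
    proof (rule Step.IH[OF c'(2)])
      fix s'' \<tau> assume "(s'', \<tau>) \<in> set_pmf (\<mu> c' s')"
      then show "ev n orc t d s'' (\<nu> s'')"
        using c'(2) by (intro Step.prems[of s'' "\<delta> + \<tau>"]) force
    qed
  qed simp
  also have "(bind_pmf (step n orc t (Seq c d) s)
      (\<lambda>(c', s', \<delta>). map_pmf (\<lambda>(s'', \<tau>). (s'', \<delta> + \<tau>)) (\<mu>' c' s'))) =
    bind_pmf (bind_pmf (step n orc t c s) (\<lambda>(c', s', \<delta>). map_pmf (\<lambda>(s'', \<tau>). (s'', \<delta> + \<tau>)) (\<mu> c' s')))
      (\<lambda>(s', \<tau>). map_pmf (\<lambda>(s'', \<tau>'). (s'', \<tau> + 1 + \<tau>')) (\<nu> s'))"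
    unfolding st \<mu>'_def
    by (simp add: bind_assoc_pmf bind_map_pmf map_bind_pmf case_prod_beta' pmf.map_comp o_def add.assoc)
  finally show ?case .
qed

lemma finite_set_pmf_step: "finite (set_pmf (step n orc t c s))"
  by (induction c) (auto intro: finite_subset)

lemma run_Skip: "run n orc t Skip s k = return_pmf (Skip, s, 0)"
  by (induction k) (auto simp: bind_return_pmf)

text \<open>Each step has finitely many outcomes, so the depths needed by the successors have a
  maximum. The law of the run is therefore eventually constant, not merely convergent.\<close>

lemma ev_run:
  assumes "ev n orc t c s \<mu>"
  shows "\<exists>k. \<forall>k'\<ge>k. run n orc t c s k' = map_pmf (\<lambda>(s', \<tau>). (Skip, s', \<tau>)) \<mu>"
  using assms
proof (induction rule: ev.induct)
  case (Skip s)
  then show ?case by (auto simp: run_Skip)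
next
  case (Step c s \<mu>)
  let ?P = "set_pmf (step n orc t c s)"
  have "\<exists>k. \<forall>k'\<ge>k. run n orc t (fst x) (fst (snd x)) k' =
      map_pmf (\<lambda>(s', \<tau>). (Skip, s', \<tau>)) (\<mu> (fst x) (fst (snd x)))" if "x \<in> ?P" for x
    using Step.IH[of "fst x" "fst (snd x)" "snd (snd x)"] that by simp
  then obtain K where K: "\<And>x k'. x \<in> ?P \<Longrightarrow> k' \<ge> K x \<Longrightarrow> run n orc t (fst x) (fst (snd x)) k' =
      map_pmf (\<lambda>(s', \<tau>). (Skip, s', \<tau>)) (\<mu> (fst x) (fst (snd x)))"
    by meson
  have "run n orc t c s k' = map_pmf (\<lambda>(s', \<tau>). (Skip, s', \<tau>)) (bind_pmf (step n orc t c s)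
      (\<lambda>(c', s', \<delta>). map_pmf (\<lambda>(s'', \<tau>). (s'', \<delta> + \<tau>)) (\<mu> c' s')))"
    if k': "k' \<ge> Suc (Max (K ` ?P))" for k'
  proof -
    obtain j where j: "k' = Suc j" "j \<ge> Max (K ` ?P)"
      using k' by (cases k') simp_all
    have *: "K x \<le> j" if "x \<in> ?P" for x
      using Max_ge[OF finite_imageI[OF finite_set_pmf_step] imageI[OF that], of K] j(2) by linarith
    have "map_pmf (\<lambda>(c'', s'', \<tau>). (c'', s'', snd (snd x) + \<tau>)) (run n orc t (fst x) (fst (snd x)) j)
      = map_pmf (\<lambda>(s', \<tau>). (Skip, s', \<tau>)) (map_pmf (\<lambda>(s'', \<tau>). (s'', snd (snd x) + \<tau>)) (\<mu> (fst x) (fst (snd x))))"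
      if "x \<in> ?P" for x
      unfolding K[OF that *[OF that]] by (simp add: pmf.map_comp o_def case_prod_beta')
    then show ?thesis
      unfolding j(1) run_Suc_step map_bind_pmf
      by (intro bind_pmf_cong refl) (simp add: case_prod_beta')
  qed
  then show ?case by blast
qed

lemma ev_unique:
  assumes "ev n orc t c s \<mu>" "ev n orc t c s \<mu>'"
  shows "\<mu> = \<mu>'"
proof -
  obtain k k' where "\<forall>j\<ge>k. run n orc t c s j = map_pmf (\<lambda>(s', \<tau>). (Skip, s', \<tau>)) \<mu>"
    "\<forall>j\<ge>k'. run n orc t c s j = map_pmf (\<lambda>(s', \<tau>). (Skip, s', \<tau>)) \<mu>'"
    using ev_run assms by meson
  then have "map_pmf (\<lambda>(s', \<tau>). (Skip, s', \<tau>)) \<mu> = map_pmf (\<lambda>(s', \<tau>). (Skip, s', \<tau>)) \<mu>'"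
    by (metis max.cobounded1 max.cobounded2)
  then have "map_pmf snd (map_pmf (\<lambda>(s', \<tau>). (Skip, s', \<tau>)) \<mu>) =
    map_pmf snd (map_pmf (\<lambda>(s', \<tau>). (Skip, s', \<tau>)) \<mu>')"
    by simp
  then show ?thesis by (simp add: pmf.map_comp o_def case_prod_beta')
qed

lemma step_cost_nonneg:
  assumes "t \<ge> 0" shows "(c', s', \<delta>) \<in> set_pmf (step n orc t c s) \<Longrightarrow> \<delta> \<ge> 0"
  using assms by (induction c arbitrary: c') (auto split: if_splits)

lemma ev_cost_nonneg:
  assumes "ev n orc t c s \<mu>" "t \<ge> 0"
  shows "(s', \<tau>) \<in> set_pmf \<mu> \<Longrightarrow> 0 \<le> \<tau>"
  using assms(1)
proof (induction arbitrary: s' \<tau> rule: ev.induct)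
  case (Step c s \<mu>)
  then obtain c1 s1 \<delta> \<tau>1 where "(c1, s1, \<delta>) \<in> set_pmf (step n orc t c s)"
    "(s', \<tau>1) \<in> set_pmf (\<mu> c1 s1)" "\<tau> = \<delta> + \<tau>1"
    by auto
  then show ?case
    using Step.IH[of c1 s1 \<delta> s' \<tau>1] step_cost_nonneg[OF assms(2), of c1 s1 \<delta>] by simp
qed auto

text \<open>Costs are nonnegative, so every partial run extends to a terminated one that costs at
  least as much. A bound on final costs thus bounds every term of the supremum in
  \<open>expected_time\<close>.\<close>

lemma ev_run_cost:
  assumes "ev n orc t c s \<mu>" "t \<ge> 0" "(c', s', \<tau>) \<in> set_pmf (run n orc t c s k)"
    "\<And>s'' \<tau>''. (s'', \<tau>'') \<in> set_pmf \<mu> \<Longrightarrow> \<tau>'' \<le> B"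
  shows "\<tau> \<le> B"
proof -
  have "\<exists>y \<in> set_pmf \<mu>. \<tau> \<le> snd y"
    using assms(1,3)
  proof (induction arbitrary: \<tau> k rule: ev.induct)
    case (Skip s)
    then show ?case by (auto simp: run_Skip)
  next
    case (Step c s \<mu>)
    let ?\<mu> = "bind_pmf (step n orc t c s)
      (\<lambda>(c', s', \<delta>). map_pmf (\<lambda>(s'', \<tau>). (s'', \<delta> + \<tau>)) (\<mu> c' s'))"
    show ?case
    proof (cases k)
      case 0
      obtain y where "y \<in> set_pmf ?\<mu>" using set_pmf_not_empty[of ?\<mu>] by blast
      moreover have "ev n orc t c s ?\<mu>" using Step.hyps by (intro ev.Step) auto
      ultimately have "0 \<le> snd y" using ev_cost_nonneg[OF _ assms(2), of n orc c s ?\<mu> "fst y" "snd y"] by simp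
      then show ?thesis using Step.prems 0 \<open>y \<in> set_pmf ?\<mu>\<close> by (intro bexI[of _ y]) simp_all
    next
      case (Suc j)
      obtain c1 s1 \<delta> \<tau>1 where x: "(c1, s1, \<delta>) \<in> set_pmf (step n orc t c s)"
        "(c', s', \<tau>1) \<in> set_pmf (run n orc t c1 s1 j)" "\<tau> = \<delta> + \<tau>1"
        using Step.prems unfolding Suc run_Suc_step by auto
      obtain y where "y \<in> set_pmf (\<mu> c1 s1)" "\<tau>1 \<le> snd y"
        using Step.IH[OF x(1,2)] by blast
      then have "(fst y, \<delta> + snd y) \<in> set_pmf ?\<mu>" "\<tau> \<le> snd (fst y, \<delta> + snd y)"
        using x by force+
      then show ?thesis by blast
    qed
  qed
  then show ?thesis using assms(4) by fastforce
qed

text \<open>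
  Since \<open>ev\<close> is inductive and steps branch finitely, this includes termination on every branch.
\<close>

definition refines ::
  "nat \<Rightarrow> (nat set \<Rightarrow> bool) \<Rightarrow> real \<Rightarrow> com \<Rightarrow> store \<Rightarrow> real \<Rightarrow> (store \<Rightarrow> 'x \<Rightarrow> bool) \<Rightarrow> 'x pmf \<Rightarrow> bool" where
  "refines n orc t c s B R D \<longleftrightarrow>
     (\<exists>\<mu>. ev n orc t c s \<mu> \<and> rel_pmf (\<lambda>(s', \<tau>) x. \<tau> \<le> B \<and> R s' x) \<mu> D)"

lemma refines_expected_time:
  assumes "refines n orc t c s B R D" "t \<ge> 0"
  shows "expected_time n orc t c s \<le> ennreal B"
proof -
  obtain \<mu> where \<mu>: "ev n orc t c s \<mu>" "rel_pmf (\<lambda>(s', \<tau>) x. \<tau> \<le> B \<and> R s' x) \<mu> D"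
    using assms(1) unfolding refines_def by blast
  have "\<tau> \<le> B" if "(s', \<tau>) \<in> set_pmf \<mu>" for s' \<tau>
    using \<mu>(2) that by (auto elim!: rel_pmf.cases)
  then have "\<tau> \<le> B" if "(c', s', \<tau>) \<in> set_pmf (run n orc t c s k)" for c' s' \<tau> k
    using ev_run_cost[OF \<mu>(1) assms(2) that] by blast
  then have "(\<integral>\<^sup>+ (c', s', \<tau>). ennreal \<tau> \<partial>measure_pmf (run n orc t c s k)) \<le>
      (\<integral>\<^sup>+ _. ennreal B \<partial>measure_pmf (run n orc t c s k))" for k
    by (intro nn_integral_mono_AE) (auto simp: AE_measure_pmf_iff intro!: ennreal_leI)
  then show ?thesis
    unfolding expected_time_def by (intro SUP_least) (simp add: measure_pmf.emeasure_space_1)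
qed

lemma refines_output_law:
  assumes "refines n orc t c s B (\<lambda>s'. (=) (set_at n 0 s')) D"
  shows "output_law n orc t c s D"
proof -
  obtain \<mu> where \<mu>: "ev n orc t c s \<mu>"
    "rel_pmf (\<lambda>(s', \<tau>) x. \<tau> \<le> B \<and> set_at n 0 s' = x) \<mu> D"
    using assms(1) unfolding refines_def by blast
  have "rel_pmf (\<lambda>y x. set_at n 0 (fst y) = x) \<mu> D"
    using \<mu>(2) by (rule pmf.rel_mono_strong) auto
  then have D: "D = map_pmf (\<lambda>y. set_at n 0 (fst y)) \<mu>"
    using pmf.rel_map(1)[of "(=)" "\<lambda>y. set_at n 0 (fst y)" \<mu> D] by (simp add: pmf.rel_eq)
  obtain k0 where k0: "\<And>k. k \<ge> k0 \<Longrightarrow> run n orc t c s k = map_pmf (\<lambda>(s', \<tau>). (Skip, s', \<tau>)) \<mu>"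
    using ev_run[OF \<mu>(1)] by blast
  show ?thesis unfolding output_law_def
  proof
    fix X
    have "measure_pmf.prob (run n orc t c s k) {(c', s', \<tau>). c' = Skip \<and> set_at n 0 s' = X} = pmf D X"
      if "k \<ge> k0" for k
      unfolding k0[OF that] D pmf_map measure_map_pmf by (intro measure_pmf.finite_measure_eq_AE) auto
    then show "(\<lambda>k. measure_pmf.prob (run n orc t c s k)
                 {(c', s', \<tau>). c' = Skip \<and> set_at n 0 s' = X}) \<longlonglongrightarrow> pmf D X"
      by (intro tendsto_eventually) (auto simp: eventually_sequentially)
  qed
qed

section \<open>Composition rules for couplings with a time budget\<close>

lemma refines_mono:
  assumes "refines n orc t c s B R D" "B \<le> B'" "\<And>s' x. R s' x \<Longrightarrow> R' s' x"
  shows "refines n orc t c s B' R' D"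
proof -
  obtain \<mu> where \<mu>: "ev n orc t c s \<mu>" "rel_pmf (\<lambda>(s', \<tau>) x. \<tau> \<le> B \<and> R s' x) \<mu> D"
    using assms(1) unfolding refines_def by blast
  have "rel_pmf (\<lambda>(s', \<tau>) x. \<tau> \<le> B' \<and> R' s' x) \<mu> D"
    using \<mu>(2) by (rule pmf.rel_mono_strong) (use assms(2,3) in auto)
  then show ?thesis using \<mu>(1) unfolding refines_def by blast
qed

lemma refines_return_step:
  assumes "c \<noteq> Skip" "step n orc t c s = return_pmf (c', s', \<delta>)" "refines n orc t c' s' (B - \<delta>) R D"
  shows "refines n orc t c s B R D"
proof -
  obtain \<mu> where \<mu>: "ev n orc t c' s' \<mu>" "rel_pmf (\<lambda>(s', \<tau>) x. \<tau> \<le> B - \<delta> \<and> R s' x) \<mu> D"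
    using assms(3) unfolding refines_def by blast
  have "rel_pmf (\<lambda>(s', \<tau>) x. \<tau> \<le> B \<and> R s' x) (map_pmf (\<lambda>(s'', \<tau>). (s'', \<delta> + \<tau>)) \<mu>) D"
    unfolding pmf.rel_map using \<mu>(2) by (rule pmf.rel_mono_strong) auto
  then show ?thesis
    using ev_return_step[OF assms(1,2) \<mu>(1)] unfolding refines_def by blast
qed

lemma refines_Skip: "0 \<le> B \<Longrightarrow> R s x \<Longrightarrow> refines n orc t Skip s B R (return_pmf x)"
  unfolding refines_def by (intro exI[of _ "return_pmf (s, 0)"]) (simp add: ev.Skip)

lemma refines_Seq:
  assumes "refines n orc t c s B1 R D"
    "\<And>s' x. x \<in> set_pmf D \<Longrightarrow> R s' x \<Longrightarrow> refines n orc t d s' (B - B1 - 1) R' (D' x)"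
  shows "refines n orc t (Seq c d) s B R' (bind_pmf D D')"
proof -
  obtain \<mu> where \<mu>: "ev n orc t c s \<mu>" "rel_pmf (\<lambda>(s', \<tau>) x. \<tau> \<le> B1 \<and> R s' x) \<mu> D"
    using assms(1) unfolding refines_def by blast
  have rel: "rel_pmf (\<lambda>y x. y \<in> set_pmf \<mu> \<and> x \<in> set_pmf D \<and> snd y \<le> B1 \<and> R (fst y) x) \<mu> D"
    using \<mu>(2) by (rule pmf.rel_mono_strong) auto
  \<comment> \<open>The law of the rest may depend on the store only, whereas several
    \<open>x\<close> can be coupled to one store. So it is chosen from the store alone, and
    \<open>ev_unique\<close> identifies it with the law that refines \<open>D' x\<close>, for each
    such \<open>x\<close>.\<close>
  define \<nu> where "\<nu> s' = (SOME \<nu>. ev n orc t d s' \<nu>)" for s'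
  have \<nu>: "ev n orc t d s' (\<nu> s')" "rel_pmf (\<lambda>(s', \<tau>) x. \<tau> \<le> B - B1 - 1 \<and> R' s' x) (\<nu> s') (D' x)"
    if sx: "x \<in> set_pmf D" "R s' x" for s' x
  proof -
    obtain \<nu>' where \<nu>': "ev n orc t d s' \<nu>'" "rel_pmf (\<lambda>(s', \<tau>) x. \<tau> \<le> B - B1 - 1 \<and> R' s' x) \<nu>' (D' x)"
      using assms(2)[OF sx] unfolding refines_def by blast
    show "ev n orc t d s' (\<nu> s')" unfolding \<nu>_def by (rule someI[of _ \<nu>']) (rule \<nu>')
    then have "\<nu> s' = \<nu>'" using \<nu>'(1) ev_unique by blast
    then show "rel_pmf (\<lambda>(s', \<tau>) x. \<tau> \<le> B - B1 - 1 \<and> R' s' x) (\<nu> s') (D' x)" using \<nu>'(2) by simp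
  qed
  have "ev n orc t (Seq c d) s
    (bind_pmf \<mu> (\<lambda>(s', \<tau>). map_pmf (\<lambda>(s'', \<tau>'). (s'', \<tau> + 1 + \<tau>')) (\<nu> s')))"
  proof (rule ev_Seq[OF \<mu>(1)])
    fix s' \<tau> assume "(s', \<tau>) \<in> set_pmf \<mu>"
    moreover have "rel_set (\<lambda>y x. y \<in> set_pmf \<mu> \<and> x \<in> set_pmf D \<and> snd y \<le> B1 \<and> R (fst y) x)
        (set_pmf \<mu>) (set_pmf D)"
      using rel_funD[OF pmf.set_transfer rel] .
    ultimately obtain x where "x \<in> set_pmf D" "R s' x"
      by (fastforce dest: rel_setD1)
    then show "ev n orc t d s' (\<nu> s')" by (rule \<nu>(1))
  qed
  moreover have "rel_pmf (\<lambda>(s', \<tau>) x. \<tau> \<le> B \<and> R' s' x)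
    (bind_pmf \<mu> (\<lambda>(s', \<tau>). map_pmf (\<lambda>(s'', \<tau>'). (s'', \<tau> + 1 + \<tau>')) (\<nu> s'))) (bind_pmf D D')"
  proof (rule rel_pmf_bindI[OF rel])
    fix y x assume A: "y \<in> set_pmf \<mu> \<and> x \<in> set_pmf D \<and> snd y \<le> B1 \<and> R (fst y) x"
    show "rel_pmf (\<lambda>(s', \<tau>) x. \<tau> \<le> B \<and> R' s' x)
      (case y of (s', \<tau>) \<Rightarrow> map_pmf (\<lambda>(s'', \<tau>'). (s'', \<tau> + 1 + \<tau>')) (\<nu> s')) (D' x)"
      unfolding case_prod_beta pmf.rel_map
      by (rule pmf.rel_mono_strong[OF \<nu>(2)]) (use A in auto)
  qed
  ultimately show ?thesis unfolding refines_def by blast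
qed

lemma refines_ISet: "1 \<le> B \<Longrightarrow> R (s\<lparr>ireg := (ireg s)(r := ival a s)\<rparr>) x \<Longrightarrow>
    refines n orc t (ISet r a) s B R (return_pmf x)"
  and refines_RSet: "1 \<le> B \<Longrightarrow> R (s\<lparr>rreg := (rreg s)(r := rval e s)\<rparr>) x \<Longrightarrow>
    refines n orc t (RSet r e) s B R (return_pmf x)"
  and refines_IStore: "1 \<le> B \<Longrightarrow> R (s\<lparr>imem := (imem s)(ival a s := ival b s)\<rparr>) x \<Longrightarrow>
    refines n orc t (IStore a b) s B R (return_pmf x)"
  and refines_RStore: "1 \<le> B \<Longrightarrow> R (s\<lparr>rmem := (rmem s)(ival a s := rval e s)\<rparr>) x \<Longrightarrow>
    refines n orc t (RStore a e) s B R (return_pmf x)"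
  and refines_Query: "1 + t \<le> B \<Longrightarrow>
    R (s\<lparr>ireg := (ireg s)(r := of_bool (orc (set_at n (ival a s) s)))\<rparr>) x \<Longrightarrow>
    refines n orc t (Query r a) s B R (return_pmf x)"
  by (rule refines_return_step, simp, simp, rule refines_Skip, simp, simp)+

lemma refines_Seq_return:
  assumes "c \<noteq> Skip" "step n orc t c s = return_pmf (Skip, s', \<delta>)" "refines n orc t d s' (B - (\<delta> + 1)) R D"
  shows "refines n orc t (Seq c d) s B R D"
proof (rule refines_return_step)
  show "step n orc t (Seq c d) s = return_pmf (Seq Skip d, s', \<delta>)" using assms by simp
  show "refines n orc t (Seq Skip d) s' (B - \<delta>) R D"
    by (rule refines_return_step[where c' = d and s' = s' and \<delta> = 1])
       (use assms in \<open>simp_all add: algebra_simps\<close>)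
qed simp

lemma refines_Cond:
  "refines n orc t (if bval b s then c else d) s (B - 1) R D \<Longrightarrow> refines n orc t (Cond b c d) s B R D"
  by (rule refines_return_step) auto

text \<open>The 2 is one unit for the assignment and one for the step that discards the leading
  \<open>Skip\<close>.\<close>

lemma refines_ISet_Seq: "refines n orc t d (s\<lparr>ireg := (ireg s)(r := ival a s)\<rparr>) (B - 2) R D \<Longrightarrow>
    refines n orc t (Seq (ISet r a) d) s B R D"
  and refines_RSet_Seq: "refines n orc t d (s\<lparr>rreg := (rreg s)(r := rval e s)\<rparr>) (B - 2) R D \<Longrightarrow>
    refines n orc t (Seq (RSet r e) d) s B R D"
  and refines_IStore_Seq: "refines n orc t d (s\<lparr>imem := (imem s)(ival a s := ival b s)\<rparr>) (B - 2) R D \<Longrightarrow>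
    refines n orc t (Seq (IStore a b) d) s B R D"
  and refines_RStore_Seq: "refines n orc t d (s\<lparr>rmem := (rmem s)(ival a s := rval e s)\<rparr>) (B - 2) R D \<Longrightarrow>
    refines n orc t (Seq (RStore a e) d) s B R D"
  and refines_Query_Seq:
    "refines n orc t d (s\<lparr>ireg := (ireg s)(r := of_bool (orc (set_at n (ival a s) s)))\<rparr>) (B - (2 + t)) R D \<Longrightarrow>
     refines n orc t (Seq (Query r a) d) s B R D"
  by (rule refines_Seq_return, simp, simp, simp add: algebra_simps)+

lemma refines_Seq_det:
  assumes "refines n orc t c s B1 (=) (return_pmf s')" "refines n orc t d s' (B - B1 - 1) R D"
  shows "refines n orc t (Seq c d) s B R D"
  using refines_Seq[OF assms(1), of d B R "\<lambda>_. D"] assms(2) by (simp add: bind_return_pmf)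

lemma refines_Flip:
  assumes "0 \<le> p" "p \<le> 1" "rval e s = p" "1 \<le> B"
    "\<And>b. R (s\<lparr>ireg := (ireg s)(r := of_bool b)\<rparr>) b"
  shows "refines n orc t (Flip r e) s B R (bernoulli_pmf p)"
proof -
  have "ev n orc t (Flip r e) s (bind_pmf (step n orc t (Flip r e) s)
      (\<lambda>(c', s', \<delta>). map_pmf (\<lambda>(s'', \<tau>). (s'', \<delta> + \<tau>)) (return_pmf (s', 0))))"
    by (rule ev.Step) (auto intro: ev.Skip)
  moreover have "rel_pmf (\<lambda>(s', \<tau>) x. \<tau> \<le> B \<and> R s' x) (bind_pmf (step n orc t (Flip r e) s)
      (\<lambda>(c', s', \<delta>). map_pmf (\<lambda>(s'', \<tau>). (s'', \<delta> + \<tau>)) (return_pmf (s', 0)))) (bernoulli_pmf p)"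
    using assms by (simp add: bind_map_pmf bind_return_pmf' flip: map_pmf_def)
      (auto simp: pmf.rel_map intro!: rel_pmf_reflI)
  ultimately show ?thesis unfolding refines_def by blast
qed

lemma refines_While_False:
  "\<not> bval b s \<Longrightarrow> 1 \<le> B \<Longrightarrow> R s x \<Longrightarrow> refines n orc t (While b c) s B R (return_pmf x)"
  by (rule refines_return_step) (auto intro: refines_Skip)

lemma refines_While_True:
  assumes "bval b s" "refines n orc t c s B1 R D"
    "\<And>s' x. x \<in> set_pmf D \<Longrightarrow> R s' x \<Longrightarrow> refines n orc t (While b c) s' (B - B1 - 2) R' (D' x)"
  shows "refines n orc t (While b c) s B R' (bind_pmf D D')"
proof (rule refines_return_step)
  show "step n orc t (While b c) s = return_pmf (Seq c (While b c), s, 1)" using assms by simp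
  show "refines n orc t (Seq c (While b c)) s (B - 1) R' (bind_pmf D D')"
    by (rule refines_Seq[OF assms(2)]) (use assms(3) in \<open>simp add: algebra_simps\<close>)
qed simp

primrec iter_pmf :: "('x \<Rightarrow> 'x pmf) \<Rightarrow> nat \<Rightarrow> 'x \<Rightarrow> 'x pmf" where
  "iter_pmf K 0 x = return_pmf x"
| "iter_pmf K (Suc m) x = bind_pmf (K x) (iter_pmf K m)"

text \<open>The number of passes is known in advance, so the loop is coupled with a kernel iterated
  \<open>N\<close> times. A pass costs two units beyond its body, for the guard and the discarded
  \<open>Skip\<close>; the final failing guard costs one.\<close>

lemma refines_While_count:
  assumes body: "\<And>j s x. j < N \<Longrightarrow> I j s x \<Longrightarrow> bval b s \<and> refines n orc t c s B (I (Suc j)) (K x)"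
    and exit: "\<And>s x. I N s x \<Longrightarrow> \<not> bval b s"
    and init: "I 0 s x"
  shows "refines n orc t (While b c) s (real N * (B + 2) + 1) (I N) (iter_pmf K N x)"
proof -
  have "refines n orc t (While b c) s (real m * (B + 2) + 1) (I N) (iter_pmf K m x)"
    if "m \<le> N" "I (N - m) s x" for m s x
    using that
  proof (induction m arbitrary: s x)
    case 0
    then show ?case using exit by (auto intro: refines_While_False)
  next
    case (Suc m)
    have *: "bval b s" "refines n orc t c s B (I (Suc (N - Suc m))) (K x)"
      using body[of "N - Suc m" s x] Suc.prems by auto
    show ?case
      unfolding iter_pmf.simps
    proof (rule refines_While_True[OF *])
      fix s' y assume "I (Suc (N - Suc m)) s' y"
      then have "refines n orc t (While b c) s' (real m * (B + 2) + 1) (I N) (iter_pmf K m y)"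
        using Suc.prems(1) by (intro Suc.IH) (simp_all add: Suc_diff_Suc)
      then show "refines n orc t (While b c) s' (real (Suc m) * (B + 2) + 1 - B - 2) (I N) (iter_pmf K m y)"
        by (rule refines_mono) (simp_all add: algebra_simps)
    qed
  qed
  from this[of N s x] init show ?thesis by simp
qed

text \<open>Code without coin tosses has a single outcome, so its postcondition can leave the
  coupling. Existential facts, such as the permutation in \<open>det_arrange\<close>, then pass from
  one command to the next.\<close>

definition det ::
  "nat \<Rightarrow> (nat set \<Rightarrow> bool) \<Rightarrow> real \<Rightarrow> com \<Rightarrow> store \<Rightarrow> real \<Rightarrow> (store \<Rightarrow> bool) \<Rightarrow> bool" where
  "det n orc t c s B P \<longleftrightarrow> (\<exists>s'. P s' \<and> refines n orc t c s B (=) (return_pmf s'))"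

lemma det_mono: "det n orc t c s B P \<Longrightarrow> B \<le> B' \<Longrightarrow> (\<And>s'. P s' \<Longrightarrow> P' s') \<Longrightarrow> det n orc t c s B' P'"
  unfolding det_def using refines_mono[of n orc t c s B "(=)"] by blast

lemma det_Seq:
  assumes "det n orc t c s B1 P" "\<And>s'. P s' \<Longrightarrow> det n orc t d s' (B - B1 - 1) P'"
  shows "det n orc t (Seq c d) s B P'"
  using assms refines_Seq_det unfolding det_def by blast

lemma refines_det_Seq:
  assumes "det n orc t c s B1 P" "\<And>s'. P s' \<Longrightarrow> refines n orc t d s' (B - B1 - 1) R D"
  shows "refines n orc t (Seq c d) s B R D"
  using assms refines_Seq_det unfolding det_def by blast

lemma det_refines:
  "det n orc t c s B P \<Longrightarrow> (\<And>s'. P s' \<Longrightarrow> R s' x) \<Longrightarrow> refines n orc t c s B R (return_pmf x)"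
  unfolding det_def by (force simp: refines_def rel_pmf_return_pmf2)

lemma det_Skip: "0 \<le> B \<Longrightarrow> P s \<Longrightarrow> det n orc t Skip s B P"
  and det_ISet: "1 \<le> B \<Longrightarrow> P (s\<lparr>ireg := (ireg s)(r := ival a s)\<rparr>) \<Longrightarrow> det n orc t (ISet r a) s B P"
  and det_RSet: "1 \<le> B \<Longrightarrow> P (s\<lparr>rreg := (rreg s)(r := rval e s)\<rparr>) \<Longrightarrow> det n orc t (RSet r e) s B P"
  and det_IStore: "1 \<le> B \<Longrightarrow> P (s\<lparr>imem := (imem s)(ival a s := ival b s)\<rparr>) \<Longrightarrow>
    det n orc t (IStore a b) s B P"
  and det_RStore: "1 \<le> B \<Longrightarrow> P (s\<lparr>rmem := (rmem s)(ival a s := rval e s)\<rparr>) \<Longrightarrow>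
    det n orc t (RStore a e) s B P"
  unfolding det_def
  by (rule exI, rule conjI, assumption, (rule refines_Skip refines_ISet refines_RSet refines_IStore refines_RStore;
      simp))+

lemma det_ISet_Seq: "det n orc t d (s\<lparr>ireg := (ireg s)(r := ival a s)\<rparr>) (B - 2) P \<Longrightarrow>
    det n orc t (Seq (ISet r a) d) s B P"
  and det_RSet_Seq: "det n orc t d (s\<lparr>rreg := (rreg s)(r := rval e s)\<rparr>) (B - 2) P \<Longrightarrow>
    det n orc t (Seq (RSet r e) d) s B P"
  and det_IStore_Seq: "det n orc t d (s\<lparr>imem := (imem s)(ival a s := ival b s)\<rparr>) (B - 2) P \<Longrightarrow>
    det n orc t (Seq (IStore a b) d) s B P"
  and det_RStore_Seq: "det n orc t d (s\<lparr>rmem := (rmem s)(ival a s := rval e s)\<rparr>) (B - 2) P \<Longrightarrow>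
    det n orc t (Seq (RStore a e) d) s B P"
  and det_Query_Seq:
    "det n orc t d (s\<lparr>ireg := (ireg s)(r := of_bool (orc (set_at n (ival a s) s)))\<rparr>) (B - (2 + t)) P \<Longrightarrow>
     det n orc t (Seq (Query r a) d) s B P"
  unfolding det_def
  by (elim exE conjE, rule exI, rule conjI, assumption,
      rule refines_ISet_Seq refines_RSet_Seq refines_IStore_Seq refines_RStore_Seq refines_Query_Seq, assumption)+

lemma det_Cond:
  "det n orc t (if bval b s then c else d) s (B - 1) P \<Longrightarrow> det n orc t (Cond b c d) s B P"
  unfolding det_def by (blast intro: refines_Cond)

lemma det_While_count:
  assumes body: "\<And>j s. j < N \<Longrightarrow> I j s \<Longrightarrow> bval b s \<and> det n orc t c s B (I (Suc j))"
    and exit: "\<And>s. I N s \<Longrightarrow> \<not> bval b s"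
    and init: "I 0 s"
  shows "det n orc t (While b c) s (real N * (B + 2) + 1) (I N)"
proof -
  have "det n orc t (While b c) s (real m * (B + 2) + 1) (I N)"
    if "m \<le> N" "I (N - m) s" for m s
    using that
  proof (induction m arbitrary: s)
    case 0
    then show ?case using exit unfolding det_def by (auto intro!: exI[of _ s] refines_While_False)
  next
    case (Suc m)
    obtain s' where *: "bval b s" "I (Suc (N - Suc m)) s'" "refines n orc t c s B (=) (return_pmf s')"
      using body[of "N - Suc m" s] Suc.prems unfolding det_def by auto
    obtain s'' where s'': "I N s''" "refines n orc t (While b c) s' (real m * (B + 2) + 1) (=) (return_pmf s'')"
      using Suc.IH[of s'] *(2) Suc.prems(1) unfolding det_def by (auto simp: Suc_diff_Suc)
    have "refines n orc t (While b c) s (real (Suc m) * (B + 2) + 1) (=) (bind_pmf (return_pmf s') (\<lambda>_. return_pmf s''))"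
    proof (rule refines_While_True[OF *(1,3)])
      fix s1 x assume "x \<in> set_pmf (return_pmf s')" "s1 = x"
      then show "refines n orc t (While b c) s1 (real (Suc m) * (B + 2) + 1 - B - 2) (=) (return_pmf s'')"
        using refines_mono[OF s''(2)] by (simp add: algebra_simps)
    qed
    then show ?case using s''(1) unfolding det_def by (auto simp: bind_return_pmf)
  qed
  from this[of N s] init show ?thesis by simp
qed

section \<open>Trickle-down for exchangeable weights\<close>

text \<open>Serves as the first-order condition at a maximiser of the Rayleigh quotient without
  differentiation.\<close>

lemma linear_coeff_zero_if_quadratic_nonpos:
  fixes a b :: real
  assumes "\<And>s. a * s + b * s^2 \<le> 0"
  shows "a = 0"
proof (rule ccontr)
  assume a: "a \<noteq> 0"
  show False
  proof (cases "b < 0")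
    case True
    then have "a * (- a / (2 * b)) + b * (- a / (2 * b))^2 = a^2 / (4 * - b)"
      by (simp add: power2_eq_square field_simps)
    moreover have "a^2 / (4 * - b) > 0" using True a by (intro divide_pos_pos) auto
    ultimately show False using assms[of "- a / (2 * b)"] by simp
  next
    case False
    then have "0 \<le> b * a^2" by simp
    then show False using assms[of a] a 
      by (simp add: power2_eq_square) (smt (verit, best) not_real_square_gt_zero zero_le_mult_iff)
  qed
qed

text \<open>
  With \<open>P = D\<^sup>-\<^sup>1 W\<close>, the hypothesis \<open>step\<close> says that every eigenvalue of \<open>P\<close> satisfies
  \<open>\<lambda> \<le> \<lambda>\<^sup>2\<close>. The letter \<open>star\<close> is joined to all others, so a maximiser of the Rayleigh quotient
  orthogonal to the constants cannot have an eigenvalue of at least one, hence has one of at most zero.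
\<close>

lemma quadratic_form_nonpos_of_trickle:
  fixes W :: "'a \<Rightarrow> 'a \<Rightarrow> real" and D :: "'a \<Rightarrow> real"
  assumes A: "finite A"
    and sym: "\<And>x y. x \<in> A \<Longrightarrow> y \<in> A \<Longrightarrow> W x y = W y x"
    and nonneg: "\<And>x y. x \<in> A \<Longrightarrow> y \<in> A \<Longrightarrow> 0 \<le> W x y"
    and D: "\<And>x. x \<in> A \<Longrightarrow> D x = (\<Sum>y\<in>A. W x y)"
    and pos: "\<And>x. x \<in> A \<Longrightarrow> 0 < D x"
    and star: "star \<in> A" "\<And>x. x \<in> A \<Longrightarrow> 0 < W star x"
    and step: "\<And>u. (\<Sum>x\<in>A. \<Sum>y\<in>A. u x * u y * W x y) \<le> (\<Sum>x\<in>A. (\<Sum>y\<in>A. W x y * u y)^2 / D x)"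
    and orth: "(\<Sum>x\<in>A. D x * v x) = 0"
  shows "(\<Sum>x\<in>A. \<Sum>y\<in>A. v x * v y * W x y) \<le> 0"
proof (rule ccontr)
  define Q where "Q u = (\<Sum>x\<in>A. \<Sum>y\<in>A. u x * u y * W x y)" for u
  define n2 where "n2 u = (\<Sum>x\<in>A. D x * (u x)^2)" for u
  define lin where "lin u = (\<Sum>x\<in>A. D x * u x)" for u
  assume "\<not> (\<Sum>x\<in>A. \<Sum>y\<in>A. v x * v y * W x y) \<le> 0"
  then have Qv: "Q v > 0" unfolding Q_def by simp
  have Q_scale: "Q (\<lambda>x. c * u x) = c^2 * Q u" for c u
    unfolding Q_def by (simp add: sum_distrib_left power2_eq_square mult_ac)
  have n2_scale: "n2 (\<lambda>x. c * u x) = c^2 * n2 u" for c u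
    unfolding n2_def by (simp add: sum_distrib_left power_mult_distrib mult_ac)
  have lin_scale: "lin (\<lambda>x. c * u x) = c * lin u" for c u
    unfolding lin_def by (simp add: sum_distrib_left mult_ac)
  have n2_nonneg: "n2 u \<ge> 0" for u
    unfolding n2_def by (intro sum_nonneg mult_nonneg_nonneg) (auto intro: less_imp_le pos)
  have n2_zero: "u x = 0" if "n2 u = 0" "x \<in> A" for u x
  proof -
    have "\<forall>x\<in>A. D x * (u x)^2 = 0"
      using that(1) unfolding n2_def
      by (subst (asm) sum_nonneg_eq_0_iff) (use A pos in \<open>auto simp: less_imp_le\<close>)
    then show ?thesis using that(2) pos by force
  qed
  have Q_cong: "Q u = Q u'" if "\<And>x. x \<in> A \<Longrightarrow> u x = u' x" for u u'
    unfolding Q_def using that by (intro sum.cong refl) simp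
  have n2_cong: "n2 u = n2 u'" if "\<And>x. x \<in> A \<Longrightarrow> u x = u' x" for u u'
    unfolding n2_def using that by (intro sum.cong refl) simp
  have lin_cong: "lin u = lin u'" if "\<And>x. x \<in> A \<Longrightarrow> u x = u' x" for u u'
    unfolding lin_def using that by (intro sum.cong refl) simp
  \<comment> \<open>The bounds on coordinates in \<open>A\<close> follow from
    \<open>n2 u = 1\<close>, and coordinates outside \<open>A\<close> are pinned to 0. This makes
    \<open>K\<close> a closed part of a product of compact intervals.\<close>
  define K where "K = {u. (\<forall>x. if x \<in> A then \<bar>u x\<bar> \<le> 1 / sqrt (D x) else u x = 0) \<and> n2 u = 1 \<and> lin u = 0}"
  have contQ: "continuous_on UNIV Q" and contn2: "continuous_on UNIV n2" and contlin: "continuous_on UNIV lin"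
    unfolding Q_def n2_def lin_def by (intro continuous_intros continuous_on_product_coordinates)+
  have norm_in_K: "(\<lambda>x. if x \<in> A then u x / sqrt (n2 u) else 0) \<in> K" if "lin u = 0" "n2 u > 0" for u
  proof -
    let ?w = "\<lambda>x. if x \<in> A then u x / sqrt (n2 u) else 0"
    have w: "n2 ?w = n2 (\<lambda>x. (1 / sqrt (n2 u)) * u x)" "lin ?w = lin (\<lambda>x. (1 / sqrt (n2 u)) * u x)"
      by (auto intro!: n2_cong lin_cong)
    have 1: "n2 ?w = 1" using w(1) that(2) unfolding n2_scale by (simp add: power_divide)
    have 2: "lin ?w = 0" using w(2) that(1) unfolding lin_scale by simp
    have "\<bar>?w x\<bar> \<le> 1 / sqrt (D x)" if "x \<in> A" for x
    proof -
      have "D x * (?w x)^2 \<le> n2 ?w" unfolding n2_def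
        by (rule member_le_sum[OF that]) (use A pos in \<open>auto simp: less_imp_le\<close>)
      then have "(?w x)^2 \<le> 1 / D x" using 1 pos[OF that] by (simp add: field_simps)
      then have "sqrt ((?w x)^2) \<le> sqrt (1 / D x)" by (rule real_sqrt_le_mono)
      then show ?thesis by (simp only: real_sqrt_abs real_sqrt_divide real_sqrt_one)
    qed
    then show ?thesis unfolding K_def using 1 2 by auto
  qed
  have "n2 v \<noteq> 0"
  proof
    assume "n2 v = 0"
    then have "Q v = Q (\<lambda>_. 0)" by (intro Q_cong) (auto dest: n2_zero)
    then show False using Qv by (simp add: Q_def)
  qed
  then have n2v: "n2 v > 0" using n2_nonneg[of v] by linarith
  have "compact {u. \<forall>x. if x \<in> A then \<bar>u x\<bar> \<le> 1 / sqrt (D x) else u x = 0}"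
  proof -
    have "compactin (product_topology (\<lambda>_. euclidean) UNIV)
       (PiE UNIV (\<lambda>x. if x \<in> A then {- (1 / sqrt (D x))..1 / sqrt (D x)} else {0}))"
      by (subst compactin_PiE) auto
    also have "(PiE UNIV (\<lambda>x. if x \<in> A then {- (1 / sqrt (D x))..1 / sqrt (D x)} else {0})) =
        {u. \<forall>x. if x \<in> A then \<bar>u x\<bar> \<le> 1 / sqrt (D x) else u x = 0}"
      by (auto simp: PiE_def Pi_def abs_le_iff)
    finally show ?thesis by (simp add: euclidean_product_topology)
  qed
  moreover have "closed {u. n2 u = 1 \<and> lin u = 0}"
    using contn2 contlin by (intro closed_Collect_conj closed_Collect_eq) auto
  ultimately have "compact ({u. \<forall>x. if x \<in> A then \<bar>u x\<bar> \<le> 1 / sqrt (D x) else u x = 0} \<inter> {u. n2 u = 1 \<and> lin u = 0})"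
    by (rule compact_Int_closed)
  then have "compact K" unfolding K_def by (simp add: Collect_conj_eq[symmetric])
  moreover have "K \<noteq> {}" using norm_in_K[of v] n2v orth unfolding lin_def by blast
  ultimately obtain f where f: "f \<in> K" "\<And>u. u \<in> K \<Longrightarrow> Q u \<le> Q f"
    using continuous_attains_sup[of K Q] continuous_on_subset[OF contQ] by blast
  define l where "l = Q f"
  have n2f: "n2 f = 1" and linf: "lin f = 0" using f(1) unfolding K_def by auto
  have ray: "Q u \<le> l * n2 u" if "lin u = 0" for u
  proof (cases "n2 u = 0")
    case True
    then have "Q u = Q (\<lambda>_. 0)" by (intro Q_cong) (auto dest: n2_zero)
    then show ?thesis using True by (simp add: Q_def)
  next
    case False
    then have n2u: "n2 u > 0" using n2_nonneg[of u] by linarith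
    have "Q (\<lambda>x. if x \<in> A then u x / sqrt (n2 u) else 0) = Q (\<lambda>x. (1 / sqrt (n2 u)) * u x)"
      by (intro Q_cong) auto
    then have "Q (\<lambda>x. if x \<in> A then u x / sqrt (n2 u) else 0) = Q u / n2 u"
      unfolding Q_scale using n2u by (simp add: power_divide)
    then have "Q u / n2 u \<le> l" using f(2)[OF norm_in_K[OF that n2u]] unfolding l_def by simp
    then show ?thesis using n2u by (simp add: field_simps)
  qed
  have lpos: "l > 0" using ray[of v] Qv n2v orth unfolding lin_def
    by (meson less_le_trans not_le zero_less_mult_pos2)
  define Wf where "Wf x = (\<Sum>y\<in>A. W x y * f y)" for x
  have Wf_total: "(\<Sum>x\<in>A. Wf x) = 0"
  proof -
    have "(\<Sum>x\<in>A. Wf x) = (\<Sum>y\<in>A. \<Sum>x\<in>A. W x y * f y)"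
      unfolding Wf_def by (rule sum.swap)
    also have "\<dots> = (\<Sum>y\<in>A. D y * f y)"
      by (intro sum.cong refl) (simp add: D sum_distrib_right sym)
    finally show ?thesis using linf unfolding lin_def by simp
  qed
  \<comment> \<open>Perturbing the maximiser by \<open>s * w\<close> stays inside
    \<open>lin = 0\<close>, so \<open>ray\<close> applies for every \<open>s\<close> and the term
    linear in \<open>s\<close> must vanish. This is the eigenvalue equation tested against
    \<open>w\<close>.\<close>
  have stationary: "(\<Sum>x\<in>A. w x * (Wf x - l * D x * f x)) = 0" if w: "lin w = 0" for w
  proof -
    let ?B = "\<Sum>x\<in>A. w x * Wf x"
    let ?C = "\<Sum>x\<in>A. D x * (w x * f x)"
    have Q_add: "Q (\<lambda>x. f x + s * w x) = Q f + 2 * s * ?B + s^2 * Q w" for s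
    proof -
      have "Q (\<lambda>x. f x + s * w x) = Q f + s * (\<Sum>x\<in>A. \<Sum>y\<in>A. w x * f y * W x y) +
          s * (\<Sum>x\<in>A. \<Sum>y\<in>A. f x * w y * W x y) + s^2 * Q w"
        unfolding Q_def by (simp add: sum.distrib[symmetric] sum_distrib_left algebra_simps power2_eq_square)
      moreover have "(\<Sum>x\<in>A. \<Sum>y\<in>A. w x * f y * W x y) = ?B"
        unfolding Wf_def by (simp add: sum_distrib_left mult_ac)
      moreover have "(\<Sum>x\<in>A. \<Sum>y\<in>A. f x * w y * W x y) = (\<Sum>y\<in>A. \<Sum>x\<in>A. f x * w y * W x y)"
        by (rule sum.swap)
      moreover have "\<dots> = ?B"
        unfolding Wf_def by (intro sum.cong refl) (simp add: sum_distrib_left sym mult_ac)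
      ultimately show ?thesis by (simp add: algebra_simps)
    qed
    have n2_add: "n2 (\<lambda>x. f x + s * w x) = n2 f + 2 * s * ?C + s^2 * n2 w" for s
      unfolding n2_def by (simp add: sum.distrib[symmetric] sum_distrib_left algebra_simps power2_eq_square)
    have lin_add: "lin (\<lambda>x. f x + s * w x) = 0" for s
    proof -
      have "lin (\<lambda>x. f x + s * w x) = lin f + s * lin w"
        unfolding lin_def by (simp add: sum.distrib[symmetric] sum_distrib_left algebra_simps)
      then show ?thesis using linf w by simp
    qed
    have "2 * (?B - l * ?C) = 0"
    proof (rule linear_coeff_zero_if_quadratic_nonpos)
      fix s
      show "2 * (?B - l * ?C) * s + (Q w - l * n2 w) * s^2 \<le> 0"
        using ray[OF lin_add[of s]] unfolding Q_add n2_add n2f l_def by (simp add: algebra_simps)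
    qed
    then have "?B - l * ?C = 0" by (metis mult_eq_0_iff zero_neq_numeral)
    then show ?thesis by (simp add: algebra_simps sum_subtractf sum_distrib_left)
  qed
  have Dtot: "(\<Sum>x\<in>A. D x) > 0" using A star(1) pos by (intro sum_pos) auto
  have eigen: "Wf x = l * D x * f x" if "x \<in> A" for x
  proof -
    \<comment> \<open>Subtracting \<open>k\<close> makes the indicator of \<open>x\<close>
      orthogonal to the constants. The constant part contributes nothing, since the residuals
      \<open>Wf y - l * D y * f y\<close> sum to zero.\<close>
    define k where "k = D x / (\<Sum>x\<in>A. D x)"
    define w where "w = (\<lambda>y. (if y = x then 1 else 0) - k)"
    have mult_w: "h y * w y = (if y = x then h y else 0) - h y * k" for h :: "'a \<Rightarrow> real" and y
      unfolding w_def by (simp add: right_diff_distrib)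
    have "lin w = D x - (\<Sum>x\<in>A. D x) * k"
      unfolding lin_def mult_w using that A by (simp add: sum_subtractf sum_distrib_right)
    then have "lin w = 0" using Dtot unfolding k_def by simp
    define h where "h y = Wf y - l * D y * f y" for y
    have "(\<Sum>y\<in>A. h y * w y) = h x - (\<Sum>y\<in>A. h y) * k"
      unfolding mult_w using that A by (simp add: sum_subtractf sum_distrib_right)
    with stationary[OF \<open>lin w = 0\<close>] have "h x - (\<Sum>y\<in>A. h y) * k = 0"
      unfolding h_def by (simp add: mult.commute)
    moreover have "(\<Sum>y\<in>A. Wf y - l * D y * f y) = 0"
      using Wf_total linf unfolding lin_def by (simp add: sum_subtractf sum_distrib_left[symmetric] mult.assoc)
    ultimately show ?thesis unfolding h_def by simp
  qed
  have "l \<le> l^2"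
  proof -
    have "Q f \<le> (\<Sum>x\<in>A. (Wf x)^2 / D x)" using step[of f] unfolding Q_def Wf_def .
    also have "\<dots> = (\<Sum>x\<in>A. l^2 * (D x * (f x)^2))"
    proof (intro sum.cong refl)
      fix x assume "x \<in> A"
      then show "(Wf x)^2 / D x = l^2 * (D x * (f x)^2)"
        using pos[of x] eigen[of x] by (simp add: power2_eq_square field_simps)
    qed
    also have "\<dots> = l^2 * n2 f" unfolding n2_def by (simp add: sum_distrib_left)
    finally show ?thesis using n2f unfolding l_def by simp
  qed
  then have l1: "l \<ge> 1" using lpos by (simp add: power2_eq_square)
  \<comment> \<open>The Dirichlet form of \<open>f\<close> equals \<open>2 - 2 * l \<le> 0\<close>,
    so \<open>f\<close> takes equal values at the ends of every edge of positive weight.\<close>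
  have "(\<Sum>x\<in>A. \<Sum>y\<in>A. W x y * (f x - f y)^2) = 2 * n2 f - 2 * Q f"
  proof -
    have "(\<Sum>x\<in>A. \<Sum>y\<in>A. W x y * (f x - f y)^2) = (\<Sum>x\<in>A. \<Sum>y\<in>A. W x y * (f x)^2) +
        (\<Sum>x\<in>A. \<Sum>y\<in>A. W x y * (f y)^2) - 2 * Q f"
      unfolding Q_def by (simp add: sum.distrib[symmetric] sum_subtractf[symmetric] sum_distrib_left power2_eq_square algebra_simps)
    moreover have "(\<Sum>x\<in>A. \<Sum>y\<in>A. W x y * (f x)^2) = n2 f"
      unfolding n2_def by (intro sum.cong refl) (simp add: D sum_distrib_right)
    moreover have "(\<Sum>x\<in>A. \<Sum>y\<in>A. W x y * (f y)^2) = (\<Sum>y\<in>A. \<Sum>x\<in>A. W x y * (f y)^2)"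
      by (rule sum.swap)
    moreover have "\<dots> = n2 f"
      unfolding n2_def by (intro sum.cong refl) (simp add: D sum_distrib_right sym)
    ultimately show ?thesis by simp
  qed
  then have le0: "(\<Sum>x\<in>A. \<Sum>y\<in>A. W x y * (f x - f y)^2) \<le> 0" using l1 n2f unfolding l_def by simp
  have const: "f x = f star" if "x \<in> A" for x
  proof -
    have "W star x * (f star - f x)^2 \<le> (\<Sum>y\<in>A. W star y * (f star - f y)^2)"
      by (rule member_le_sum[OF that]) (use A nonneg star in auto)
    also have "\<dots> \<le> (\<Sum>x\<in>A. \<Sum>y\<in>A. W x y * (f x - f y)^2)"
      by (rule member_le_sum[OF star(1)]) (use A nonneg in \<open>auto intro!: sum_nonneg\<close>)
    also have "\<dots> \<le> 0" by (rule le0)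
    finally show ?thesis using star(2)[OF that] by (simp add: mult_le_0_iff)
  qed
  have "f star * (\<Sum>x\<in>A. D x) = lin f"
    unfolding lin_def sum_distrib_left by (intro sum.cong refl) (simp add: const)
  then have "f star = 0" using linf Dtot by simp
  then have "n2 f = 0" unfolding n2_def using const by simp
  then show False using n2f by simp
qed

text \<open>Letters of degree zero are dropped and \<open>u\<close> is centred at its
  \<open>D\<close>-weighted mean \<open>m\<close>. The previous lemma applies to the centred vector,
  and expanding its quadratic form turns the sign condition into the product inequality.\<close>

lemma reverse_cauchy_schwarz_of_trickle:
  fixes W :: "'a \<Rightarrow> 'a \<Rightarrow> real"
  assumes A: "finite A"
    and sym: "\<And>x y. x \<in> A \<Longrightarrow> y \<in> A \<Longrightarrow> W x y = W y x"
    and nonneg: "\<And>x y. x \<in> A \<Longrightarrow> y \<in> A \<Longrightarrow> 0 \<le> W x y"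
    and D: "\<And>x. x \<in> A \<Longrightarrow> D x = (\<Sum>y\<in>A. W x y)"
    and star: "star \<in> A" "\<And>x. x \<in> A \<Longrightarrow> 0 < D x \<Longrightarrow> 0 < W star x"
    and step: "\<And>u. (\<Sum>x\<in>A. \<Sum>y\<in>A. u x * u y * W x y) \<le> (\<Sum>x\<in>A. (\<Sum>y\<in>A. W x y * u y)^2 / D x)"
  shows "(\<Sum>x\<in>A. \<Sum>y\<in>A. u x * u y * W x y) * (\<Sum>x\<in>A. D x) \<le> (\<Sum>x\<in>A. D x * u x)^2"
proof -
  define X where "X = {x\<in>A. D x > 0}"
  have Dnn: "D x \<ge> 0" if "x \<in> A" for x using that by (auto simp: D intro!: sum_nonneg nonneg)
  have zero: "W x y = 0" "W y x = 0" if "x \<in> A - X" "y \<in> A" for x y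
  proof -
    have "D x = 0" using that Dnn[of x] unfolding X_def by auto
    then have "\<forall>y\<in>A. W x y = 0"
      using that nonneg A by (subst (asm) D, simp, subst (asm) sum_nonneg_eq_0_iff) auto
    then show "W x y = 0" "W y x = 0" using that sym[of y x] by auto
  qed
  have X: "X \<subseteq> A" "finite X" using A unfolding X_def by auto
  have restr: "(\<Sum>x\<in>A. h x) = (\<Sum>x\<in>X. h x)" if "\<And>x. x \<in> A - X \<Longrightarrow> h x = 0" for h :: "'a \<Rightarrow> real"
    by (rule sum.mono_neutral_right) (use A X that in auto)
  have restrW: "(\<Sum>y\<in>A. W x y * u y) = (\<Sum>y\<in>X. W x y * u y)" if "x \<in> A" for x u
    by (rule restr) (use zero that in auto)
  have restrQ: "(\<Sum>x\<in>A. \<Sum>y\<in>A. u x * u y * W x y) = (\<Sum>x\<in>X. \<Sum>y\<in>X. u x * u y * W x y)" for u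
  proof -
    have "(\<Sum>x\<in>A. \<Sum>y\<in>A. u x * u y * W x y) = (\<Sum>x\<in>X. \<Sum>y\<in>A. u x * u y * W x y)"
      by (rule restr) (use zero in simp)
    also have "\<dots> = (\<Sum>x\<in>X. \<Sum>y\<in>X. u x * u y * W x y)"
      by (intro sum.cong refl restr) (use zero X in auto)
    finally show ?thesis .
  qed
  have D0: "D x = 0" if "x \<in> A - X" for x using that Dnn[of x] unfolding X_def by auto
  show ?thesis
  proof (cases "X = {}")
    case True
    then show ?thesis unfolding restrQ by simp
  next
    case False
    then obtain x0 where x0: "x0 \<in> A" "D x0 > 0" unfolding X_def by auto
    have DX: "D x = (\<Sum>y\<in>X. W x y)" if "x \<in> X" for x
      using restrW[of x "\<lambda>_. 1"] that X by (auto simp: D)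
    have "star \<in> X"
      using star(1) star(2)[OF x0] zero(1)[of star x0] x0 by (cases "star \<in> X") auto
    have total: "(\<Sum>x\<in>A. D x) = (\<Sum>x\<in>X. D x)" by (rule restr) (rule D0)
    have lin: "(\<Sum>x\<in>A. D x * u x) = (\<Sum>x\<in>X. D x * u x)" by (rule restr) (simp add: D0)
    have pos: "(\<Sum>x\<in>X. D x) > 0" using False X by (intro sum_pos) (auto simp: X_def)
    define m where "m = (\<Sum>x\<in>X. D x * u x) / (\<Sum>x\<in>X. D x)"
    define v where "v x = u x - m" for x
    have "(\<Sum>x\<in>X. \<Sum>y\<in>X. v x * v y * W x y) \<le> 0"
    proof (rule quadratic_form_nonpos_of_trickle[where D = D and star = star])
      show "(\<Sum>x\<in>X. \<Sum>y\<in>X. u x * u y * W x y) \<le> (\<Sum>x\<in>X. (\<Sum>y\<in>X. W x y * u y)\<^sup>2 / D x)" for u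
      proof -
        have "(\<Sum>x\<in>A. (\<Sum>y\<in>A. W x y * u y)\<^sup>2 / D x) = (\<Sum>x\<in>X. (\<Sum>y\<in>A. W x y * u y)\<^sup>2 / D x)"
          by (rule restr) (simp add: D0)
        also have "\<dots> = (\<Sum>x\<in>X. (\<Sum>y\<in>X. W x y * u y)\<^sup>2 / D x)"
          using X restrW by (intro sum.cong refl) (auto simp: subset_iff)
        finally show ?thesis using step[of u] unfolding restrQ by simp
      qed
      have "(\<Sum>x\<in>X. D x * v x) = (\<Sum>x\<in>X. D x * u x) - (\<Sum>x\<in>X. D x) * m"
        unfolding v_def by (simp add: right_diff_distrib sum_subtractf sum_distrib_right)
      then show "(\<Sum>x\<in>X. D x * v x) = 0" using pos unfolding m_def by simp
      show "0 < W star x" if "x \<in> X" for x using that star(2)[of x] unfolding X_def by auto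
      show "W x y = W y x" if "x \<in> X" "y \<in> X" for x y using that X(1) sym by blast
      show "0 \<le> W x y" if "x \<in> X" "y \<in> X" for x y using that X(1) nonneg by blast
      show "0 < D x" if "x \<in> X" for x using that unfolding X_def by blast
    qed (fact X(2) DX \<open>star \<in> X\<close>)+
    moreover have "(\<Sum>x\<in>X. \<Sum>y\<in>X. v x * v y * W x y) =
       (\<Sum>x\<in>X. \<Sum>y\<in>X. u x * u y * W x y) - m * (\<Sum>x\<in>X. D x * u x) - m * (\<Sum>x\<in>X. D x * u x) + m^2 * (\<Sum>x\<in>X. D x)"
    proof -
      have 1: "(\<Sum>x\<in>X. \<Sum>y\<in>X. u x * m * W x y) = m * (\<Sum>x\<in>X. D x * u x)"
        by (simp add: sum_distrib_left sum_distrib_right DX mult_ac)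
      have "(\<Sum>x\<in>X. \<Sum>y\<in>X. m * u y * W x y) = (\<Sum>y\<in>X. \<Sum>x\<in>X. m * u y * W x y)" by (rule sum.swap)
      also have "\<dots> = m * (\<Sum>x\<in>X. D x * u x)"
        unfolding sum_distrib_left
      proof (intro sum.cong refl)
        fix y assume "y \<in> X"
        then have "D y = (\<Sum>x\<in>X. W x y)" using DX[of y] sym X by (auto intro!: sum.cong)
        then show "(\<Sum>x\<in>X. m * u y * W x y) = m * (D y * u y)" by (simp add: sum_distrib_left mult_ac)
      qed
      finally have 2: "(\<Sum>x\<in>X. \<Sum>y\<in>X. m * u y * W x y) = m * (\<Sum>x\<in>X. D x * u x)" .
      have 3: "(\<Sum>x\<in>X. \<Sum>y\<in>X. m * m * W x y) = m^2 * (\<Sum>x\<in>X. D x)"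
        by (simp add: sum_distrib_left DX power2_eq_square mult_ac)
      have "(\<Sum>x\<in>X. \<Sum>y\<in>X. v x * v y * W x y) = (\<Sum>x\<in>X. \<Sum>y\<in>X. u x * u y * W x y) -
         (\<Sum>x\<in>X. \<Sum>y\<in>X. u x * m * W x y) - (\<Sum>x\<in>X. \<Sum>y\<in>X. m * u y * W x y) + (\<Sum>x\<in>X. \<Sum>y\<in>X. m * m * W x y)"
        unfolding v_def by (simp add: sum.distrib[symmetric] sum_subtractf[symmetric] algebra_simps)
      then show ?thesis using 1 2 3 by simp
    qed
    moreover have "m * (\<Sum>x\<in>X. D x) = (\<Sum>x\<in>X. D x * u x)" using pos unfolding m_def by simp
    ultimately have "(\<Sum>x\<in>X. \<Sum>y\<in>X. u x * u y * W x y) \<le> m * (\<Sum>x\<in>X. D x * u x)"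
      by (simp add: power2_eq_square mult.assoc)
    then have "(\<Sum>x\<in>X. \<Sum>y\<in>X. u x * u y * W x y) * (\<Sum>x\<in>X. D x) \<le> m * (\<Sum>x\<in>X. D x * u x) * (\<Sum>x\<in>X. D x)"
      using pos by (intro mult_right_mono) auto
    also have "\<dots> = (\<Sum>x\<in>X. D x * u x)^2" using pos unfolding m_def by (simp add: power2_eq_square)
    finally show ?thesis unfolding restrQ total lin .
  qed
qed

text \<open>An exchangeable law on words: \<open>g M\<close> is the mass of any one ordering of
  \<open>M\<close> as a prefix, and depending on the multiset alone is exchangeability.
  \<open>weight_sum\<close> is marginalisation over the next letter.\<close>

locale level_weights =
  fixes A :: "'a set" and N :: nat and g :: "'a multiset \<Rightarrow> real"
  assumes finite_letters: "finite A"
    and weight_nonneg: "\<And>M. 0 \<le> g M"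
    and weight_sum: "\<And>M. size M < N \<Longrightarrow> g M = (\<Sum>a\<in>A. g (add_mset a M))"
begin

definition quad :: "'a multiset \<Rightarrow> ('a \<Rightarrow> real) \<Rightarrow> real" where
  "quad M u = (\<Sum>x\<in>A. \<Sum>y\<in>A. u x * u y * g (add_mset x (add_mset y M)))"

text \<open>Reverse Cauchy-Schwarz against the constant vector. While
  \<open>size M + 2 \<le> N\<close>, it says that the matrix of the masses of the next two letters
  has at most one positive eigenvalue.\<close>

definition lorentzian_at :: "'a multiset \<Rightarrow> bool" where
  "lorentzian_at M \<longleftrightarrow> (\<forall>u. quad M u * g M \<le> (\<Sum>x\<in>A. g (add_mset x M) * u x)^2)"

lemma weight_zero_add:
  assumes "size M < N" "g M = 0" "a \<in> A" shows "g (add_mset a M) = 0"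
  using weight_sum[OF assms(1)] assms finite_letters weight_nonneg by (simp add: sum_nonneg_eq_0_iff)

text \<open>By \<open>weight_sum\<close> the quadratic form at \<open>M\<close> is the sum of the
  forms at \<open>add_mset z M\<close>. Bounding each of these by its own reverse Cauchy-Schwarz
  inequality yields exactly the hypothesis \<open>step\<close> of
  \<open>reverse_cauchy_schwarz_of_trickle\<close>. The strict bound on the size leaves room for the
  third letter.\<close>

lemma trickle_down:
  assumes size: "size M + 2 < N"
    and star: "star \<in> A" "\<And>x. x \<in> A \<Longrightarrow> 0 < g (add_mset x M) \<Longrightarrow> 0 < g (add_mset star (add_mset x M))"
    and link: "\<And>z. z \<in> A \<Longrightarrow> lorentzian_at (add_mset z M)"
  shows "lorentzian_at M"
  unfolding lorentzian_at_def
proof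
  fix u
  let ?D = "\<lambda>x. g (add_mset x M)"
  have "(\<Sum>x\<in>A. \<Sum>y\<in>A. u x * u y * g (add_mset x (add_mset y M))) * (\<Sum>x\<in>A. ?D x) \<le> (\<Sum>x\<in>A. ?D x * u x)^2"
  proof (rule reverse_cauchy_schwarz_of_trickle[where star = star])
    fix u
    have "(\<Sum>x\<in>A. \<Sum>y\<in>A. u x * u y * g (add_mset x (add_mset y M))) =
        (\<Sum>x\<in>A. \<Sum>y\<in>A. \<Sum>z\<in>A. u x * u y * g (add_mset x (add_mset y (add_mset z M))))"
      using size by (intro sum.cong refl, subst weight_sum) (simp_all add: sum_distrib_left add_mset_commute)
    also have "\<dots> = (\<Sum>z\<in>A. quad (add_mset z M) u)"
    proof -
      have "(\<Sum>x\<in>A. \<Sum>y\<in>A. \<Sum>z\<in>A. h x y z) = (\<Sum>z\<in>A. \<Sum>x\<in>A. \<Sum>y\<in>A. h x y z)" for h :: "'a \<Rightarrow> 'a \<Rightarrow> 'a \<Rightarrow> real"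
      proof -
        have "(\<Sum>x\<in>A. \<Sum>y\<in>A. \<Sum>z\<in>A. h x y z) = (\<Sum>x\<in>A. \<Sum>z\<in>A. \<Sum>y\<in>A. h x y z)"
          by (intro sum.cong refl sum.swap)
        also have "\<dots> = (\<Sum>z\<in>A. \<Sum>x\<in>A. \<Sum>y\<in>A. h x y z)" by (rule sum.swap)
        finally show ?thesis .
      qed
      then show ?thesis unfolding quad_def .
    qed
    also have "\<dots> \<le> (\<Sum>z\<in>A. (\<Sum>y\<in>A. g (add_mset z (add_mset y M)) * u y)^2 / ?D z)"
    proof (intro sum_mono)
      fix z assume z: "z \<in> A"
      have sz: "size (add_mset z M) < N" using size by simp
      show "quad (add_mset z M) u \<le> (\<Sum>y\<in>A. g (add_mset z (add_mset y M)) * u y)^2 / ?D z"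
      proof (cases "?D z = 0")
        case True
        then have "quad (add_mset z M) u = 0"
          unfolding quad_def using weight_zero_add[OF sz True] weight_zero_add size
          by (intro sum.neutral ballI) (simp add: weight_zero_add)
        then show ?thesis using True by simp
      next
        case False
        then have "?D z > 0" using weight_nonneg[of "add_mset z M"] by simp
        then show ?thesis
          using link[OF z, unfolded lorentzian_at_def, rule_format, of u]
          by (simp add: pos_le_divide_eq add_mset_commute)
      qed
    qed
    finally show "(\<Sum>x\<in>A. \<Sum>y\<in>A. u x * u y * g (add_mset x (add_mset y M)))
      \<le> (\<Sum>z\<in>A. (\<Sum>y\<in>A. g (add_mset z (add_mset y M)) * u y)^2 / ?D z)" .
  next
    fix x assume "x \<in> A"
    show "g (add_mset x M) = (\<Sum>y\<in>A. g (add_mset x (add_mset y M)))"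
      using size by (subst weight_sum) (simp_all add: add_mset_commute)
  qed (use star finite_letters weight_nonneg in \<open>auto simp: add_mset_commute\<close>)
  then show "quad M u * g M \<le> (\<Sum>x\<in>A. ?D x * u x)^2"
    unfolding quad_def using weight_sum[of M] size by simp
qed

end

section \<open>Entropy of exchangeable laws\<close>

definition rel_ent :: "real \<Rightarrow> real \<Rightarrow> real" where
  "rel_ent a b = a * ln (a / b)"

lemma rel_ent_zero [simp]: "rel_ent 0 b = 0" by (simp add: rel_ent_def)

lemma diff_le_mult_ln_diff:
  fixes a b :: real
  assumes "a > 0" "b > 0"
  shows "a - b \<le> a * (ln a - ln b)"
proof -
  have "ln (b / a) \<le> b / a - 1" using assms by (intro ln_le_minus_one) simp
  then have "a * ln (b / a) \<le> a * (b / a - 1)" using assms by (intro mult_left_mono) auto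
  then show ?thesis using assms by (simp add: ln_div right_diff_distrib)
qed

text \<open>With \<open>v = f1 / g1\<close>, compare \<open>f2 x y\<close> with
  \<open>(g0 / f0) * (v x * v y * g2 x y)\<close>. The logarithm of the latter splits into parts
  that sum to the middle and outer entropies, and by \<open>rcs\<close> at \<open>u = v\<close> its
  total mass is at most \<open>f0\<close>, the mass of \<open>f2\<close>.\<close>

lemma local_entropy_inequality:
  fixes f2 g2 :: "'a \<Rightarrow> 'a \<Rightarrow> real" and f1 g1 :: "'a \<Rightarrow> real" and f0 g0 :: real
  assumes A: "finite A"
    and nn: "\<And>x y. x \<in> A \<Longrightarrow> y \<in> A \<Longrightarrow> 0 \<le> f2 x y" "\<And>x y. x \<in> A \<Longrightarrow> y \<in> A \<Longrightarrow> 0 \<le> g2 x y"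
    and sym: "\<And>x y. x \<in> A \<Longrightarrow> y \<in> A \<Longrightarrow> f2 x y = f2 y x"
    and f1: "\<And>x. x \<in> A \<Longrightarrow> f1 x = (\<Sum>y\<in>A. f2 x y)" and g1: "\<And>x. x \<in> A \<Longrightarrow> g1 x = (\<Sum>y\<in>A. g2 x y)"
    and f0: "f0 = (\<Sum>x\<in>A. f1 x)" and g0: "g0 = (\<Sum>x\<in>A. g1 x)"
    and ac: "\<And>x y. x \<in> A \<Longrightarrow> y \<in> A \<Longrightarrow> g2 x y = 0 \<Longrightarrow> f2 x y = 0"
    and rcs: "\<And>u. (\<Sum>x\<in>A. \<Sum>y\<in>A. u x * u y * g2 x y) * g0 \<le> (\<Sum>x\<in>A. g1 x * u x)^2"
  shows "2 * (\<Sum>x\<in>A. rel_ent (f1 x) (g1 x)) \<le> (\<Sum>x\<in>A. \<Sum>y\<in>A. rel_ent (f2 x y) (g2 x y)) + rel_ent f0 g0"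
proof -
  have f1nn: "f1 x \<ge> 0" if "x \<in> A" for x using that by (auto simp: f1 intro!: sum_nonneg nn)
  have g1nn: "g1 x \<ge> 0" if "x \<in> A" for x using that by (auto simp: g1 intro!: sum_nonneg nn)
  have f2_le: "f2 x y \<le> f1 x" if "x \<in> A" "y \<in> A" for x y
    unfolding f1[OF that(1)] by (rule member_le_sum[OF that(2)]) (use A nn that in auto)
  have g2_le: "g2 x y \<le> g1 x" if "x \<in> A" "y \<in> A" for x y
    unfolding g1[OF that(1)] by (rule member_le_sum[OF that(2)]) (use A nn that in auto)
  have f1_le: "f1 x \<le> f0" if "x \<in> A" for x
    unfolding f0 by (rule member_le_sum[OF that]) (use A f1nn that in auto)
  have g1_le: "g1 x \<le> g0" if "x \<in> A" for x
    unfolding g0 by (rule member_le_sum[OF that]) (use A g1nn that in auto)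
  have ac1: "f1 x = 0" if "x \<in> A" "g1 x = 0" for x
    unfolding f1[OF that(1)]
    using g2_le[OF that(1)] that nn ac by (intro sum.neutral ballI) (metis order_antisym)
  have f0nn: "f0 \<ge> 0" unfolding f0 by (intro sum_nonneg f1nn)
  show ?thesis
  proof (cases "f0 = 0")
    case True
    then have f10: "f1 x = 0" if "x \<in> A" for x using f1_le[OF that] f1nn[OF that] by simp
    have "f2 x y = 0" if "x \<in> A" "y \<in> A" for x y
      using f2_le[OF that] nn(1)[OF that] f10[OF that(1)] by simp
    then show ?thesis using True f10 by simp
  next
    case False
    then have f0p: "f0 > 0" using f0nn by simp
    obtain x0 where x0: "x0 \<in> A" "f1 x0 \<noteq> 0"
    proof (rule ccontr)
      assume "\<not> thesis"
      then have "f0 = 0" unfolding f0 using that by (intro sum.neutral) blast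
      then show False using False by simp
    qed
    have "g1 x0 > 0" using ac1[OF x0(1)] g1nn[OF x0(1)] x0(2) by linarith
    then have g0p: "g0 > 0" using g1_le[OF x0(1)] by simp
    define v where "v x = f1 x / g1 x" for x
    have vg: "g1 x * v x = f1 x" if "x \<in> A" for x
      using ac1[OF that] unfolding v_def by (cases "g1 x = 0") auto
    have pointwise: "f2 x y - (g0 / f0) * (v x * v y * g2 x y) \<le>
        rel_ent (f2 x y) (g2 x y) - f2 x y * ln (v x) - f2 x y * ln (v y) + f2 x y * ln (f0 / g0)"
      if xy: "x \<in> A" "y \<in> A" for x y
    proof (cases "f2 x y = 0")
      case True
      have "0 \<le> (g0 / f0) * (v x * v y * g2 x y)"
        unfolding v_def using f0p g0p nn(2)[OF xy] xy by (intro mult_nonneg_nonneg divide_nonneg_nonneg f1nn g1nn) auto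
      then show ?thesis using True by simp
    next
      case False
      then have p: "f2 x y > 0" "g2 x y > 0" using nn[OF xy] ac[OF xy] False by linarith+
      have q: "f1 x > 0" "f1 y > 0" "g1 x > 0" "g1 y > 0"
        using p f2_le[OF xy] f2_le[OF xy(2,1)] sym[OF xy] g2_le[OF xy] ac1[OF xy(2)] g1nn[OF xy(2)] by linarith+
      have vp: "v x > 0" "v y > 0" using q unfolding v_def by auto
      define b where "b = (g0 / f0) * (v x * v y * g2 x y)"
      have bp: "b > 0" unfolding b_def using p vp f0p g0p by simp
      have lnb: "ln b = ln g0 - ln f0 + ln (v x) + ln (v y) + ln (g2 x y)"
        unfolding b_def using p vp f0p g0p by (simp add: ln_mult ln_div)
      have r: "rel_ent (f2 x y) (g2 x y) = f2 x y * (ln (f2 x y) - ln (g2 x y))"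
        unfolding rel_ent_def using p by (simp add: ln_div)
      have l0: "ln (f0 / g0) = ln f0 - ln g0" using f0p g0p by (simp add: ln_div)
      have "f2 x y - b \<le> f2 x y * (ln (f2 x y) - ln b)"
        using diff_le_mult_ln_diff[OF p(1) bp] .
      then show ?thesis unfolding r l0 lnb b_def[symmetric] by argo
    qed
    have "(\<Sum>x\<in>A. \<Sum>y\<in>A. f2 x y - (g0 / f0) * (v x * v y * g2 x y)) \<le>
       (\<Sum>x\<in>A. \<Sum>y\<in>A. rel_ent (f2 x y) (g2 x y) - f2 x y * ln (v x) - f2 x y * ln (v y) + f2 x y * ln (f0 / g0))"
      by (intro sum_mono pointwise)
    also have "\<dots> = (\<Sum>x\<in>A. \<Sum>y\<in>A. rel_ent (f2 x y) (g2 x y)) - (\<Sum>x\<in>A. \<Sum>y\<in>A. f2 x y * ln (v x))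
       - (\<Sum>x\<in>A. \<Sum>y\<in>A. f2 x y * ln (v y)) + (\<Sum>x\<in>A. \<Sum>y\<in>A. f2 x y * ln (f0 / g0))"
      by (simp add: sum.distrib sum_subtractf)
    also have "(\<Sum>x\<in>A. \<Sum>y\<in>A. f2 x y * ln (v x)) = (\<Sum>x\<in>A. rel_ent (f1 x) (g1 x))"
      unfolding rel_ent_def v_def by (intro sum.cong refl) (simp add: f1 sum_distrib_right)
    also have "(\<Sum>x\<in>A. \<Sum>y\<in>A. f2 x y * ln (v y)) = (\<Sum>y\<in>A. \<Sum>x\<in>A. f2 x y * ln (v y))"
      by (rule sum.swap)
    also have "\<dots> = (\<Sum>x\<in>A. rel_ent (f1 x) (g1 x))"
      unfolding rel_ent_def v_def by (intro sum.cong refl) (simp add: f1 sum_distrib_right sym)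
    also have "(\<Sum>x\<in>A. \<Sum>y\<in>A. f2 x y * ln (f0 / g0)) = rel_ent f0 g0"
    proof -
      have "(\<Sum>x\<in>A. \<Sum>y\<in>A. f2 x y) = f0"
        unfolding f0 by (intro sum.cong refl) (simp add: f1)
      then show ?thesis unfolding rel_ent_def by (simp add: sum_distrib_right[symmetric])
    qed
    finally have 1: "(\<Sum>x\<in>A. \<Sum>y\<in>A. f2 x y - (g0 / f0) * (v x * v y * g2 x y)) \<le>
       (\<Sum>x\<in>A. \<Sum>y\<in>A. rel_ent (f2 x y) (g2 x y)) - (\<Sum>x\<in>A. rel_ent (f1 x) (g1 x)) -
       (\<Sum>x\<in>A. rel_ent (f1 x) (g1 x)) + rel_ent f0 g0" .
    have "(\<Sum>x\<in>A. \<Sum>y\<in>A. f2 x y - (g0 / f0) * (v x * v y * g2 x y)) =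
       f0 - (\<Sum>x\<in>A. \<Sum>y\<in>A. v x * v y * g2 x y) * g0 / f0"
    proof -
      have "(\<Sum>x\<in>A. \<Sum>y\<in>A. f2 x y - (g0 / f0) * (v x * v y * g2 x y)) =
        (\<Sum>x\<in>A. \<Sum>y\<in>A. f2 x y) - (g0 / f0) * (\<Sum>x\<in>A. \<Sum>y\<in>A. v x * v y * g2 x y)"
        unfolding sum_subtractf sum_distrib_left ..
      moreover have "(\<Sum>x\<in>A. \<Sum>y\<in>A. f2 x y) = f0"
        unfolding f0 by (intro sum.cong refl) (simp add: f1)
      ultimately show ?thesis by (simp add: mult.commute)
    qed
    moreover have "(\<Sum>x\<in>A. \<Sum>y\<in>A. v x * v y * g2 x y) * g0 / f0 \<le> f0"
    proof -
      have "(\<Sum>x\<in>A. g1 x * v x) = f0" unfolding f0 by (intro sum.cong refl vg)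
      then show ?thesis using rcs[of v] f0p by (simp add: divide_le_eq power2_eq_square)
    qed
    ultimately show ?thesis using 1 by simp
  qed
qed

text \<open>The slopes \<open>a j / j\<close> of a convex sequence starting at 0 increase;
  denominators are cleared so that \<open>j = 0\<close> is covered.\<close>

lemma convex_seq_pred_le:
  fixes a :: "nat \<Rightarrow> real"
  assumes "a 0 = 0" "\<And>j. j + 2 \<le> N \<Longrightarrow> 2 * a (Suc j) \<le> a j + a (Suc (Suc j))"
  shows "Suc j \<le> N \<Longrightarrow> real (Suc j) * a j \<le> real j * a (Suc j)"
proof (induction j)
  case (Suc j)
  then have "real (Suc j) * a j \<le> real j * a (Suc j)" by simp
  moreover have "real (Suc j) * (2 * a (Suc j)) \<le> real (Suc j) * (a j + a (Suc (Suc j)))"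
    using Suc.prems by (intro mult_left_mono assms(2)) auto
  ultimately show ?case by (simp add: algebra_simps)
qed (use assms in simp)

text \<open>Sums \<open>F\<close> over all words of \<open>d\<close> letters appended to
  \<open>M\<close>, different orders being counted separately.\<close>

primrec lev :: "'a set \<Rightarrow> ('a multiset \<Rightarrow> real) \<Rightarrow> nat \<Rightarrow> 'a multiset \<Rightarrow> real" where
  "lev A F 0 M = F M"
| "lev A F (Suc d) M = (\<Sum>a\<in>A. lev A F d (add_mset a M))"

lemma lev_Suc_inner: "lev A F (Suc d) M = lev A (\<lambda>M. \<Sum>a\<in>A. F (add_mset a M)) d M"
  by (induction d arbitrary: M) simp_all

lemma lev_mono:
  "(\<And>M'. size M' = size M + d \<Longrightarrow> F M' \<le> G M') \<Longrightarrow> lev A F d M \<le> lev A G d M"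
  by (induction d arbitrary: M) (auto intro!: sum_mono)

lemma lev_add: "lev A (\<lambda>M. F M + G M) d M = lev A F d M + lev A G d M"
  by (induction d arbitrary: M) (auto simp: sum.distrib)

lemma lev_mult: "lev A (\<lambda>M. c * F M) d M = c * lev A F d M"
  by (induction d arbitrary: M) (auto simp: sum_distrib_left)

lemma lev_nonneg: "(\<And>M. 0 \<le> F M) \<Longrightarrow> 0 \<le> lev A F d M"
  by (induction d arbitrary: M) (auto intro!: sum_nonneg)

lemma level_weights_lev:
  assumes "finite A" "\<And>M. 0 \<le> F M"
  shows "level_weights A N (\<lambda>M. lev A F (N - size M) M)"
proof
  show "lev A F (N - size M) M = (\<Sum>a\<in>A. lev A F (N - size (add_mset a M)) (add_mset a M))"
    if "size M < N" for M
    using that by (cases "N - size M") (auto simp: Suc_diff_Suc[symmetric] intro!: sum.cong arg_cong[of _ _ "\<lambda>d. lev A F d _"])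
  show "0 \<le> lev A F (N - size M) M" for M by (rule lev_nonneg) (rule assms)
qed (rule assms)

context level_weights
begin

lemma entropy_contraction:
  fixes f :: "'a multiset \<Rightarrow> real"
  assumes f: "level_weights A N f"
    and ac: "\<And>M. g M = 0 \<Longrightarrow> f M = 0"
    and lor: "\<And>M. size M + 2 \<le> N \<Longrightarrow> lorentzian_at M"
    and norm: "g {#} = 1" "f {#} = 1"
    and N: "1 \<le> N"
  shows "real N * lev A (\<lambda>M. rel_ent (f M) (g M)) (N - 1) {#} \<le> real (N - 1) * lev A (\<lambda>M. rel_ent (f M) (g M)) N {#}"
proof -
  interpret f: level_weights A N f by (rule f)
  define \<phi> where "\<phi> M = rel_ent (f M) (g M)" for M
  have conv: "2 * lev A \<phi> (Suc j) {#} \<le> lev A \<phi> j {#} + lev A \<phi> (Suc (Suc j)) {#}" if j: "j + 2 \<le> N" for j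
  proof -
    \<comment> \<open>The local inequality at \<open>M\<close>, summed over all words of length
      \<open>j\<close>, is convexity at level \<open>Suc j\<close>.\<close>
    have "lev A (\<lambda>M. 2 * (\<Sum>a\<in>A. \<phi> (add_mset a M))) j {#} \<le>
        lev A (\<lambda>M. (\<Sum>a\<in>A. \<Sum>b\<in>A. \<phi> (add_mset b (add_mset a M))) + \<phi> M) j {#}"
    proof (rule lev_mono)
      fix M :: "'a multiset" assume "size M = size {#} + j"
      then have M: "size M + 2 \<le> N" using j by simp
      show "2 * (\<Sum>a\<in>A. \<phi> (add_mset a M)) \<le> (\<Sum>a\<in>A. \<Sum>b\<in>A. \<phi> (add_mset b (add_mset a M))) + \<phi> M"
        unfolding \<phi>_def
      proof (rule local_entropy_inequality)
        show "(\<Sum>x\<in>A. \<Sum>y\<in>A. u x * u y * g (add_mset y (add_mset x M))) * g M \<le> (\<Sum>x\<in>A. g (add_mset x M) * u x)^2" for u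
          using lor[OF M] unfolding lorentzian_at_def quad_def by (simp add: add_mset_commute)
        show "f M = (\<Sum>x\<in>A. f (add_mset x M))" using M by (intro f.weight_sum) simp
        show "g M = (\<Sum>x\<in>A. g (add_mset x M))" using M by (intro weight_sum) simp
        show "f (add_mset x M) = (\<Sum>y\<in>A. f (add_mset y (add_mset x M)))" for x
          using M by (intro f.weight_sum) simp
        show "g (add_mset x M) = (\<Sum>y\<in>A. g (add_mset y (add_mset x M)))" for x
          using M by (intro weight_sum) simp
      qed (use ac finite_letters weight_nonneg f.weight_nonneg in \<open>simp_all add: add_mset_commute\<close>)
    qed
    then show ?thesis unfolding lev_add lev_mult lev_Suc_inner by simp
  qed
  have "Suc (N - 1) \<le> N" using N by simp
  from convex_seq_pred_le[where a = "\<lambda>j. lev A \<phi> j {#}", OF _ conv this]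
  show ?thesis using N norm unfolding \<phi>_def by (simp add: rel_ent_def)
qed

end

section \<open>Independent sets as exchangeable words\<close>

text \<open>Cauchy-Schwarz over the fibres of \<open>q\<close>, of which there are at most
  \<open>card F\<close>. The double sum is the sum of the squares of the fibre sums.\<close>

lemma sum_square_le_classes:
  fixes s :: "'a \<Rightarrow> real"
  assumes "finite F"
  shows "(\<Sum>e\<in>F. s e)^2 \<le> real (card F) * (\<Sum>e\<in>F. \<Sum>e'\<in>{e'\<in>F. q e' = q e}. s e * s e')"
proof -
  let ?a = "\<lambda>y. \<Sum>e\<in>{e\<in>F. q e = y}. s e"
  have "(\<Sum>e\<in>F. s e)^2 = (\<Sum>y\<in>q ` F. ?a y)^2"
    using assms by (subst sum.group) auto
  also have "\<dots> \<le> (\<Sum>y\<in>q ` F. (?a y)^2) * real (card (q ` F))"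
    by (rule sum_squared_le_sum_of_squares)
  also have "\<dots> \<le> (\<Sum>y\<in>q ` F. (?a y)^2) * real (card F)"
    using card_image_le[OF assms, of q] by (intro mult_left_mono sum_nonneg) auto
  also have "(\<Sum>y\<in>q ` F. (?a y)^2) = (\<Sum>y\<in>q ` F. \<Sum>e\<in>{e\<in>F. q e = y}. \<Sum>e'\<in>{e'\<in>F. q e' = q e}. s e * s e')"
    by (intro sum.cong refl) (auto simp: power2_eq_square sum_product intro!: sum.cong)
  also have "\<dots> = (\<Sum>e\<in>F. \<Sum>e'\<in>{e'\<in>F. q e' = q e}. s e * s e')"
    using assms by (subst sum.group) auto
  finally show ?thesis by (simp add: mult.commute)
qed

text \<open>As a function of \<open>t\<close>, the form at \<open>u - t\<close> is a quadratic with
  leading coefficient \<open>g M\<close> and linear coefficient \<open>- 2 * ?L\<close>. If it is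
  nonpositive somewhere, its discriminant is nonnegative.\<close>

lemma (in level_weights) lorentzian_atI:
  assumes size: "size M + 2 \<le> N" and ex: "\<And>u. \<exists>t. quad M (\<lambda>x. u x - t) \<le> 0"
  shows "lorentzian_at M"
  unfolding lorentzian_at_def
proof
  fix u
  obtain t where t: "quad M (\<lambda>x. u x - t) \<le> 0" using ex by blast
  let ?L = "\<Sum>x\<in>A. g (add_mset x M) * u x"
  have row: "(\<Sum>y\<in>A. g (add_mset x (add_mset y M))) = g (add_mset x M)" for x
    using weight_sum[of "add_mset x M"] size by (simp add: add_mset_commute)
  have col: "(\<Sum>y\<in>A. g (add_mset y (add_mset x M))) = g (add_mset x M)" for x
    using weight_sum[of "add_mset x M"] size by simp
  have 1: "(\<Sum>x\<in>A. \<Sum>y\<in>A. u x * g (add_mset x (add_mset y M))) = ?L"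
    by (intro sum.cong refl) (simp add: sum_distrib_left[symmetric] row mult.commute)
  have "(\<Sum>x\<in>A. \<Sum>y\<in>A. u y * g (add_mset x (add_mset y M))) = (\<Sum>y\<in>A. \<Sum>x\<in>A. u y * g (add_mset x (add_mset y M)))"
    by (rule sum.swap)
  also have "\<dots> = ?L"
    by (intro sum.cong refl) (simp add: sum_distrib_left[symmetric] col mult.commute)
  finally have 2: "(\<Sum>x\<in>A. \<Sum>y\<in>A. u y * g (add_mset x (add_mset y M))) = ?L" .
  have 3: "(\<Sum>x\<in>A. \<Sum>y\<in>A. g (add_mset x (add_mset y M))) = g M"
    using weight_sum[of M] size by (simp add: row)
  have "quad M (\<lambda>x. u x - t) = quad M u
      - t * (\<Sum>x\<in>A. \<Sum>y\<in>A. u x * g (add_mset x (add_mset y M)))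
      - t * (\<Sum>x\<in>A. \<Sum>y\<in>A. u y * g (add_mset x (add_mset y M)))
      + t^2 * (\<Sum>x\<in>A. \<Sum>y\<in>A. g (add_mset x (add_mset y M)))"
    unfolding quad_def sum_distrib_left
    by (simp add: sum.distrib[symmetric] sum_subtractf[symmetric] algebra_simps power2_eq_square)
  then have "quad M u \<le> 2 * t * ?L - t^2 * g M" using t unfolding 1 2 3 by simp
  then have "quad M u * g M \<le> (2 * t * ?L - t^2 * g M) * g M"
    by (intro mult_right_mono weight_nonneg)
  also have "\<dots> = ?L^2 - (?L - t * g M)^2" by (simp add: power2_eq_square algebra_simps)
  also have "\<dots> \<le> ?L^2" by simp
  finally show "quad M u * g M \<le> ?L^2" .
qed

text \<open>Falling factorial: the number of words of length \<open>m\<close> made of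
  \<open>k\<close> given distinct elements and \<open>m - k\<close> stars.\<close>

definition falling :: "nat \<Rightarrow> nat \<Rightarrow> real" where
  "falling m k = (if k \<le> m then fact m / fact (m - k) else 0)"

text \<open>The last letter of the word is a star or one of the \<open>k\<close> elements.\<close>

lemma falling_Suc: "falling (Suc m) k = falling m k + real k * falling m (k - 1)"
proof -
  consider "k = 0" | "1 \<le> k" "k \<le> m" | "k = Suc m" | "k > Suc m" by linarith
  then show ?thesis
  proof cases
    case 2
    then obtain j where j: "m = k + j" by (metis le_add_diff_inverse)
    obtain i where i: "k = Suc i" using 2 by (cases k) auto
    define X :: real where "X = fact (Suc i + j)"
    define Y :: real where "Y = fact j"
    have "Y \<noteq> 0" unfolding Y_def by simp
    have "falling (Suc m) (Suc i) = (real i + real j + 2) * X / ((real j + 1) * Y)"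
      unfolding falling_def i j X_def Y_def by (simp add: Suc_diff_le algebra_simps del: fact_Suc) (simp add: algebra_simps)
    moreover have "falling m (Suc i) = X / Y" "falling m i = X / ((real j + 1) * Y)"
      unfolding falling_def i j X_def Y_def by (simp_all add: Suc_diff_le algebra_simps)
    moreover have "(real i + real j + 2) * X / ((real j + 1) * Y) = X / Y + real (Suc i) * (X / ((real j + 1) * Y))"
    proof -
      have "real j + 1 \<noteq> 0" by linarith
      then show ?thesis using \<open>Y \<noteq> 0\<close> by (simp add: divide_simps) (simp add: algebra_simps)
    qed
    ultimately show ?thesis unfolding i by simp
  qed (auto simp: falling_def)
qed

section \<open>Matroids with external fields, and words padded with stars\<close>

locale weighted_matroid = matroid E \<I> for E :: "'a set" and \<I> +
  fixes lam :: "'a \<Rightarrow> real"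
  assumes lam_pos: "\<And>e. e \<in> E \<Longrightarrow> 0 < lam e"
begin

abbreviation "n \<equiv> card E"

definition wt :: "'a set \<Rightarrow> real" where "wt S = (\<Prod>e\<in>S. lam e)"

definition Z :: real where "Z = (\<Sum>S\<in>\<I>. wt S)"

definition addable :: "'a set \<Rightarrow> 'a set" where "addable T = {e \<in> E - T. insert e T \<in> \<I>}"

lemma finite_indep: "finite \<I>"
  by (rule finite_subset[of _ "Pow E"]) (use indep_subset finite_ground in auto)

lemma finite_addable: "finite (addable T)" unfolding addable_def using finite_ground by simp

lemma indep_finite: "S \<in> \<I> \<Longrightarrow> finite S"
  using indep_subset finite_ground finite_subset by blast

lemma card_indep: "S \<in> \<I> \<Longrightarrow> card S \<le> n"
  using indep_subset finite_ground card_mono by blast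

lemma wt_pos: "S \<in> \<I> \<Longrightarrow> 0 < wt S"
  unfolding wt_def using indep_subset lam_pos by (intro prod_pos) auto

lemma wt_insert: "S \<in> \<I> \<Longrightarrow> e \<notin> S \<Longrightarrow> wt (insert e S) = lam e * wt S"
  unfolding wt_def using indep_finite by simp

lemma Z_pos: "0 < Z"
  unfolding Z_def using finite_indep indep_empty wt_pos by (intro sum_pos) auto

text \<open>The bijection sends \<open>(S, e)\<close> to \<open>(S - {e}, e)\<close>. It underlies
  both the counting of words and the reversibility of the chain.\<close>

lemma sum_delete_eq_sum_insert:
  "(\<Sum>S\<in>\<I>. \<Sum>e\<in>S. \<Phi> S e) = (\<Sum>T\<in>\<I>. \<Sum>e\<in>addable T. \<Phi> (insert e T) e)"
proof -
  have "(\<Sum>(S, e)\<in>Sigma \<I> (\<lambda>S. S). \<Phi> S e) = (\<Sum>(T, e)\<in>Sigma \<I> addable. \<Phi> (insert e T) e)"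
    by (rule sum.reindex_bij_witness[where i = "\<lambda>(T, e). (insert e T, e)" and j = "\<lambda>(S, e). (S - {e}, e)"])
      (auto simp: addable_def insert_absorb intro: indep_mono dest: indep_subset[THEN subsetD])
  then show ?thesis
    using finite_indep indep_finite finite_addable by (subst (1 2) sum.Sigma) auto
qed

definition letters :: "'a option set" where "letters = insert None (Some ` E)"

definition word :: "'a set \<Rightarrow> nat \<Rightarrow> 'a option multiset" where
  "word S j = image_mset Some (mset_set S) + replicate_mset j None"

text \<open>The number of stars is unbounded, so a legal word may be longer than \<open>n\<close>.
  This keeps \<open>legal_add_None\<close> free of side conditions.\<close>

definition legal :: "'a option multiset \<Rightarrow> bool" where
  "legal M \<longleftrightarrow> (\<exists>T\<in>\<I>. \<exists>j. M = word T j)"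

lemma size_word: "size (word S j) = card S + j" by (simp add: word_def)

lemma add_None_word: "add_mset None (word S j) = word S (Suc j)" by (simp add: word_def)

lemma add_Some_word: "finite S \<Longrightarrow> e \<notin> S \<Longrightarrow> add_mset (Some e) (word S j) = word (insert e S) j"
  by (simp add: word_def)

lemma count_Some_word: "finite S \<Longrightarrow> count (word S j) (Some e) = of_bool (e \<in> S)"
proof -
  assume "finite S"
  have "count (image_mset Some (mset_set S)) (Some e) = count (mset_set S) e"
  proof -
    have "{x. x \<in># mset_set S \<and> Some e = Some x} = (if e \<in> S then {e} else {})"
      using \<open>finite S\<close> by auto
    then show ?thesis using \<open>finite S\<close> unfolding count_image_mset' by (auto simp: count_mset_set')
  qed
  then show ?thesis using \<open>finite S\<close> by (auto simp: word_def count_mset_set')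
qed

lemma count_None_word: "count (word S j) None = j"
proof -
  have "None \<notin># image_mset Some (mset_set S)" by auto
  then have "count (image_mset Some (mset_set S)) None = 0" by (simp only: not_in_iff)
  then show ?thesis by (simp add: word_def)
qed

lemma word_eq_iff: "finite S \<Longrightarrow> finite T \<Longrightarrow> word S i = word T j \<longleftrightarrow> S = T \<and> i = j"
proof
  assume "finite S" "finite T" "word S i = word T j"
  then have "count (word S i) x = count (word T j) x" for x by simp
  note cnt = this
  have "e \<in> S \<longleftrightarrow> e \<in> T" for e
    using cnt[of "Some e"] \<open>finite S\<close> \<open>finite T\<close> by (simp add: count_Some_word of_bool_def split: if_splits)
  then show "S = T \<and> i = j" using cnt[of None] by (auto simp: count_None_word)
qed auto

lemma legal_word: "finite T \<Longrightarrow> legal (word T j) \<longleftrightarrow> T \<in> \<I>"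
  unfolding legal_def using word_eq_iff indep_finite by metis

lemma legal_add_Some_word:
  assumes "T \<in> \<I>" shows "legal (add_mset (Some e) (word T j)) \<longleftrightarrow> e \<in> addable T"
proof (cases "e \<in> T")
  case True
  have "\<not> legal (add_mset (Some e) (word T j))"
  proof
    assume "legal (add_mset (Some e) (word T j))"
    then obtain S i where "S \<in> \<I>" "add_mset (Some e) (word T j) = word S i" unfolding legal_def by blast
    then have "count (add_mset (Some e) (word T j)) (Some e) = count (word S i) (Some e)" by simp
    then show False using True assms \<open>S \<in> \<I>\<close> indep_finite by (simp add: count_Some_word of_bool_def split: if_splits)
  qed
  then show ?thesis using True by (simp add: addable_def)
next
  case False
  then show ?thesis using assms indep_finite[OF assms] indep_subset[of "insert e T"]
    by (auto simp: add_Some_word legal_word addable_def)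
qed

lemma legal_add: assumes "legal (add_mset a M)" shows "legal M"
proof -
  obtain T j where T: "T \<in> \<I>" "add_mset a M = word T j" using assms unfolding legal_def by blast
  have fin: "finite T" using T indep_finite by blast
  show ?thesis
  proof (cases a)
    case None
    have "j > 0" using arg_cong[OF T(2), of "\<lambda>M. count M None"] None by (simp add: count_None_word)
    then obtain i where "j = Suc i" by (cases j) auto
    then have "add_mset None M = add_mset None (word T i)" using T(2) None add_None_word[of T i] by simp
    then have "M = word T i" by simp
    then show ?thesis using T(1) unfolding legal_def by blast
  next
    case (Some e)
    have "e \<in> T" using arg_cong[OF T(2), of "\<lambda>M. count M (Some e)"] Some fin
      by (simp add: count_Some_word of_bool_def split: if_splits)
    then have "add_mset (Some e) M = add_mset (Some e) (word (T - {e}) j)"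
      using T(2) Some add_Some_word[of "T - {e}" e j] fin by (simp add: insert_absorb)
    then have "M = word (T - {e}) j" by simp
    then show ?thesis using T(1) indep_mono[of T "T - {e}"] unfolding legal_def by blast
  qed
qed

lemma legal_add_None: "legal M \<Longrightarrow> legal (add_mset None M)"
  unfolding legal_def using add_None_word by metis

lemma sum_letters: "(\<Sum>a\<in>letters. h a) = h None + (\<Sum>e\<in>E. h (Some e))"
  unfolding letters_def using finite_ground by (simp add: sum.reindex)

lemma sum_letters_word:
  assumes "T \<in> \<I>" "\<And>M. \<not> legal M \<Longrightarrow> F M = 0"
  shows "(\<Sum>a\<in>letters. F (add_mset a (word T j))) =
    F (word T (Suc j)) + (\<Sum>e\<in>addable T. F (word (insert e T) j))"
proof -
  have "(\<Sum>e\<in>E. F (add_mset (Some e) (word T j))) = (\<Sum>e\<in>addable T. F (add_mset (Some e) (word T j)))"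
    by (rule sum.mono_neutral_right)
      (use finite_ground legal_add_Some_word[OF assms(1)] assms(2) in \<open>auto simp: addable_def\<close>)
  also have "\<dots> = (\<Sum>e\<in>addable T. F (word (insert e T) j))"
    using indep_finite[OF assms(1)] by (intro sum.cong refl) (auto simp: add_Some_word addable_def)
  finally show ?thesis unfolding sum_letters by (simp add: add_None_word)
qed

lemma lev_zero_illegal:
  "(\<And>M. \<not> legal M \<Longrightarrow> F M = 0) \<Longrightarrow> \<not> legal M \<Longrightarrow> lev letters F d M = 0"
proof (induction d arbitrary: M)
  case (Suc d)
  then have "lev letters F d (add_mset a M) = 0" for a using legal_add by blast
  then show ?case by simp
qed auto

text \<open>Words of length \<open>m\<close> are grouped by their set of elements. The truncated
  \<open>m - card T\<close> does no harm, since \<open>falling\<close> vanishes when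
  \<open>card T > m\<close>.\<close>

lemma lev_empty_eq:
  assumes "\<And>M. \<not> legal M \<Longrightarrow> F M = 0"
  shows "lev letters F m {#} = (\<Sum>T\<in>\<I>. falling m (card T) * F (word T (m - card T)))"
  using assms
proof (induction m arbitrary: F)
  case 0
  have "(\<Sum>T\<in>\<I>. falling 0 (card T) * F (word T (0 - card T))) =
     (\<Sum>T\<in>{{}}. falling 0 (card T) * F (word T (0 - card T)))"
    by (rule sum.mono_neutral_right)
      (use finite_indep indep_empty indep_finite in \<open>auto simp: falling_def card_eq_0_iff\<close>)
  then show ?case by (simp add: falling_def word_def)
next
  case (Suc m)
  let ?F = "\<lambda>M. \<Sum>a\<in>letters. F (add_mset a M)"
  have F0: "?F M = 0" if "\<not> legal M" for M
    using Suc.prems legal_add that by (intro sum.neutral ballI) blast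
  have "lev letters F (Suc m) {#} = (\<Sum>T\<in>\<I>. falling m (card T) * ?F (word T (m - card T)))"
    unfolding lev_Suc_inner by (rule Suc.IH) (rule F0)
  also have "\<dots> = (\<Sum>T\<in>\<I>. falling m (card T) * F (word T (Suc m - card T))) +
      (\<Sum>T\<in>\<I>. \<Sum>e\<in>addable T. falling m (card (insert e T) - 1) * F (word (insert e T) (Suc m - card (insert e T))))"
    unfolding sum.distrib[symmetric]
  proof (intro sum.cong refl)
    fix T assume T: "T \<in> \<I>"
    have c: "card (insert e T) = Suc (card T)" if "e \<in> addable T" for e
      using that indep_finite[OF T] by (auto simp: addable_def)
    have "falling m (card T) * F (word T (Suc (m - card T))) = falling m (card T) * F (word T (Suc m - card T))"
      by (cases "card T \<le> m") (auto simp: falling_def Suc_diff_le)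
    then show "falling m (card T) * ?F (word T (m - card T)) = falling m (card T) * F (word T (Suc m - card T)) +
        (\<Sum>e\<in>addable T. falling m (card (insert e T) - 1) * F (word (insert e T) (Suc m - card (insert e T))))"
      using c by (subst sum_letters_word[OF T Suc.prems]) (simp_all add: distrib_left sum_distrib_left)
  qed
  also have "(\<Sum>T\<in>\<I>. \<Sum>e\<in>addable T. falling m (card (insert e T) - 1) * F (word (insert e T) (Suc m - card (insert e T)))) =
     (\<Sum>S\<in>\<I>. \<Sum>e\<in>S. falling m (card S - 1) * F (word S (Suc m - card S)))"
    by (rule sum_delete_eq_sum_insert[symmetric])
  also have "(\<Sum>T\<in>\<I>. falling m (card T) * F (word T (Suc m - card T))) + \<dots> =
     (\<Sum>S\<in>\<I>. falling (Suc m) (card S) * F (word S (Suc m - card S)))"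
    unfolding sum.distrib[symmetric] falling_Suc by (intro sum.cong refl) (simp add: algebra_simps)
  finally show ?case .
qed

text \<open>
  A facet is the independent set \<open>S\<close> padded with \<open>n - card S\<close> stars, here the letter \<open>None\<close>. The
  factor \<open>fact (n - card S) / fact n\<close> spreads the mass of \<open>S\<close> evenly over all words with these letters.
\<close>

definition facet_wt :: "('a set \<Rightarrow> real) \<Rightarrow> 'a option multiset \<Rightarrow> real" where
  "facet_wt h M = (let S = {e. Some e \<in># M} in
     if S \<in> \<I> \<and> M = word S (n - card S) then h S * (wt S / Z) * fact (n - card S) / fact n else 0)"

lemma facet_wt_word:
  assumes "finite S"
  shows "facet_wt h (word S j) =
    (if S \<in> \<I> \<and> j = n - card S then h S * (wt S / Z) * fact (n - card S) / fact n else 0)"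
proof -
  have "{e. Some e \<in># word S j} = S"
    using assms by (auto simp: count_Some_word simp flip: count_greater_zero_iff)
  then show ?thesis using assms unfolding facet_wt_def by (auto simp: word_eq_iff)
qed

lemma facet_wt_illegal: "\<not> legal M \<Longrightarrow> facet_wt h M = 0"
  unfolding facet_wt_def legal_def Let_def by auto

lemma facet_wt_nonneg: "(\<And>S. 0 \<le> h S) \<Longrightarrow> 0 \<le> facet_wt h M"
  unfolding facet_wt_def Let_def using wt_pos Z_pos by (auto simp: less_imp_le)

text \<open>Prefix weights of the law with density \<open>h\<close> relative to the target;
  \<open>h = 1\<close> gives the target itself.\<close>

definition face_wt :: "('a set \<Rightarrow> real) \<Rightarrow> 'a option multiset \<Rightarrow> real" where
  "face_wt h M = lev letters (facet_wt h) (n - size M) M"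

lemma level_weights_face: "(\<And>S. 0 \<le> h S) \<Longrightarrow> level_weights letters n (face_wt h)"
  unfolding face_wt_def using finite_ground facet_wt_nonneg
  by (intro level_weights_lev) (auto simp: letters_def)

lemma face_wt_illegal: "\<not> legal M \<Longrightarrow> face_wt h M = 0"
  unfolding face_wt_def using facet_wt_illegal by (intro lev_zero_illegal) auto

lemma face_wt_full: "n \<le> size M \<Longrightarrow> face_wt h M = facet_wt h M"
  unfolding face_wt_def by simp

text \<open>Appending stars until the length is \<open>n\<close> ends in a facet of positive
  weight.\<close>

lemma face_wt_pos:
  assumes "legal M" "size M \<le> n"
  shows "0 < face_wt (\<lambda>_. 1) M"
proof -
  have "0 < lev letters (facet_wt (\<lambda>_. 1)) d M" if "legal M" "size M + d = n" for d M
    using that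
  proof (induction d arbitrary: M)
    case 0
    then obtain T j where "T \<in> \<I>" "M = word T j" unfolding legal_def by blast
    then show ?case using 0 wt_pos Z_pos indep_finite by (auto simp: facet_wt_word size_word)
  next
    case (Suc d)
    obtain T j where T: "T \<in> \<I>" "M = word T j" using Suc.prems unfolding legal_def by blast
    then have "legal (add_mset None M)" using Suc.prems legal_add_None by blast
    then have "0 < lev letters (facet_wt (\<lambda>_. 1)) d (add_mset None M)" using Suc by auto
    also have "\<dots> \<le> lev letters (facet_wt (\<lambda>_. 1)) (Suc d) M"
      unfolding lev.simps
      by (rule member_le_sum)
        (use finite_ground in \<open>auto simp: letters_def intro!: lev_nonneg facet_wt_nonneg\<close>)
    finally show ?case .
  qed
  from this[OF assms(1), of "n - size M"] show ?thesis unfolding face_wt_def using assms(2) by simp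
qed

text \<open>Absolute continuity at all levels: the target vanishes only on illegal words and on
  words longer than \<open>n\<close>, where \<open>face_wt h\<close> vanishes for every
  \<open>h\<close>.\<close>

lemma face_wt_one_zero_imp:
  assumes "face_wt (\<lambda>_. 1) M = 0"
  shows "face_wt h M = 0"
proof (cases "legal M \<and> size M \<le> n")
  case True
  then show ?thesis using face_wt_pos[of M] assms by simp
next
  case False
  then show ?thesis
  proof (cases "legal M")
    case True
    then obtain T j where "T \<in> \<I>" "M = word T j" unfolding legal_def by blast
    then show ?thesis using False True card_indep[of T] indep_finite[of T]
      by (simp add: face_wt_full facet_wt_word size_word)
  qed (rule face_wt_illegal)
qed

text \<open>If \<open>e\<close> and \<open>g\<close> were not parallel over \<open>T\<close>,
  augmenting \<open>insert f T\<close> from \<open>insert e (insert g T)\<close> would make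
  \<open>f\<close> independent of one of them.\<close>

lemma parallel_trans:
  assumes T: "T \<in> \<I>" and e: "e \<in> addable T" "f \<in> addable T" "g \<in> addable T"
    and ef: "e = f \<or> insert e (insert f T) \<notin> \<I>" and fg: "f = g \<or> insert f (insert g T) \<notin> \<I>"
  shows "e = g \<or> insert e (insert g T) \<notin> \<I>"
proof (rule ccontr)
  assume "\<not> ?thesis"
  then have eg: "e \<noteq> g" "insert e (insert g T) \<in> \<I>" by auto
  have fT: "finite T" "e \<notin> T" "f \<notin> T" "g \<notin> T" "insert f T \<in> \<I>" using indep_finite[OF T] e unfolding addable_def by auto
  have "card (insert f T) < card (insert e (insert g T))" using fT eg by simp
  from augment[OF fT(5) eg(2) this] obtain y where "y \<in> {e, g}" "y \<noteq> f" "insert y (insert f T) \<in> \<I>"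
    by auto
  then show False using ef fg by (auto simp: insert_commute)
qed

text \<open>
  The link of \<open>T\<close> in codimension two is complete multipartite, the parts being the classes of parallel
  elements; since there are at most \<open>n - card T\<close> parts, completing the square bounds the quadratic form
  by a multiple of the square of a linear form.
\<close>

lemma lorentzian_codim_two:
  assumes M: "size M + 2 = n"
  shows "level_weights.lorentzian_at letters (face_wt (\<lambda>_. 1)) M"
proof -
  interpret L: level_weights letters n "face_wt (\<lambda>_. 1)" by (rule level_weights_face) simp
  show ?thesis
  proof (cases "legal M")
    case False
    then show ?thesis unfolding L.lorentzian_at_def by (simp add: face_wt_illegal)
  next
    case True
    then obtain T j where T: "T \<in> \<I>" "M = word T j" unfolding legal_def by blast
    define m where "m = n - card T"
    have m: "m = j + 2" "card T + j + 2 = n" using M T unfolding m_def by (auto simp: size_word)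
    have fT: "finite T" using T indep_finite by blast
    define F where "F = addable T"
    have F: "finite F" unfolding F_def by (rule finite_addable)
    have "F \<subseteq> E - T" unfolding F_def addable_def by blast
    then have "card F \<le> card (E - T)" using finite_ground by (intro card_mono) auto
    also have "\<dots> = m" unfolding m_def using indep_subset[OF T(1)] fT by (rule card_Diff_subset[rotated])
    finally have cF: "card F \<le> m" .
    \<comment> \<open>The weight of a facet with two elements beyond \<open>T\<close>, without their
      fields. Replacing one element by a star multiplies by \<open>j + 1 = m - 1\<close>, replacing
      the second by \<open>j + 2 = m\<close>, from the factorials in
      \<open>facet_wt\<close>.\<close>
    define \<kappa> where "\<kappa> = wt T / Z * fact j / fact n"
    have \<kappa>: "\<kappa> > 0" unfolding \<kappa>_def using wt_pos[OF T(1)] Z_pos by simp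
    define G where "G = facet_wt (\<lambda>_. 1)"
    have G: "face_wt (\<lambda>_. 1) (add_mset x (add_mset y M)) = G (add_mset x (add_mset y M))" for x y
      unfolding G_def using M by (intro face_wt_full) simp
    have cins: "card (insert e T) = Suc (card T)" "e \<notin> T" "e \<in> E" "insert e T \<in> \<I>" if "e \<in> F" for e
      using that fT unfolding F_def addable_def by auto
    have GNN: "G (add_mset None (add_mset None M)) = \<kappa> * (real m * (real m - 1))"
    proof -
      have "n - card T = Suc (Suc j)" using m by simp
      then show ?thesis
        unfolding G_def T(2) add_None_word \<kappa>_def using fT T m by (simp add: facet_wt_word field_simps)
    qed
    have GSN: "G (add_mset (Some e) (add_mset None M)) = (if e \<in> F then \<kappa> * ((real m - 1) * lam e) else 0)" for e
    proof (cases "e \<in> F")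
      case True
      have "n - card (insert e T) = Suc j" using m cins[OF True] by simp
      then show ?thesis
        unfolding G_def T(2) add_None_word \<kappa>_def using True fT T m cins[OF True]
        by (simp add: add_Some_word facet_wt_word wt_insert)
    next
      case False
      then show ?thesis using legal_add_Some_word[OF T(1), of e "Suc j"]
        unfolding G_def T(2) add_None_word F_def by (simp add: facet_wt_illegal)
    qed
    have GSS: "G (add_mset (Some e) (add_mset (Some e') M)) =
        (if e \<in> F \<and> e' \<in> F \<and> e \<noteq> e' \<and> insert e (insert e' T) \<in> \<I> then \<kappa> * (lam e * lam e') else 0)" for e e'
    proof (cases "e' \<in> F")
      case True
      note ce = cins[OF True]
      have eq: "add_mset (Some e') M = word (insert e' T) j"
        unfolding T(2) using ce fT by (simp add: add_Some_word)
      show ?thesis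
      proof (cases "e \<in> addable (insert e' T)")
        case A: True
        then have e: "e \<in> E" "e \<notin> T" "e \<noteq> e'" "insert e (insert e' T) \<in> \<I>" unfolding addable_def by auto
        then have "insert e T \<in> \<I>" by (auto intro: indep_mono)
        then have eF: "e \<in> F" using e unfolding F_def addable_def by auto
        have "n - card (insert e (insert e' T)) = j" using m e ce fT by simp
        then show ?thesis unfolding eq G_def \<kappa>_def using True eF e fT ce T(1)
          by (simp add: add_Some_word facet_wt_word wt_insert)
      next
        case A: False
        then have "G (add_mset (Some e) (add_mset (Some e') M)) = 0"
          unfolding eq G_def using legal_add_Some_word[OF ce(4)] by (intro facet_wt_illegal) simp
        moreover have "\<not> (e \<in> F \<and> e \<noteq> e' \<and> insert e (insert e' T) \<in> \<I>)"
          using A cins[of e] unfolding addable_def by auto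
        ultimately show ?thesis by auto
      qed
    next
      case False
      then have "\<not> legal (add_mset (Some e') M)" using legal_add_Some_word[OF T(1)] T(2) F_def by simp
      then have "\<not> legal (add_mset (Some e) (add_mset (Some e') M))" using legal_add by blast
      then show ?thesis using False unfolding G_def by (simp add: facet_wt_illegal)
    qed
    define par where "par e e' \<longleftrightarrow> e = e' \<or> insert e (insert e' T) \<notin> \<I>" for e e'
    have par_sym: "par e' e" if "par e e'" for e e'
      using that insert_commute[of e e' T] unfolding par_def by metis
    have par_trans: "par e g" if "par e f" "par f g" "e \<in> F" "f \<in> F" "g \<in> F" for e f g
      using parallel_trans[OF T(1), of e f g] that unfolding par_def F_def by blast
    define cls where "cls e = {e'\<in>F. par e' e}" for e
    have cls: "cls e' = cls e \<longleftrightarrow> par e e'" if "e \<in> F" "e' \<in> F" for e e'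
    proof
      assume "cls e' = cls e"
      moreover have "e' \<in> cls e'" using that unfolding cls_def par_def by blast
      ultimately have "par e' e" unfolding cls_def by blast
      then show "par e e'" by (rule par_sym)
    next
      assume "par e e'"
      then show "cls e' = cls e"
        unfolding cls_def using par_sym par_trans that by blast
    qed
    show ?thesis
    proof (rule L.lorentzian_atI)
      show "size M + 2 \<le> n" using M by simp
    next
      fix u :: "'a option \<Rightarrow> real"
      define s where "s e = lam e * u (Some e)" for e
      have bound: "L.quad M v \<le> \<kappa> * ((real m - 1) / real m) * (real m * v None + (\<Sum>e\<in>F. lam e * v (Some e)))^2" for v
      proof -
        define s where "s e = lam e * v (Some e)" for e
        define y where "y = v None"
        have FE: "F \<subseteq> E" using cins by blast
        have restr: "(\<Sum>e\<in>E. if e \<in> F then h e else 0) = (\<Sum>e\<in>F. h e)" for h :: "'a \<Rightarrow> real"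
          using finite_ground FE by (simp add: sum.inter_restrict[symmetric] Int_absorb1)
        have "L.quad M v = \<kappa> * (real m * (real m - 1) * y^2) + 2 * (\<Sum>e\<in>F. \<kappa> * ((real m - 1) * y * s e)) +
            (\<Sum>e\<in>E. \<Sum>e'\<in>E. v (Some e) * v (Some e') * G (add_mset (Some e) (add_mset (Some e') M)))"
        proof -
          have "(\<Sum>e\<in>E. y * v (Some e) * G (add_mset (Some e) (add_mset None M))) = (\<Sum>e\<in>F. \<kappa> * ((real m - 1) * y * s e))"
            unfolding GSN s_def restr[symmetric] by (intro sum.cong refl) simp
          then show ?thesis
            unfolding L.quad_def sum_letters G GNN
            by (simp add: sum.distrib y_def power2_eq_square add_mset_commute mult_ac)
        qed
        also have "(\<Sum>e\<in>E. \<Sum>e'\<in>E. v (Some e) * v (Some e') * G (add_mset (Some e) (add_mset (Some e') M))) =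
           (\<Sum>e\<in>F. \<Sum>e'\<in>F. \<kappa> * (if cls e' = cls e then 0 else s e * s e'))"
        proof -
          have "(\<Sum>e'\<in>E. v (Some e) * v (Some e') * G (add_mset (Some e) (add_mset (Some e') M))) =
             (if e \<in> F then \<Sum>e'\<in>F. \<kappa> * (if cls e' = cls e then 0 else s e * s e') else 0)" for e
            unfolding restr[symmetric] GSS
            by (cases "e \<in> F") (auto simp: cls par_def s_def intro!: sum.cong sum.neutral)
          then show ?thesis by (simp add: restr)
        qed
        also have "\<dots> = \<kappa> * ((\<Sum>e\<in>F. s e)^2 - (\<Sum>e\<in>F. \<Sum>e'\<in>{e'\<in>F. cls e' = cls e}. s e * s e'))"
        proof -
          have "(\<Sum>e\<in>F. s e)^2 = (\<Sum>e\<in>F. \<Sum>e'\<in>F. s e * s e')" by (simp add: power2_eq_square sum_product)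
          moreover have "(\<Sum>e\<in>F. \<Sum>e'\<in>{e'\<in>F. cls e' = cls e}. s e * s e') =
              (\<Sum>e\<in>F. \<Sum>e'\<in>F. if cls e' = cls e then s e * s e' else 0)"
            by (rule sum.cong[OF refl]) (rule sum.inter_filter[OF F])
          moreover have "(\<Sum>e\<in>F. \<Sum>e'\<in>F. if cls e' = cls e then 0 else s e * s e') =
              (\<Sum>e\<in>F. \<Sum>e'\<in>F. s e * s e') - (\<Sum>e\<in>F. \<Sum>e'\<in>F. if cls e' = cls e then s e * s e' else 0)"
            unfolding sum_subtractf[symmetric] by (intro sum.cong refl) auto
          ultimately show ?thesis by (simp add: sum_distrib_left[symmetric])
        qed
        finally have quad_eq: "L.quad M v = \<kappa> * (real m * (real m - 1) * y^2) + 2 * (\<Sum>e\<in>F. \<kappa> * ((real m - 1) * y * s e)) +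
           \<kappa> * ((\<Sum>e\<in>F. s e)^2 - (\<Sum>e\<in>F. \<Sum>e'\<in>{e'\<in>F. cls e' = cls e}. s e * s e'))" .
        have q: "L.quad M v = \<kappa> * (real m * (real m - 1) * y^2 + 2 * (real m - 1) * y * (\<Sum>e\<in>F. s e) + (\<Sum>e\<in>F. s e)^2
             - (\<Sum>e\<in>F. \<Sum>e'\<in>{e'\<in>F. cls e' = cls e}. s e * s e'))"
        proof -
          have "(\<Sum>e\<in>F. \<kappa> * ((real m - 1) * y * s e)) = \<kappa> * ((real m - 1) * y * (\<Sum>e\<in>F. s e))"
            by (simp only: sum_distrib_left mult.assoc)
          then show ?thesis using quad_eq by (simp only:) (simp add: algebra_simps)
        qed
        let ?X = "\<Sum>e\<in>F. \<Sum>e'\<in>{e'\<in>F. cls e' = cls e}. s e * s e'"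
        have mp: "real m > 0" using m by simp
        have sq: "(\<Sum>e\<in>F. s e)^2 \<le> real m * ?X"
        proof -
          have "(\<Sum>e\<in>F. s e)^2 \<le> real (card F) * ?X" by (rule sum_square_le_classes[OF F])
          moreover have "0 \<le> ?X"
          proof (cases "card F = 0")
            case True
            then show ?thesis using F by simp
          next
            case False
            have "0 \<le> real (card F) * ?X" using sum_square_le_classes[OF F, of s cls] zero_le_power2 order_trans by blast
            then show ?thesis using False by (simp add: zero_le_mult_iff)
          qed
          ultimately show ?thesis using cF mult_right_mono[of "real (card F)" "real m" ?X] by linarith
        qed
        let ?S = "\<Sum>e\<in>F. s e"
        \<comment> \<open>Completing the square: the sides differ by
          \<open>?X - ?S^2 / real m\<close>, which is nonnegative by \<open>sq\<close>.\<close>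
        have "real m * (real m - 1) * y^2 + 2 * (real m - 1) * y * ?S + ?S^2 - ?X \<le>
            ((real m - 1) / real m) * (real m * y + ?S)^2"
        proof -
          have "?S^2 / real m \<le> ?X" using sq mp by (simp add: divide_le_eq mult.commute)
          moreover have "((real m - 1) / real m) * (real m * y + ?S)^2 =
             real m * (real m - 1) * y^2 + 2 * (real m - 1) * y * ?S + ?S^2 - ?S^2 / real m"
            using mp by (simp add: field_simps power2_eq_square)
          ultimately show ?thesis by linarith
        qed
        then have "\<kappa> * (real m * (real m - 1) * y^2 + 2 * (real m - 1) * y * ?S + ?S^2 - ?X) \<le>
            \<kappa> * (((real m - 1) / real m) * (real m * y + ?S)^2)"
          using \<kappa> by (intro mult_left_mono) auto
        then show ?thesis unfolding q y_def s_def by (simp add: mult.assoc)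
      qed
      \<comment> \<open>\<open>d\<close> is the value of the linear form in \<open>bound\<close> at
        the constant 1, and \<open>t\<close> is the constant whose subtraction from \<open>u\<close>
        annihilates this form.\<close>
      define d where "d = real m + (\<Sum>e\<in>F. lam e)"
      have "d > 0" unfolding d_def using m cins lam_pos
        by (intro add_pos_nonneg sum_nonneg) (auto simp: less_imp_le)
      define t where "t = (real m * u None + (\<Sum>e\<in>F. lam e * u (Some e))) / d"
      have "real m * (u None - t) + (\<Sum>e\<in>F. lam e * (u (Some e) - t)) =
          real m * u None + (\<Sum>e\<in>F. lam e * u (Some e)) - t * d"
        unfolding d_def by (simp add: algebra_simps sum_subtractf sum_distrib_left)
      also have "\<dots> = 0" using \<open>d > 0\<close> unfolding t_def by simp
      finally have "L.quad M (\<lambda>x. u x - t) \<le> 0" using bound[of "\<lambda>x. u x - t"] by simp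
      then show "\<exists>t. L.quad M (\<lambda>x. u x - t) \<le> 0" by blast
    qed
  qed
qed

lemma lorentzian_face_wt:
  "size M + 2 \<le> n \<Longrightarrow> level_weights.lorentzian_at letters (face_wt (\<lambda>_. 1)) M"
proof (induction "n - (size M + 2)" arbitrary: M)
  case 0
  then show ?case by (intro lorentzian_codim_two) simp
next
  case (Suc k)
  interpret L: level_weights letters n "face_wt (\<lambda>_. 1)" by (rule level_weights_face) simp
  show ?case
  proof (rule L.trickle_down[where star = None])
    show "size M + 2 < n" using Suc by simp
    show "None \<in> letters" by (simp add: letters_def)
    fix x assume x: "x \<in> letters" "0 < face_wt (\<lambda>_. 1) (add_mset x M)"
    then have "legal (add_mset x M)" using face_wt_illegal by force
    \<comment> \<open>A star can always be appended, so it is joined to every letter of positive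
      weight.\<close>
    then have "legal (add_mset None (add_mset x M))" by (rule legal_add_None)
    then show "0 < face_wt (\<lambda>_. 1) (add_mset None (add_mset x M))"
      using Suc by (intro face_wt_pos) auto
  next
    fix z assume "z \<in> letters"
    show "L.lorentzian_at (add_mset z M)" by (rule Suc(1)) (use Suc(2,3) in auto)
  qed
qed

text \<open>Weights of the heat-bath update at \<open>T\<close>. Relative to inserting elements with
  weights \<open>lam e\<close>, the star has weight \<open>n - card T\<close>, the quotient of the
  factorials in \<open>facet_wt\<close>. Hence \<open>avg h T\<close> is the conditional expectation
  of \<open>h\<close> given the remaining word.\<close>

definition tot :: "'a set \<Rightarrow> real" where
  "tot T = real (n - card T) + (\<Sum>e\<in>addable T. lam e)"

definition avg :: "('a set \<Rightarrow> real) \<Rightarrow> 'a set \<Rightarrow> real" where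
  "avg h T = (real (n - card T) * h T + (\<Sum>e\<in>addable T. lam e * h (insert e T))) / tot T"

lemma tot_pos: "card T < n \<Longrightarrow> 0 < tot T"
  unfolding tot_def using lam_pos by (intro add_pos_nonneg sum_nonneg) (auto simp: addable_def less_imp_le)

lemma addable_full: assumes "card T = n" "T \<in> \<I>" shows "addable T = {}"
proof -
  have "T = E" using assms indep_subset finite_ground card_subset_eq by blast
  then show ?thesis unfolding addable_def by simp
qed

text \<open>The words of length \<open>n - 1\<close> with element set \<open>T\<close> have total
  mass \<open>wt T / Z * tot T / n\<close> and density \<open>avg h T\<close>. The statement is the
  comparison of the last two levels after grouping words by sets.\<close>

lemma entropy_contraction_sets:
  assumes h: "\<And>S. 0 \<le> h S" "(\<Sum>S\<in>\<I>. wt S / Z * h S) = 1" and n: "1 \<le> n"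
  shows "(\<Sum>T\<in>\<I>. wt T / Z * tot T * (avg h T * ln (avg h T))) \<le>
    (real n - 1) * (\<Sum>S\<in>\<I>. wt S / Z * (h S * ln (h S)))"
proof -
  interpret L: level_weights letters n "face_wt (\<lambda>_. 1)" by (rule level_weights_face) simp
  have fallfact: "falling n (card T) * (fact (n - card T) / fact n) = 1" if "T \<in> \<I>" for T
    using card_indep[OF that] by (simp add: falling_def)
  have top: "falling n (card T) * face_wt k (word T (n - card T)) = k T * (wt T / Z)" if "T \<in> \<I>" for T k
  proof -
    have "face_wt k (word T (n - card T)) = k T * (wt T / Z) * (fact (n - card T) / fact n)"
      using that card_indep[OF that] indep_finite[OF that] by (simp add: face_wt_full size_word facet_wt_word)
    then have "falling n (card T) * face_wt k (word T (n - card T)) =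
        (k T * (wt T / Z)) * (falling n (card T) * (fact (n - card T) / fact n))"
      by (simp only: mult_ac)
    then show ?thesis unfolding fallfact[OF that] by simp
  qed
  have empty: "face_wt k {#} = (\<Sum>T\<in>\<I>. k T * (wt T / Z))" for k
  proof -
    have "face_wt k {#} = lev letters (facet_wt k) n {#}" by (simp add: face_wt_def)
    also have "\<dots> = (\<Sum>T\<in>\<I>. falling n (card T) * facet_wt k (word T (n - card T)))"
      by (rule lev_empty_eq) (rule facet_wt_illegal)
    also have "\<dots> = (\<Sum>T\<in>\<I>. k T * (wt T / Z))"
      using top[of _ k] card_indep by (intro sum.cong refl) (simp add: face_wt_full size_word)
    finally show ?thesis .
  qed
  have e1: "face_wt (\<lambda>_. 1) {#} = 1"
    unfolding empty using Z_pos by (simp add: sum_divide_distrib[symmetric] Z_def[symmetric])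
  have e2: "face_wt h {#} = 1"
    unfolding empty using h(2) by (simp add: mult.commute)
  define \<phi> where "\<phi> M = rel_ent (face_wt h M) (face_wt (\<lambda>_. 1) M)" for M
  have \<phi>0: "\<phi> M = 0" if "\<not> legal M" for M unfolding \<phi>_def using that by (simp add: face_wt_illegal)
  have "real n * lev letters \<phi> (n - 1) {#} \<le> real (n - 1) * lev letters \<phi> n {#}"
    unfolding \<phi>_def
    by (rule L.entropy_contraction)
      (use n e1 e2 in \<open>auto intro: level_weights_face h(1) face_wt_one_zero_imp lorentzian_face_wt\<close>)
  also have "lev letters \<phi> n {#} = (\<Sum>S\<in>\<I>. wt S / Z * (h S * ln (h S)))"
  proof (subst lev_empty_eq[OF \<phi>0]; (intro sum.cong refl)?)
    fix T assume T: "T \<in> \<I>"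
    have "face_wt h (word T (n - card T)) = h T * face_wt (\<lambda>_. 1) (word T (n - card T))"
      using T card_indep[OF T] indep_finite[OF T] by (simp add: face_wt_full size_word facet_wt_word)
    moreover have "face_wt (\<lambda>_. 1) (word T (n - card T)) > 0"
      using T card_indep[OF T] indep_finite[OF T] by (intro face_wt_pos) (auto simp: legal_word size_word)
    ultimately have "\<phi> (word T (n - card T)) = face_wt (\<lambda>_. 1) (word T (n - card T)) * (h T * ln (h T))"
      unfolding \<phi>_def rel_ent_def by simp
    then show "falling n (card T) * \<phi> (word T (n - card T)) = wt T / Z * (h T * ln (h T))"
      using top[OF T, of "\<lambda>_. 1"] by (simp only: mult.assoc[symmetric] mult_1_left)
  qed auto
  also have "lev letters \<phi> (n - 1) {#} = (\<Sum>T\<in>\<I>. wt T / Z * tot T / real n * (avg h T * ln (avg h T)))"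
  proof (subst lev_empty_eq[OF \<phi>0]; (intro sum.cong refl)?)
    fix T assume T: "T \<in> \<I>"
    show "falling (n - 1) (card T) * \<phi> (word T (n - 1 - card T)) =
      wt T / Z * tot T / real n * (avg h T * ln (avg h T))"
    proof (cases "card T = n")
      case True
      then show ?thesis using n addable_full[OF True T] by (simp add: falling_def tot_def)
    next
      case False
      then have lt: "card T < n" using card_indep[OF T] by simp
      define j where "j = n - 1 - card T"
      have j: "n - card T = Suc j" "card T + Suc j = n" using lt unfolding j_def by auto
      define c where "c = wt T / Z * fact j / fact n"
      have c: "c > 0" unfolding c_def using wt_pos[OF T] Z_pos by simp
      have fw: "face_wt k (word T j) = c * (real (n - card T) * k T + (\<Sum>e\<in>addable T. lam e * k (insert e T)))" for k
      proof -
        have "face_wt k (word T j) = (\<Sum>a\<in>letters. facet_wt k (add_mset a (word T j)))"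
        proof -
          have "n - size (word T j) = Suc 0" using j by (simp add: size_word)
          then show ?thesis unfolding face_wt_def by simp
        qed
        also have "\<dots> = facet_wt k (word T (Suc j)) + (\<Sum>e\<in>addable T. facet_wt k (word (insert e T) j))"
          by (rule sum_letters_word[OF T]) (rule facet_wt_illegal)
        also have "facet_wt k (word T (Suc j)) = c * (real (n - card T) * k T)"
          using T j indep_finite[OF T] unfolding c_def by (simp add: facet_wt_word)
        also have "(\<Sum>e\<in>addable T. facet_wt k (word (insert e T) j)) = (\<Sum>e\<in>addable T. c * (lam e * k (insert e T)))"
        proof (intro sum.cong refl)
          fix e assume "e \<in> addable T"
          then have e: "e \<notin> T" "insert e T \<in> \<I>" unfolding addable_def by auto
          then have "n - card (insert e T) = j" using j indep_finite[OF T] by simp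
          then show "facet_wt k (word (insert e T) j) = c * (lam e * k (insert e T))"
            using e indep_finite[OF T] T unfolding c_def by (simp add: facet_wt_word wt_insert)
        qed
        finally show ?thesis by (simp add: distrib_left sum_distrib_left)
      qed
      have g: "face_wt (\<lambda>_. 1) (word T j) = c * tot T" using fw[of "\<lambda>_. 1"] unfolding tot_def by simp
      have f: "face_wt h (word T j) = c * tot T * avg h T"
        using fw[of h] tot_pos[OF lt] unfolding avg_def by simp
      have "\<phi> (word T j) = c * tot T * (avg h T * ln (avg h T))"
        unfolding \<phi>_def rel_ent_def f g using c tot_pos[OF lt] by simp
      moreover have "falling (n - 1) (card T) * c = wt T / Z / real n"
      proof -
        have "fact n = real n * fact (n - 1)" using n by (simp add: fact_reduce)
        then show ?thesis using lt unfolding c_def falling_def j_def by simp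
      qed
      ultimately show ?thesis unfolding j_def[symmetric] by (metis (no_types, lifting) mult.assoc mult.commute times_divide_eq_right)
    qed
  qed auto
  finally have "real n * (\<Sum>T\<in>\<I>. wt T / Z * tot T / real n * (avg h T * ln (avg h T))) \<le>
    (real n - 1) * (\<Sum>S\<in>\<I>. wt S / Z * (h S * ln (h S)))" using n by (simp add: of_nat_diff)
  moreover have "real n * (\<Sum>T\<in>\<I>. wt T / Z * tot T / real n * (avg h T * ln (avg h T))) =
     (\<Sum>T\<in>\<I>. wt T / Z * tot T * (avg h T * ln (avg h T)))"
    using n unfolding sum_distrib_left by (intro sum.cong refl) simp
  ultimately show ?thesis by simp
qed

end

section \<open>The lazy heat-bath chain\<close>

lemma xlnx_jensen:
  fixes p x :: "'b \<Rightarrow> real"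
  assumes I: "finite I" and p: "\<And>i. i \<in> I \<Longrightarrow> 0 \<le> p i" and x: "\<And>i. i \<in> I \<Longrightarrow> 0 \<le> x i"
    and P: "0 < (\<Sum>i\<in>I. p i)" and y: "y * (\<Sum>i\<in>I. p i) = (\<Sum>i\<in>I. p i * x i)"
  shows "(\<Sum>i\<in>I. p i) * (y * ln y) \<le> (\<Sum>i\<in>I. p i * (x i * ln (x i)))"
proof -
  have "0 \<le> (\<Sum>i\<in>I. p i * x i)" using p x by (intro sum_nonneg) auto
  then have y0: "y \<ge> 0" using y P by (metis zero_le_mult_iff not_less order_less_imp_le)
  show ?thesis
  proof (cases "y = 0")
    case True
    then have "(\<Sum>i\<in>I. p i * x i) = 0" using y by simp
    then have "\<forall>i\<in>I. p i * x i = 0" using I p x by (subst (asm) sum_nonneg_eq_0_iff) auto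
    then have "(\<Sum>i\<in>I. p i * (x i * ln (x i))) = 0" by (intro sum.neutral ballI) auto
    then show ?thesis using True by simp
  next
    case False
    then have yp: "y > 0" using y0 by simp
    have "p i * (y * ln y) + (1 + ln y) * (p i * x i - y * p i) \<le> p i * (x i * ln (x i))" if i: "i \<in> I" for i
    proof -
      have "y * ln y + (1 + ln y) * (x i - y) \<le> x i * ln (x i)"
      proof (cases "x i = 0")
        case True
        then show ?thesis using yp by (simp add: algebra_simps)
      next
        case False
        then have "x i > 0" using x[OF i] by simp
        from diff_le_mult_ln_diff[OF this yp] show ?thesis by (simp add: algebra_simps)
      qed
      then have "p i * (y * ln y + (1 + ln y) * (x i - y)) \<le> p i * (x i * ln (x i))"
        using p[OF i] by (rule mult_left_mono)
      then show ?thesis by (simp add: algebra_simps)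
    qed
    then have "(\<Sum>i\<in>I. p i * (y * ln y) + (1 + ln y) * (p i * x i - y * p i)) \<le> (\<Sum>i\<in>I. p i * (x i * ln (x i)))"
      by (rule sum_mono)
    moreover have "(\<Sum>i\<in>I. p i * (y * ln y) + (1 + ln y) * (p i * x i - y * p i)) =
       (\<Sum>i\<in>I. p i) * (y * ln y) + (1 + ln y) * ((\<Sum>i\<in>I. p i * x i) - y * (\<Sum>i\<in>I. p i))"
      unfolding sum.distrib sum_distrib_right sum_distrib_left sum_subtractf[symmetric] ..
    ultimately show ?thesis using y by simp
  qed
qed

lemma xlnx_jensen_insert:
  fixes p x :: "'b \<Rightarrow> real"
  assumes I: "finite I" and p: "\<And>i. i \<in> I \<Longrightarrow> 0 \<le> p i" "0 \<le> p0" and x: "\<And>i. i \<in> I \<Longrightarrow> 0 \<le> x i" "0 \<le> x0"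
    and P: "0 < p0 + (\<Sum>i\<in>I. p i)" and y: "y * (p0 + (\<Sum>i\<in>I. p i)) = p0 * x0 + (\<Sum>i\<in>I. p i * x i)"
  shows "(p0 + (\<Sum>i\<in>I. p i)) * (y * ln y) \<le> p0 * (x0 * ln x0) + (\<Sum>i\<in>I. p i * (x i * ln (x i)))"
proof -
  let ?p = "\<lambda>j. case j of None \<Rightarrow> p0 | Some i \<Rightarrow> p i"
  let ?x = "\<lambda>j. case j of None \<Rightarrow> x0 | Some i \<Rightarrow> x i"
  have sums: "(\<Sum>j\<in>insert None (Some ` I). G j) = G None + (\<Sum>i\<in>I. G (Some i))" for G :: "'b option \<Rightarrow> real"
    using I by (simp add: sum.reindex)
  have "(\<Sum>j\<in>insert None (Some ` I). ?p j) * (y * ln y) \<le> (\<Sum>j\<in>insert None (Some ` I). ?p j * (?x j * ln (?x j)))"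
  proof (rule xlnx_jensen)
    show "0 < (\<Sum>j\<in>insert None (Some ` I). ?p j)" unfolding sums using P by simp
    show "y * (\<Sum>j\<in>insert None (Some ` I). ?p j) = (\<Sum>j\<in>insert None (Some ` I). ?p j * ?x j)"
      unfolding sums using y by simp
  qed (use I p x in auto)
  then show ?thesis unfolding sums by simp
qed

text \<open>The loop rule peels off the first step, whereas the entropy argument appends a last
  one.\<close>

lemma iter_pmf_Suc_right: "iter_pmf K (Suc m) x = bind_pmf (iter_pmf K m x) K"
proof (induction m arbitrary: x)
  case 0
  have "iter_pmf K 0 = return_pmf" by (rule ext) simp
  then show ?case by (simp add: bind_return_pmf bind_return_pmf')
next
  case (Suc m)
  have *: "iter_pmf K (Suc m) = (\<lambda>y. bind_pmf (iter_pmf K m y) K)" by (rule ext) (rule Suc)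
  have "iter_pmf K (Suc (Suc m)) x = bind_pmf (K x) (iter_pmf K (Suc m))" by (rule iter_pmf.simps(2))
  also have "\<dots> = bind_pmf (iter_pmf K (Suc m) x) K"
    unfolding * bind_assoc_pmf[symmetric] iter_pmf.simps(2)[symmetric] ..
  finally show ?case .
qed

section \<open>Reversibility and entropy decay of the lazy chain\<close>

context weighted_matroid
begin

definition lmax :: real where "lmax = Max (lam ` E)"

definition rate :: real where "rate = 1 / (1 + lmax)"

text \<open>
  Viewing \<open>S\<close> as a word padded with stars, a uniformly chosen letter is removed: the element \<open>e\<close> if
  \<open>e \<in> S\<close>, a star otherwise. With the remaining set \<open>T\<close>, the star and each addable \<open>e'\<close> are proposed with
  weights in the ratio \<open>1 : lam e' / (n - card T)\<close>; when no proposal is accepted, the removed letter is put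
  back. So a heat-bath update happens with probability \<open>theta T \<ge> rate\<close>, which avoids rejection loops.
\<close>

definition kernel :: "'a set \<Rightarrow> 'a set pmf" where
  "kernel S = bind_pmf (pmf_of_set E) (\<lambda>e.
     bind_pmf (bernoulli_pmf rate) (\<lambda>b.
       if b then return_pmf (S - {e})
       else bind_pmf (pmf_of_set (E - (S - {e}))) (\<lambda>e'.
         map_pmf (\<lambda>a. if insert e' (S - {e}) \<in> \<I> \<and> a then insert e' (S - {e}) else S)
           (bernoulli_pmf (lam e' / lmax)))))"

definition theta :: "'a set \<Rightarrow> real" where
  "theta T = rate * tot T / real (n - card T)"

text \<open>The action of \<open>kernel\<close> on functions, as \<open>pmf_kernel\<close> confirms
  by evaluating it on indicators.\<close>

definition trans_op :: "('a set \<Rightarrow> real) \<Rightarrow> 'a set \<Rightarrow> real" where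
  "trans_op F S = (\<Sum>e\<in>E. (1 - theta (S - {e})) * F S + theta (S - {e}) * avg F (S - {e})) / real n"

lemma lam_le_lmax: "e \<in> E \<Longrightarrow> lam e \<le> lmax"
  unfolding lmax_def using finite_ground by simp

text \<open>Multiplying by \<open>tot T\<close> removes the division by zero: if
  \<open>card T = n\<close>, nothing is addable and both sides are 0.\<close>

lemma avg_tot: "T \<in> \<I> \<Longrightarrow>
    tot T * avg F T = real (n - card T) * F T + (\<Sum>e\<in>addable T. lam e * F (insert e T))"
  using tot_pos[of T] card_indep[of T] addable_full[of T] unfolding avg_def
  by (cases "card T = n") (auto simp: tot_def)

lemma card_addable: "T \<in> \<I> \<Longrightarrow> card (addable T) \<le> n - card T"
  using card_mono[of "E - T" "addable T"] finite_ground indep_subset[of T] indep_finite[of T]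
  by (auto simp: card_Diff_subset addable_def)

text \<open>Counts the pairs of a set and the set left after a removal from the side of the latter:
  \<open>T\<close> arises from itself for \<open>n - card T\<close> choices of \<open>e\<close>, and
  from each \<open>insert e T\<close>, whose weight is \<open>lam e * wt T\<close>.\<close>

lemma sum_neighbours:
  "(\<Sum>S\<in>\<I>. wt S * (\<Sum>e\<in>E. \<Phi> S (S - {e}))) =
   (\<Sum>T\<in>\<I>. wt T * (real (n - card T) * \<Phi> T T + (\<Sum>e\<in>addable T. lam e * \<Phi> (insert e T) T)))"
proof -
  have "(\<Sum>S\<in>\<I>. wt S * (\<Sum>e\<in>E. \<Phi> S (S - {e}))) =
    (\<Sum>S\<in>\<I>. wt S * (real (n - card S) * \<Phi> S S)) + (\<Sum>S\<in>\<I>. \<Sum>e\<in>S. wt S * \<Phi> S (S - {e}))"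
    unfolding sum.distrib[symmetric]
  proof (intro sum.cong refl)
    fix S assume S: "S \<in> \<I>"
    have "(\<Sum>e\<in>E. \<Phi> S (S - {e})) = (\<Sum>e\<in>E - S. \<Phi> S (S - {e})) + (\<Sum>e\<in>S. \<Phi> S (S - {e}))"
      using indep_subset[OF S] finite_ground by (rule sum.subset_diff)
    also have "(\<Sum>e\<in>E - S. \<Phi> S (S - {e})) = (\<Sum>e\<in>E - S. \<Phi> S S)"
      by (intro sum.cong refl) (simp add: Diff_insert0)
    also have "\<dots> = real (n - card S) * \<Phi> S S"
      using card_Diff_subset[OF indep_finite[OF S] indep_subset[OF S]] by simp
    finally show "wt S * (\<Sum>e\<in>E. \<Phi> S (S - {e})) =
        wt S * (real (n - card S) * \<Phi> S S) + (\<Sum>e\<in>S. wt S * \<Phi> S (S - {e}))"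
      by (simp add: distrib_left sum_distrib_left)
  qed
  also have "(\<Sum>S\<in>\<I>. \<Sum>e\<in>S. wt S * \<Phi> S (S - {e})) =
      (\<Sum>T\<in>\<I>. \<Sum>e\<in>addable T. wt (insert e T) * \<Phi> (insert e T) (insert e T - {e}))"
    by (rule sum_delete_eq_sum_insert)
  also have "\<dots> = (\<Sum>T\<in>\<I>. wt T * (\<Sum>e\<in>addable T. lam e * \<Phi> (insert e T) T))"
    unfolding sum_distrib_left
    by (intro sum.cong refl) (auto simp: addable_def wt_insert)
  finally show ?thesis by (simp add: distrib_left sum.distrib)
qed

text \<open>The laziness \<open>theta\<close> depends only on the set left after the removal, which
  both ends of a move share. Regrouped by that set, the sum is symmetric in \<open>h\<close> and
  \<open>F\<close>.\<close>

lemma trans_op_self_adjoint: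
  "(\<Sum>S\<in>\<I>. wt S * (h S * trans_op F S)) = (\<Sum>S\<in>\<I>. wt S * (F S * trans_op h S))"
proof -
  have expand: "(\<Sum>S\<in>\<I>. wt S * (h S * trans_op F S)) =
      ((\<Sum>S\<in>\<I>. wt S * (\<Sum>e\<in>E. (1 - theta (S - {e})) * (h S * F S))) +
       (\<Sum>T\<in>\<I>. wt T * (theta T * tot T * avg h T * avg F T))) / real n" for h F
  proof -
    have "(\<Sum>S\<in>\<I>. wt S * (h S * trans_op F S)) =
      ((\<Sum>S\<in>\<I>. wt S * (\<Sum>e\<in>E. (1 - theta (S - {e})) * (h S * F S))) +
       (\<Sum>S\<in>\<I>. wt S * (\<Sum>e\<in>E. theta (S - {e}) * (h S * avg F (S - {e}))))) / real n"
      unfolding sum.distrib[symmetric] sum_divide_distrib trans_op_def distrib_left[symmetric]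
      by (intro sum.cong refl) (simp add: sum_distrib_left mult_ac distrib_left sum_divide_distrib)
    also have "(\<Sum>S\<in>\<I>. wt S * (\<Sum>e\<in>E. theta (S - {e}) * (h S * avg F (S - {e})))) =
       (\<Sum>T\<in>\<I>. wt T * (real (n - card T) * (theta T * (h T * avg F T)) +
          (\<Sum>e\<in>addable T. lam e * (theta T * (h (insert e T) * avg F T)))))"
      by (rule sum_neighbours)
    also have "\<dots> = (\<Sum>T\<in>\<I>. wt T * (theta T * avg F T * (tot T * avg h T)))"
      by (intro sum.cong refl) (simp add: avg_tot distrib_left sum_distrib_left mult_ac)
    finally show ?thesis by (simp add: mult_ac)
  qed
  show ?thesis unfolding expand[of h F] expand[of F h] by (simp add: mult_ac)
qed

definition ent :: "('a set \<Rightarrow> real) \<Rightarrow> real" where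
  "ent h = (\<Sum>S\<in>\<I>. wt S / Z * (h S * ln (h S)))"

definition density :: "('a set \<Rightarrow> real) \<Rightarrow> 'a set pmf \<Rightarrow> bool" where
  "density h \<nu> \<longleftrightarrow> (\<forall>S. 0 \<le> h S) \<and> set_pmf \<nu> \<subseteq> \<I> \<and> (\<forall>S\<in>\<I>. pmf \<nu> S = wt S / Z * h S)"

lemma density_sum: "density h \<nu> \<Longrightarrow> (\<Sum>S\<in>\<I>. wt S / Z * h S) = 1"
  using sum_pmf_eq_1[OF finite_indep, of \<nu>] unfolding density_def by simp

context
  assumes E_nonempty: "E \<noteq> {}"
begin

lemma n_pos: "1 \<le> n" using E_nonempty finite_ground by (simp add: Suc_le_eq card_gt_0_iff)

lemma lmax_pos: "0 < lmax"
proof -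
  obtain e where "e \<in> E" using E_nonempty by blast
  then show ?thesis using lam_pos[of e] lam_le_lmax[of e] by linarith
qed

lemma rate_pos: "0 < rate" and rate_le: "rate \<le> 1" and rate_lmax: "rate * (1 + lmax) = 1"
  unfolding rate_def using lmax_pos by auto

lemma card_delete_less: "S \<in> \<I> \<Longrightarrow> e \<in> E \<Longrightarrow> card (S - {e}) < n"
  using finite_ground indep_subset[of S] by (intro psubset_card_mono) auto

text \<open>The star alone contributes \<open>n - card T\<close> to \<open>tot T\<close>, and at
  most \<open>n - card T\<close> elements are addable, each with field at most
  \<open>lmax\<close>.\<close>

lemma theta_bounds:
  assumes "T \<in> \<I>" "card T < n" shows "rate \<le> theta T" "theta T \<le> 1"
proof -
  have m: "real (n - card T) > 0" using assms by simp
  have "real (n - card T) \<le> tot T"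
    unfolding tot_def using lam_pos by (auto intro!: sum_nonneg simp: addable_def less_imp_le)
  then have "rate * real (n - card T) \<le> rate * tot T" using rate_pos by (intro mult_left_mono) auto
  then show "rate \<le> theta T" unfolding theta_def using m by (simp add: pos_le_divide_eq)
  have "(\<Sum>e\<in>addable T. lam e) \<le> (\<Sum>e\<in>addable T. lmax)"
    by (intro sum_mono lam_le_lmax) (auto simp: addable_def)
  also have "\<dots> \<le> real (n - card T) * lmax"
    using card_addable[OF assms(1)] lmax_pos by (simp add: mult_right_mono)
  finally have "tot T \<le> real (n - card T) * (1 + lmax)" unfolding tot_def by (simp add: algebra_simps)
  then have "rate * tot T \<le> rate * (real (n - card T) * (1 + lmax))" using rate_pos by (intro mult_left_mono) auto
  also have "\<dots> = real (n - card T) * (rate * (1 + lmax))" by (simp only: mult_ac)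
  finally show "theta T \<le> 1" unfolding theta_def rate_lmax using m by (simp add: divide_le_eq)
qed

lemma lazy_mix:
  fixes m :: real
  assumes "m \<noteq> 0"
  shows "r * a + (1 - r) * b + r * (s - l * b) / m = b - r * (m + l) / m * b + r * (m * a + s) / m"
  using assms by (simp add: field_simps)

text \<open>The choice of \<open>rate\<close> makes \<open>(1 - rate) / lmax = rate\<close>. So the
  star is proposed with probability \<open>rate\<close> and each addable \<open>e'\<close> with
  \<open>rate * lam e' / (n - card T)\<close>: these are heat-bath proportions of total probability
  \<open>theta T\<close>.\<close>

lemma pmf_kernel:
  assumes S: "S \<in> \<I>"
  shows "pmf (kernel S) X = trans_op (\<lambda>S'. of_bool (S' = X)) S"
proof -
  let ?F = "\<lambda>S'. of_bool (S' = X) :: real"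
  have "pmf (bind_pmf (bernoulli_pmf rate) (\<lambda>b.
       if b then return_pmf T
       else bind_pmf (pmf_of_set (E - T)) (\<lambda>e'.
         map_pmf (\<lambda>a. if insert e' T \<in> \<I> \<and> a then insert e' T else S)
           (bernoulli_pmf (lam e' / lmax))))) X = (1 - theta T) * ?F S + theta T * avg ?F T"
    if T: "T \<in> \<I>" "card T < n" for T
  proof -
    have TE: "T \<subseteq> E" "finite T" using indep_subset indep_finite T by auto
    have m: "real (n - card T) > 0" "card (E - T) = n - card T"
      using T card_Diff_subset[OF TE(2,1)] by auto
    then have "0 < card (E - T)" by simp
    then have ne: "E - T \<noteq> {}" "finite (E - T)" by (auto simp only: card_gt_0_iff)
    have coin: "pmf (map_pmf (\<lambda>a. if insert e' T \<in> \<I> \<and> a then insert e' T else S) (bernoulli_pmf (lam e' / lmax))) X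
       = ?F S + (if e' \<in> addable T then lam e' / lmax * (?F (insert e' T) - ?F S) else 0)" if e': "e' \<in> E - T" for e'
    proof -
      have p: "0 \<le> lam e' / lmax" "lam e' / lmax \<le> 1"
        using that lam_pos[of e'] lam_le_lmax[of e'] lmax_pos by auto
      show ?thesis
        unfolding map_pmf_def pmf_bind using p e'
        by (subst integral_bernoulli_pmf)
           (auto simp: addable_def pmf_return indicator_def algebra_simps)
    qed
    have "pmf (bind_pmf (pmf_of_set (E - T)) (\<lambda>e'.
         map_pmf (\<lambda>a. if insert e' T \<in> \<I> \<and> a then insert e' T else S)
           (bernoulli_pmf (lam e' / lmax)))) X =
      (\<Sum>e'\<in>E - T. ?F S + (if e' \<in> addable T then lam e' / lmax * (?F (insert e' T) - ?F S) else 0)) / real (n - card T)"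
      unfolding pmf_bind using ne coin m(2) by (simp add: integral_pmf_of_set)
    also have "(\<Sum>e'\<in>E - T. ?F S + (if e' \<in> addable T then lam e' / lmax * (?F (insert e' T) - ?F S) else 0)) =
      real (n - card T) * ?F S + (\<Sum>e'\<in>addable T. lam e' * (?F (insert e' T) - ?F S)) / lmax"
    proof -
      have "(\<Sum>e'\<in>E - T. if e' \<in> addable T then lam e' / lmax * (?F (insert e' T) - ?F S) else 0) =
          (\<Sum>e'\<in>addable T. lam e' / lmax * (?F (insert e' T) - ?F S))"
        using ne by (subst sum.inter_restrict[symmetric]) (auto simp: addable_def intro!: sum.cong)
      then show ?thesis using m by (simp add: sum.distrib sum_divide_distrib)
    qed
    finally have inner: "pmf (bind_pmf (pmf_of_set (E - T)) (\<lambda>e'.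
         map_pmf (\<lambda>a. if insert e' T \<in> \<I> \<and> a then insert e' T else S)
           (bernoulli_pmf (lam e' / lmax)))) X =
       (real (n - card T) * ?F S + (\<Sum>e'\<in>addable T. lam e' * (?F (insert e' T) - ?F S)) / lmax) / real (n - card T)" .
    let ?D = "\<Sum>e'\<in>addable T. lam e' * (?F (insert e' T) - ?F S)"
    have "pmf (bind_pmf (bernoulli_pmf rate) (\<lambda>b.
       if b then return_pmf T
       else bind_pmf (pmf_of_set (E - T)) (\<lambda>e'.
         map_pmf (\<lambda>a. if insert e' T \<in> \<I> \<and> a then insert e' T else S)
           (bernoulli_pmf (lam e' / lmax))))) X =
       rate * ?F T + (1 - rate) * ((real (n - card T) * ?F S + ?D / lmax) / real (n - card T))"
      unfolding pmf_bind[of "bernoulli_pmf rate"] using rate_pos rate_le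
      by (subst integral_bernoulli_pmf) (simp_all add: inner pmf_return indicator_def)
    also have "\<dots> = rate * ?F T + (1 - rate) * ?F S + ((1 - rate) / lmax) * ?D / real (n - card T)"
      using m lmax_pos by (simp add: field_simps)
    also have "(1 - rate) / lmax = rate"
      using rate_lmax lmax_pos by (simp add: field_simps)
    also have "?D = (\<Sum>e'\<in>addable T. lam e' * ?F (insert e' T)) - (\<Sum>e'\<in>addable T. lam e') * ?F S"
      by (simp add: right_diff_distrib sum_subtractf sum_distrib_right)
    also have "rate * ?F T + (1 - rate) * ?F S +
        rate * ((\<Sum>e'\<in>addable T. lam e' * ?F (insert e' T)) - (\<Sum>e'\<in>addable T. lam e') * ?F S) / real (n - card T) =
      ?F S - rate * tot T / real (n - card T) * ?F S +
        rate * (real (n - card T) * ?F T + (\<Sum>e'\<in>addable T. lam e' * ?F (insert e' T))) / real (n - card T)"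
      unfolding tot_def by (rule lazy_mix[OF less_imp_neq[OF m(1), symmetric]])
    also have "real (n - card T) * ?F T + (\<Sum>e'\<in>addable T. lam e' * ?F (insert e' T)) = tot T * avg ?F T"
      using avg_tot[OF T(1), of ?F] by simp
    finally show ?thesis unfolding theta_def by (simp add: algebra_simps)
  qed
  note step = this
  show ?thesis
    unfolding kernel_def trans_op_def pmf_bind[of "pmf_of_set E"]
    using E_nonempty finite_ground step[OF indep_mono[OF S Diff_subset] card_delete_less[OF S]]
    by (simp add: integral_pmf_of_set)
qed

lemma set_pmf_kernel: "S \<in> \<I> \<Longrightarrow> set_pmf (kernel S) \<subseteq> \<I>"
  unfolding kernel_def using indep_mono[of S] by (auto split: if_splits)

lemma avg_nonneg: "(\<And>S. 0 \<le> h S) \<Longrightarrow> T \<in> \<I> \<Longrightarrow> 0 \<le> avg h T"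
  unfolding avg_def tot_def using lam_pos
  by (intro divide_nonneg_nonneg add_nonneg_nonneg sum_nonneg mult_nonneg_nonneg)
    (auto simp: addable_def less_imp_le)

lemma trans_op_nonneg: "(\<And>S. 0 \<le> h S) \<Longrightarrow> S \<in> \<I> \<Longrightarrow> 0 \<le> trans_op h S"
  unfolding trans_op_def
  using theta_bounds[OF indep_mono[of S] card_delete_less[of S]] rate_pos
  by (intro divide_nonneg_nonneg sum_nonneg add_nonneg_nonneg mult_nonneg_nonneg avg_nonneg)
    (auto intro: indep_mono order_trans[OF less_imp_le])

text \<open>Self-adjointness moves \<open>trans_op\<close> from the indicator of \<open>X\<close> to
  the density.\<close>

lemma density_step:
  assumes "density h \<nu>"
  shows "density (\<lambda>S. if S \<in> \<I> then trans_op h S else 0) (bind_pmf \<nu> kernel)"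
  unfolding density_def
proof (intro conjI ballI allI)
  have h: "\<And>S. 0 \<le> h S" and \<nu>: "set_pmf \<nu> \<subseteq> \<I>" "\<And>S. S \<in> \<I> \<Longrightarrow> pmf \<nu> S = wt S / Z * h S"
    using assms unfolding density_def by auto
  show "0 \<le> (if S \<in> \<I> then trans_op h S else 0)" for S using trans_op_nonneg[OF h] by simp
  show "set_pmf (bind_pmf \<nu> kernel) \<subseteq> \<I>" using \<nu>(1) set_pmf_kernel by (auto simp: subset_iff)
  fix X assume X: "X \<in> \<I>"
  have "pmf (bind_pmf \<nu> kernel) X = (\<Sum>S\<in>\<I>. pmf (kernel S) X * pmf \<nu> S)"
    unfolding pmf_bind using \<nu>(1) finite_indep by (subst integral_measure_pmf_real[of \<I>]) auto
  also have "\<dots> = (\<Sum>S\<in>\<I>. wt S * (h S * trans_op (\<lambda>S'. of_bool (S' = X)) S)) / Z"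
    unfolding sum_divide_distrib by (intro sum.cong refl) (simp add: pmf_kernel \<nu>(2))
  also have "\<dots> = (\<Sum>S\<in>\<I>. wt S * (of_bool (S = X) * trans_op h S)) / Z"
    unfolding trans_op_self_adjoint[of h] ..
  also have "(\<Sum>S\<in>\<I>. wt S * (of_bool (S = X) * trans_op h S)) = wt X * trans_op h X"
    using finite_indep X by (simp add: of_bool_def if_distrib if_distribR cong: if_cong)
  finally show "pmf (bind_pmf \<nu> kernel) X = wt X / Z * (if X \<in> \<I> then trans_op h X else 0)"
    using X by simp
qed

text \<open>Jensen, first over the uniform letter and then over the lazy mixture, shows a loss of at
  least \<open>theta T * gap T\<close> per remaining set, \<open>gap T\<close> being the local
  Jensen gap. The gaps are nonnegative, so \<open>theta\<close> may be lowered to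
  \<open>rate\<close>, and by \<open>entropy_contraction_sets\<close> their weighted sum is at least
  the whole entropy.\<close>

lemma ent_step:
  assumes d: "density h \<nu>"
  shows "ent (\<lambda>S. if S \<in> \<I> then trans_op h S else 0) \<le> (1 - rate / real n) * ent h"
proof -
  have h: "\<And>S. 0 \<le> h S" using d unfolding density_def by auto
  define \<psi> where "\<psi> x = x * ln x" for x :: real
  have np: "real n > 0" using n_pos by linarith
  define gap where "gap T = real (n - card T) * \<psi> (h T) + (\<Sum>e\<in>addable T. lam e * \<psi> (h (insert e T))) - tot T * \<psi> (avg h T)" for T
  have gap0: "0 \<le> gap T" if T: "T \<in> \<I>" for T
  proof (cases "card T = n")
    case True
    then show ?thesis using addable_full[OF True T] by (simp add: gap_def tot_def)
  next
    case False
    then have "0 < tot T" using tot_pos card_indep[OF T] by simp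
    then have "tot T * \<psi> (avg h T) \<le> real (n - card T) * \<psi> (h T) + (\<Sum>e\<in>addable T. lam e * \<psi> (h (insert e T)))"
      unfolding tot_def \<psi>_def using avg_tot[OF T, of h] h lam_pos finite_addable
      by (intro xlnx_jensen_insert) (auto simp: tot_def addable_def less_imp_le mult.commute)
    then show ?thesis unfolding gap_def by simp
  qed
  have conv: "real n * \<psi> (trans_op h S) \<le> (\<Sum>e\<in>E. \<psi> (h S) - theta (S - {e}) * (\<psi> (h S) - \<psi> (avg h (S - {e}))))"
    if S: "S \<in> \<I>" for S
  proof -
    define z where "z e = (1 - theta (S - {e})) * h S + theta (S - {e}) * avg h (S - {e})" for e
    have T: "S - {e} \<in> \<I>" "rate \<le> theta (S - {e})" "theta (S - {e}) \<le> 1" if "e \<in> E" for e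
      using theta_bounds[OF indep_mono[OF S Diff_subset] card_delete_less[OF S that]] indep_mono[OF S] by auto
    have z0: "0 \<le> z e" if "e \<in> E" for e
      unfolding z_def using T[OF that] h avg_nonneg[OF h T(1)[OF that]] rate_pos by (simp add: add_nonneg_nonneg)
    have "(\<Sum>e\<in>E. 1) * (trans_op h S * ln (trans_op h S)) \<le> (\<Sum>e\<in>E. 1 * (z e * ln (z e)))"
      by (rule xlnx_jensen) (use finite_ground z0 np in \<open>auto simp: trans_op_def z_def\<close>)
    also have "\<dots> \<le> (\<Sum>e\<in>E. \<psi> (h S) - theta (S - {e}) * (\<psi> (h S) - \<psi> (avg h (S - {e}))))"
    proof (intro sum_mono)
      fix e assume e: "e \<in> E"
      \<comment> \<open>Two-point Jensen; the singleton \<open>{()}\<close> indexes the second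
        point.\<close>
      have "((1 - theta (S - {e})) + (\<Sum>i\<in>{()}. theta (S - {e}))) * (z e * ln (z e)) \<le>
         (1 - theta (S - {e})) * (h S * ln (h S)) + (\<Sum>i\<in>{()}. theta (S - {e}) * (avg h (S - {e}) * ln (avg h (S - {e}))))"
        by (rule xlnx_jensen_insert) (use T[OF e] rate_pos h avg_nonneg[OF h T(1)[OF e]] in \<open>auto simp: z_def\<close>)
      then show "1 * (z e * ln (z e)) \<le> \<psi> (h S) - theta (S - {e}) * (\<psi> (h S) - \<psi> (avg h (S - {e})))"
        unfolding \<psi>_def by (simp add: algebra_simps)
    qed
    finally show ?thesis unfolding \<psi>_def by simp
  qed
  have reg: "(\<Sum>S\<in>\<I>. wt S * (\<Sum>e\<in>E. r (S - {e}) * (\<psi> (h S) - \<psi> (avg h (S - {e}))))) = (\<Sum>T\<in>\<I>. wt T * (r T * gap T))" for r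
    unfolding sum_neighbours[of "\<lambda>S T. r T * (\<psi> (h S) - \<psi> (avg h T))"]
  proof (intro sum.cong refl)
    fix T
    have "(\<Sum>e\<in>addable T. lam e * (r T * (\<psi> (h (insert e T)) - \<psi> (avg h T)))) =
       r T * ((\<Sum>e\<in>addable T. lam e * \<psi> (h (insert e T))) - (\<Sum>e\<in>addable T. lam e) * \<psi> (avg h T))"
      unfolding sum_distrib_left sum_distrib_right sum_subtractf[symmetric]
      by (intro sum.cong refl) (simp add: algebra_simps)
    then show "wt T * (real (n - card T) * (r T * (\<psi> (h T) - \<psi> (avg h T))) +
           (\<Sum>e\<in>addable T. lam e * (r T * (\<psi> (h (insert e T)) - \<psi> (avg h T))))) = wt T * (r T * gap T)"
      unfolding gap_def tot_def by (simp only:) (simp only: algebra_simps)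
  qed
  let ?E = "\<Sum>S\<in>\<I>. wt S * \<psi> (h S)"
  have con: "(\<Sum>T\<in>\<I>. wt T * tot T * \<psi> (avg h T)) \<le> (real n - 1) * ?E"
  proof -
    have "(\<Sum>T\<in>\<I>. wt T / Z * tot T * (avg h T * ln (avg h T))) \<le> (real n - 1) * (\<Sum>S\<in>\<I>. wt S / Z * (h S * ln (h S)))"
      by (rule entropy_contraction_sets) (use h density_sum[OF d] n_pos in auto)
    then have "(\<Sum>T\<in>\<I>. wt T * tot T * \<psi> (avg h T)) / Z \<le> (real n - 1) * (?E / Z)"
      unfolding \<psi>_def sum_divide_distrib by (simp add: mult_ac)
    then show ?thesis using Z_pos by (simp add: divide_le_cancel)
  qed
  have E_le: "?E \<le> (\<Sum>T\<in>\<I>. wt T * gap T)"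
  proof -
    have "(\<Sum>T\<in>\<I>. wt T * (real (n - card T) * \<psi> (h T) + (\<Sum>e\<in>addable T. lam e * \<psi> (h (insert e T))))) = (\<Sum>S\<in>\<I>. wt S * (\<Sum>e\<in>E. \<psi> (h S)))"
      by (rule sum_neighbours[symmetric])
    also have "\<dots> = real n * ?E" by (simp add: sum_distrib_left mult_ac)
    finally have "(\<Sum>T\<in>\<I>. wt T * gap T) = real n * ?E - (\<Sum>T\<in>\<I>. wt T * tot T * \<psi> (avg h T))"
      unfolding gap_def by (simp add: right_diff_distrib sum_subtractf mult.assoc)
    then show ?thesis using con by (simp add: algebra_simps)
  qed
  have "rate * ?E \<le> (\<Sum>T\<in>\<I>. wt T * (theta T * gap T))"
  proof -
    have "rate * ?E \<le> rate * (\<Sum>T\<in>\<I>. wt T * gap T)" using E_le rate_pos by (intro mult_left_mono) auto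
    also have "\<dots> = (\<Sum>T\<in>\<I>. wt T * (rate * gap T))" by (simp add: sum_distrib_left mult_ac)
    also have "\<dots> \<le> (\<Sum>T\<in>\<I>. wt T * (theta T * gap T))"
    proof (intro sum_mono mult_left_mono)
      fix T assume T: "T \<in> \<I>"
      show "rate * gap T \<le> theta T * gap T"
      proof (cases "card T = n")
        case True
        then have "gap T = 0" using addable_full[OF True T] by (simp add: gap_def tot_def)
        then show ?thesis by simp
      next
        case False
        then show ?thesis using theta_bounds(1)[OF T] card_indep[OF T] gap0[OF T] by (intro mult_right_mono) auto
      qed
    qed (use wt_pos in \<open>auto simp: less_imp_le\<close>)
    finally show ?thesis .
  qed
  moreover have "(\<Sum>S\<in>\<I>. wt S * (real n * \<psi> (trans_op h S))) \<le>
     (\<Sum>S\<in>\<I>. wt S * (\<Sum>e\<in>E. \<psi> (h S) - theta (S - {e}) * (\<psi> (h S) - \<psi> (avg h (S - {e})))))"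
    using conv wt_pos by (intro sum_mono mult_left_mono) (auto simp: less_imp_le)
  moreover have "(\<Sum>S\<in>\<I>. wt S * (\<Sum>e\<in>E. \<psi> (h S) - theta (S - {e}) * (\<psi> (h S) - \<psi> (avg h (S - {e}))))) =
     real n * ?E - (\<Sum>T\<in>\<I>. wt T * (theta T * gap T))"
    unfolding sum_subtractf right_diff_distrib[of "wt _"] reg by (simp add: sum_distrib_left mult_ac)
  ultimately have "real n * (\<Sum>S\<in>\<I>. wt S * \<psi> (trans_op h S)) \<le> real n * ?E - rate * ?E"
    by (simp add: sum_distrib_left mult_ac)
  then have "(\<Sum>S\<in>\<I>. wt S * \<psi> (trans_op h S)) \<le> (1 - rate / real n) * ?E"
    using np by (simp add: field_simps)
  then have "(\<Sum>S\<in>\<I>. wt S * \<psi> (trans_op h S)) / Z \<le> (1 - rate / real n) * (?E / Z)"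
    using Z_pos by (simp add: divide_le_cancel)
  then show ?thesis
    unfolding ent_def \<psi>_def sum_divide_distrib by simp
qed

lemma density_iter:
  assumes "density h (return_pmf S0)"
  shows "\<exists>h'. density h' (iter_pmf kernel m S0) \<and> ent h' \<le> (1 - rate / real n)^m * ent h"
proof (induction m)
  case 0
  then show ?case using assms by auto
next
  case (Suc m)
  then obtain h' where h': "density h' (iter_pmf kernel m S0)" "ent h' \<le> (1 - rate / real n)^m * ent h"
    by blast
  have "rate / real n \<le> 1" using rate_le n_pos by (simp add: divide_le_eq)
  then have "(1 - rate / real n) * ent h' \<le> (1 - rate / real n) * ((1 - rate / real n)^m * ent h)"
    using h'(2) by (intro mult_left_mono) auto
  then have "ent (\<lambda>S. if S \<in> \<I> then trans_op h' S else 0) \<le> (1 - rate / real n)^Suc m * ent h"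
    using ent_step[OF h'(1)] by (simp add: mult.assoc)
  then show ?case using density_step[OF h'(1)] unfolding iter_pmf_Suc_right by blast
qed

text \<open>Both sides are compared with the squared Hellinger distance, which is \<open>2 - 2 * B\<close> below.\<close>

lemma tv_dist_le_ent:
  assumes d: "density h \<nu>"
  shows "(tv_dist \<I> (pmf \<nu>) (indep_dist \<I> lam))^2 \<le> ent h"
proof -
  have h: "\<And>S. 0 \<le> h S" "\<And>S. S \<in> \<I> \<Longrightarrow> pmf \<nu> S = wt S / Z * h S"
    using d unfolding density_def by auto
  define p where "p S = wt S / Z" for S
  have p: "0 < p S" if "S \<in> \<I>" for S unfolding p_def using wt_pos[OF that] Z_pos by simp
  have p1: "(\<Sum>S\<in>\<I>. p S) = 1" unfolding p_def using Z_pos by (simp add: sum_divide_distrib[symmetric] Z_def[symmetric])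
  have ph: "(\<Sum>S\<in>\<I>. p S * h S) = 1" using density_sum[OF d] unfolding p_def .
  define g where "g S = sqrt (h S)" for S
  have g: "0 \<le> g S" "g S * g S = h S" for S unfolding g_def using h(1) by auto
  define B where "B = (\<Sum>S\<in>\<I>. p S * g S)"
  have B: "B \<le> 1"
  proof -
    have "2 * B \<le> (\<Sum>S\<in>\<I>. p S * h S + p S)"
      unfolding B_def sum_distrib_left
    proof (intro sum_mono)
      fix S assume S: "S \<in> \<I>"
      have "0 \<le> (g S - 1)^2" by simp
      then have "2 * g S \<le> h S + 1" using g(2)[of S] by (simp add: power2_eq_square algebra_simps)
      then have "p S * (2 * g S) \<le> p S * (h S + 1)" using p[OF S] by (intro mult_left_mono) auto
      then show "2 * (p S * g S) \<le> p S * h S + p S" by (simp add: algebra_simps)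
    qed
    then show ?thesis using p1 ph by (simp add: sum.distrib)
  qed
  have entB: "2 - 2 * B \<le> ent h"
  proof -
    have "(\<Sum>S\<in>\<I>. p S * (2 * h S - 2 * g S)) \<le> (\<Sum>S\<in>\<I>. p S * (h S * ln (h S)))"
    proof (intro sum_mono)
      fix S assume S: "S \<in> \<I>"
      have "2 * h S - 2 * g S \<le> h S * ln (h S)"
      proof (cases "h S = 0")
        case True
        then show ?thesis by (simp add: g_def)
      next
        case False
        then have hp: "h S > 0" using h(1)[of S] by simp
        then have gp: "g S > 0" unfolding g_def by simp
        have "g S - 1 \<le> g S * (ln (g S) - ln 1)" by (rule diff_le_mult_ln_diff) (use gp in auto)
        then have "g S * (g S - 1) \<le> g S * (g S * ln (g S))" using gp by (intro mult_left_mono) auto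
        moreover have "ln (h S) = 2 * ln (g S)" unfolding g_def using hp by (simp add: ln_sqrt)
        moreover have "g S * (g S - 1) = h S - g S" by (simp add: right_diff_distrib g(2))
        moreover have "g S * (g S * ln (g S)) = h S * ln (g S)" by (simp only: mult.assoc[symmetric] g(2))
        ultimately show ?thesis by simp
      qed
      then show "p S * (2 * h S - 2 * g S) \<le> p S * (h S * ln (h S))" using p[OF S] by (intro mult_left_mono) auto
    qed
    moreover have "(\<Sum>S\<in>\<I>. p S * (2 * h S - 2 * g S)) = 2 * (\<Sum>S\<in>\<I>. p S * h S) - 2 * B"
      unfolding B_def sum_distrib_left sum_subtractf[symmetric] by (intro sum.cong refl) (simp add: algebra_simps)
    ultimately show ?thesis using ph unfolding ent_def p_def[symmetric] by linarith
  qed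
  have "tv_dist \<I> (pmf \<nu>) (indep_dist \<I> lam) = 1 / 2 * (\<Sum>S\<in>\<I>. (sqrt (p S) * \<bar>g S - 1\<bar>) * (sqrt (p S) * (g S + 1)))"
    unfolding tv_dist_def
  proof (intro arg_cong[of _ _ "\<lambda>x. 1 / 2 * x"] sum.cong refl)
    fix S assume S: "S \<in> \<I>"
    have "pmf \<nu> S - indep_dist \<I> lam S = p S * (h S - 1)"
    proof -
      have "indep_dist \<I> lam S = p S" using S unfolding indep_dist_def p_def Z_def wt_def by simp
      moreover have "pmf \<nu> S = p S * h S" using h(2)[OF S] unfolding p_def .
      ultimately show ?thesis by (simp add: right_diff_distrib)
    qed
    also have "h S - 1 = (g S - 1) * (g S + 1)" using g(2)[of S] by (simp add: algebra_simps)
    finally have "\<bar>pmf \<nu> S - indep_dist \<I> lam S\<bar> = p S * (\<bar>g S - 1\<bar> * (g S + 1))"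
      using p[OF S] g(1)[of S] by (simp add: abs_mult)
    also have "p S = sqrt (p S) * sqrt (p S)" using p[OF S] by simp
    finally show "\<bar>pmf \<nu> S - indep_dist \<I> lam S\<bar> = sqrt (p S) * \<bar>g S - 1\<bar> * (sqrt (p S) * (g S + 1))"
      by (simp only: mult_ac)
  qed
  then have "(tv_dist \<I> (pmf \<nu>) (indep_dist \<I> lam))^2 =
      1 / 4 * (\<Sum>S\<in>\<I>. (sqrt (p S) * \<bar>g S - 1\<bar>) * (sqrt (p S) * (g S + 1)))^2"
    by (simp only: power_mult_distrib) (simp add: power_divide)
  also have "\<dots> \<le> 1 / 4 * ((\<Sum>S\<in>\<I>. (sqrt (p S) * \<bar>g S - 1\<bar>)^2) * (\<Sum>S\<in>\<I>. (sqrt (p S) * (g S + 1))^2))"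
    by (intro mult_left_mono Cauchy_Schwarz_ineq_sum) auto
  also have "(\<Sum>S\<in>\<I>. (sqrt (p S) * \<bar>g S - 1\<bar>)^2) = (\<Sum>S\<in>\<I>. p S * h S + p S - 2 * (p S * g S))"
    by (intro sum.cong refl) (use p in \<open>simp add: power_mult_distrib less_imp_le power2_eq_square algebra_simps flip: g(2)\<close>)
  also have "\<dots> = 2 - 2 * B"
    by (simp add: sum_subtractf sum.distrib ph p1 B_def sum_distrib_left)
  also have "(\<Sum>S\<in>\<I>. (sqrt (p S) * (g S + 1))^2) = (\<Sum>S\<in>\<I>. p S * h S + p S + 2 * (p S * g S))"
    by (intro sum.cong refl) (use p in \<open>simp add: power_mult_distrib less_imp_le power2_eq_square algebra_simps flip: g(2)\<close>)
  also have "\<dots> = 2 + 2 * B"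
    by (simp add: sum.distrib ph p1 B_def sum_distrib_left)
  also have "1 / 4 * ((2 - 2 * B) * (2 + 2 * B)) = (1 - B) * (1 + B)" by (simp add: algebra_simps)
  also have "\<dots> \<le> (1 - B) * 2" using B by (intro mult_left_mono) auto
  also have "\<dots> \<le> ent h" using entB by simp
  finally show ?thesis .
qed

text \<open>A point mass at \<open>S0\<close> has entropy \<open>ln (Z / wt S0)\<close>. The factor
  2 in the number of steps gives a contraction by \<open>(\<epsilon> / n)^2\<close>, which takes
  \<open>n^2\<close> to \<open>\<epsilon>^2\<close>.\<close>

lemma iter_kernel_tv_dist:
  assumes S0: "S0 \<in> \<I>" and warm: "ln (Z / wt S0) \<le> (real n)^2"
    and \<epsilon>: "0 < \<epsilon>" "\<epsilon> < 1" and m: "2 * (1 + lmax) * real n * ln (real n / \<epsilon>) \<le> real m"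
  shows "tv_dist \<I> (pmf (iter_pmf kernel m S0)) (indep_dist \<I> lam) \<le> \<epsilon>"
proof -
  define h where "h S = (if S = S0 then Z / wt S0 else 0)" for S
  have "density h (return_pmf S0)"
    unfolding density_def h_def using S0 wt_pos[OF S0] Z_pos by (auto simp: indicator_def)
  then obtain h' where h': "density h' (iter_pmf kernel m S0)" "ent h' \<le> (1 - rate / real n)^m * ent h"
    using density_iter by blast
  have np: "real n \<ge> 1" using n_pos by simp
  have "ent h = (\<Sum>S\<in>\<I>. if S = S0 then ln (Z / wt S0) else 0)"
    unfolding ent_def h_def using wt_pos[OF S0] Z_pos by (intro sum.cong refl) simp
  also have "\<dots> = ln (Z / wt S0)" using finite_indep S0 by simp
  finally have eh: "ent h \<le> (real n)^2" using warm by simp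
  have r1: "0 \<le> 1 - rate / real n" using rate_le np by (simp add: divide_le_eq)
  have "1 - rate / real n \<le> exp (- (rate / real n))"
    using exp_ge_add_one_self[of "- (rate / real n)"] by simp
  then have "(1 - rate / real n)^m \<le> exp (- (rate / real n))^m" using r1 by (intro power_mono) auto
  also have "\<dots> = exp (- (real m * rate / real n))" by (simp add: exp_of_nat_mult[symmetric])
  also have "\<dots> \<le> exp (- (2 * ln (real n / \<epsilon>)))"
  proof -
    have "2 * ln (real n / \<epsilon>) * real n = rate * (2 * (1 + lmax) * real n * ln (real n / \<epsilon>))"
    proof -
      have "rate * (2 * (1 + lmax) * real n * ln (real n / \<epsilon>)) = (rate * (1 + lmax)) * (2 * ln (real n / \<epsilon>) * real n)"
        by (simp only: mult_ac)
      then show ?thesis by (simp only: rate_lmax mult_1_left)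
    qed
    also have "\<dots> \<le> rate * real m" using m rate_pos by (intro mult_left_mono) auto
    finally show ?thesis using np by (simp add: pos_le_divide_eq mult.commute)
  qed
  also have "\<dots> = (\<epsilon> / real n)^2"
  proof -
    have "exp (- (2 * ln (real n / \<epsilon>))) = exp (- ln (real n / \<epsilon>))^2"
      by (simp add: exp_double[symmetric])
    also have "exp (- ln (real n / \<epsilon>)) = \<epsilon> / real n" using \<epsilon> np by (simp add: exp_minus)
    finally show ?thesis .
  qed
  finally have "(1 - rate / real n)^m \<le> (\<epsilon> / real n)^2" .
  then have "(1 - rate / real n)^m * ent h \<le> (1 - rate / real n)^m * (real n)^2" 
    "(1 - rate / real n)^m * (real n)^2 \<le> (\<epsilon> / real n)^2 * (real n)^2"
    using eh r1 by (auto intro!: mult_left_mono mult_right_mono)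
  then have "ent h' \<le> (\<epsilon> / real n)^2 * (real n)^2" using h'(2) by linarith
  then have "ent h' \<le> \<epsilon>^2" using np by (simp add: power_divide)
  then have "(tv_dist \<I> (pmf (iter_pmf kernel m S0)) (indep_dist \<I> lam))^2 \<le> \<epsilon>^2"
    using tv_dist_le_ent[OF h'(1)] by simp
  then show ?thesis by (rule power2_le_imp_le) (use \<epsilon> in simp)
qed

section \<open>Support of the chain and warm starts\<close>

lemma set_pmf_iter_kernel: "S0 \<in> \<I> \<Longrightarrow> set_pmf (iter_pmf kernel m S0) \<subseteq> \<I>"
proof (induction m)
  case (Suc m)
  then show ?case using set_pmf_kernel unfolding iter_pmf_Suc_right set_bind_pmf by blast
qed simp

text \<open>\<open>Z\<close> is at most the product of all \<open>1 + lam e\<close>, hence at most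
  \<open>(1 + n)^n\<close>, and \<open>ln (1 + n) \<le> n\<close>.\<close>

lemma warm_empty:
  assumes "lmax \<le> real n"
  shows "ln (Z / wt {}) \<le> (real n)^2"
proof -
  have "Z \<le> (\<Sum>S\<in>Pow E. wt S)"
    unfolding Z_def
  proof (rule sum_mono2)
    show "0 \<le> wt S" if "S \<in> Pow E - \<I>" for S
      unfolding wt_def by (intro prod_nonneg less_imp_le lam_pos) (use that in blast)
  qed (use finite_ground indep_subset in auto)
  also have "\<dots> = (\<Prod>e\<in>E. 1 + lam e)"
    unfolding wt_def by (subst add.commute) (simp add: prod_add[OF finite_ground])
  also have "\<dots> \<le> (\<Prod>e\<in>E. 1 + real n)"
  proof (rule prod_mono)
    fix e assume "e \<in> E"
    then show "0 \<le> 1 + lam e \<and> 1 + lam e \<le> 1 + real n"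
      using lam_pos[of e] lam_le_lmax[of e] assms by linarith
  qed
  finally have "Z \<le> (1 + real n)^n" by simp
  then have "ln Z \<le> ln ((1 + real n)^n)" using Z_pos by simp
  also have "\<dots> = real n * ln (1 + real n)" by (simp add: ln_realpow)
  also have "\<dots> \<le> real n * real n" by (intro mult_left_mono ln_add_one_self_le_self) auto
  finally show ?thesis by (simp add: wt_def power2_eq_square)
qed

text \<open>There are at most \<open>2^n\<close> independent sets, none heavier than
  \<open>S0\<close>.\<close>

lemma warm_dominant:
  assumes S0: "S0 \<in> \<I>" and dom: "\<And>T. T \<in> \<I> \<Longrightarrow> wt T \<le> wt S0"
  shows "ln (Z / wt S0) \<le> (real n)^2"
proof -
  have "Z \<le> (\<Sum>T\<in>\<I>. wt S0)" unfolding Z_def by (intro sum_mono dom)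
  also have "\<dots> = real (card \<I>) * wt S0" by simp
  also have "\<dots> \<le> 2^n * wt S0"
  proof -
    have "card \<I> \<le> card (Pow E)" using finite_ground indep_subset by (intro card_mono) auto
    then have "real (card \<I>) \<le> 2^n" using finite_ground by (simp add: card_Pow)
    then show ?thesis using wt_pos[OF S0] by (intro mult_right_mono) auto
  qed
  finally have "Z / wt S0 \<le> 2^n" using wt_pos[OF S0] by (simp add: divide_le_eq)
  then have "ln (Z / wt S0) \<le> ln (2^n)" using Z_pos wt_pos[OF S0] by (intro ln_mono) auto
  also have "\<dots> = real n * ln 2" by (simp add: ln_realpow)
  also have "\<dots> \<le> real n * real n" using n_pos ln_2_less_1 by (intro mult_left_mono) auto
  finally show ?thesis by (simp add: power2_eq_square)
qed

end

text \<open>\<open>U\<close> is the set of elements not considered yet.\<close>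

definition greedy_inv :: "'a set \<Rightarrow> 'a set \<Rightarrow> bool" where
  "greedy_inv U S \<longleftrightarrow> S \<in> \<I> \<and> U \<subseteq> E \<and> S \<subseteq> E - U \<and>
     (\<forall>y\<in>E - U - S. insert y S \<notin> \<I>) \<and> (\<forall>y\<in>E - U. \<forall>x\<in>U. lam x \<le> lam y) \<and>
     (\<forall>T\<in>\<I>. T \<subseteq> E - U \<longrightarrow> wt T \<le> wt S)"

lemma greedy_inv_init: "greedy_inv E {}"
  unfolding greedy_inv_def using indep_empty by auto

text \<open>Exchange argument. If \<open>x\<close> cannot be added and \<open>T\<close> contains
  \<open>x\<close>, maximality of \<open>S\<close> makes \<open>T - {x}\<close> smaller than
  \<open>S\<close>, so it can be augmented by some \<open>y\<close> of \<open>S\<close>, whose field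
  is at least that of \<open>x\<close>. The bound \<open>1 \<le> lam x\<close> ensures that adding
  \<open>x\<close> loses no weight.\<close>

lemma greedy_inv_step:
  assumes inv: "greedy_inv U S" and x: "x \<in> U" "\<And>y. y \<in> U \<Longrightarrow> lam y \<le> lam x" and x1: "1 \<le> lam x"
  shows "greedy_inv (U - {x}) (if insert x S \<in> \<I> then insert x S else S)"
proof -
  have S: "S \<in> \<I>" "U \<subseteq> E" "S \<subseteq> E - U" and max: "\<And>y. y \<in> E - U - S \<Longrightarrow> insert y S \<notin> \<I>"
    and ord: "\<And>y z. y \<in> E - U \<Longrightarrow> z \<in> U \<Longrightarrow> lam z \<le> lam y"
    and opt: "\<And>T. T \<in> \<I> \<Longrightarrow> T \<subseteq> E - U \<Longrightarrow> wt T \<le> wt S"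
    using inv unfolding greedy_inv_def by auto
  have xE: "x \<in> E" "x \<notin> S" using S x by auto
  have EU: "E - (U - {x}) = insert x (E - U)" using xE x(1) by auto
  have lx: "lam x > 0" using lam_pos xE by auto
  define S' where "S' = (if insert x S \<in> \<I> then insert x S else S)"
  have opt': "wt T \<le> wt S'" if T: "T \<in> \<I>" "T \<subseteq> insert x (E - U)" for T
  proof (cases "x \<in> T")
    case False
    then have "wt T \<le> wt S" using T by (intro opt) auto
    also have "wt S \<le> wt S'"
      unfolding S'_def using wt_insert[OF S(1) xE(2)] x1 wt_pos[OF S(1)] by simp
    finally show ?thesis .
  next
    case True
    define R where "R = T - {x}"
    have R: "R \<in> \<I>" "x \<notin> R" "R \<subseteq> E - U" "T = insert x R"
      using T True unfolding R_def by (auto intro: indep_mono)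
    have wT: "wt T = lam x * wt R" using wt_insert[OF R(1,2)] R(4) by simp
    show ?thesis
    proof (cases "insert x S \<in> \<I>")
      case True
      then show ?thesis unfolding S'_def wT using wt_insert[OF S(1) xE(2)] opt[OF R(1,3)] lx by simp
    next
      case False
      have "card T \<le> card S"
      proof (rule ccontr)
        assume "\<not> card T \<le> card S"
        then obtain y where "y \<in> T - S" "insert y S \<in> \<I>" using augment[OF S(1) T(1)] by auto
        then show False using max[of y] T(2) False by auto
      qed
      moreover have "card R < card T" unfolding R(4) using R(2) indep_finite[OF R(1)] by simp
      ultimately have "card R < card S" by simp
      then obtain y where y: "y \<in> S - R" "insert y R \<in> \<I>" using augment[OF R(1) S(1)] by blast
      have "lam x \<le> lam y" using y(1) S(3) by (intro ord x(1)) auto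
      then have "wt T \<le> wt (insert y R)"
        unfolding wT using wt_insert[OF R(1), of y] y wt_pos[OF R(1)] by (simp add: mult_right_mono)
      also have "\<dots> \<le> wt S" using y S(3) R(3) by (intro opt) auto
      finally show ?thesis using False unfolding S'_def by simp
    qed
  qed
  have "insert y S' \<notin> \<I>" if y: "y \<in> insert x (E - U) - S'" for y
  proof (cases "y = x")
    case True
    then show ?thesis using y unfolding S'_def by (auto split: if_splits)
  next
    case False
    then have "insert y S \<notin> \<I>" using y max unfolding S'_def by (auto split: if_splits)
    then show ?thesis unfolding S'_def using indep_mono[of "insert y (insert x S)" "insert y S"] by auto
  qed
  then show ?thesis
    unfolding greedy_inv_def S'_def[symmetric] EU
    using S opt' ord x xE unfolding S'_def by (auto split: if_splits)
qed

text \<open>Deleting elements with fields at most 1 from \<open>T\<close> does not lower its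
  weight.\<close>

lemma greedy_inv_dominant:
  assumes inv: "greedy_inv U S" and small: "\<And>y. y \<in> U \<Longrightarrow> lam y \<le> 1" and T: "T \<in> \<I>"
  shows "wt T \<le> wt S"
proof -
  have fT: "finite T" using T indep_finite by blast
  have "wt T = wt (T - U) * wt (T \<inter> U)"
    unfolding wt_def using fT prod.Int_Diff[of T lam U] by (simp add: mult.commute)
  also have "\<dots> \<le> wt (T - U) * 1"
  proof (intro mult_left_mono)
    show "wt (T \<inter> U) \<le> 1" unfolding wt_def
      using small T indep_subset[of T] lam_pos by (intro prod_le_1) (auto simp: less_imp_le subset_iff)
    show "0 \<le> wt (T - U)" using wt_pos[of "T - U"] indep_mono[OF T] by (auto simp: less_imp_le)
  qed
  also have "wt (T - U) \<le> wt S"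
    using inv T indep_subset[OF T] indep_mono[OF T, of "T - U"] unfolding greedy_inv_def by auto
  finally show ?thesis by simp
qed

end

section \<open>The sampling program\<close>

lemma det_CondI:
  assumes "bval b s \<Longrightarrow> det n orc t c s (B - 1) P" "\<not> bval b s \<Longrightarrow> det n orc t d s (B - 1) P"
  shows "det n orc t (Cond b c d) s B P"
  by (rule det_Cond) (use assms in auto)

lemma det_Query:
  "1 + t \<le> B \<Longrightarrow> P (s\<lparr>ireg := (ireg s)(r := of_bool (orc (set_at n (ival a s) s)))\<rparr>) \<Longrightarrow>
   det n orc t (Query r a) s B P"
  unfolding det_def by (rule exI, rule conjI, assumption, rule refines_Query; simp)

lemmas det_rules = det_ISet_Seq det_RSet_Seq det_IStore_Seq det_RStore_Seq det_Query_Seq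
  det_ISet det_RSet det_IStore det_RStore det_Query det_Skip det_CondI

lemma refines_CondI:
  assumes "bval b s \<Longrightarrow> refines n orc t c s (B - 1) R D" "\<not> bval b s \<Longrightarrow> refines n orc t d s (B - 1) R D"
  shows "refines n orc t (Cond b c d) s B R D"
  by (rule refines_Cond) (use assms in auto)

lemma refines_map:
  assumes "refines n orc t c s B R D" "\<And>s' x. R s' x \<Longrightarrow> R' s' (f x)"
  shows "refines n orc t c s B R' (map_pmf f D)"
proof -
  obtain \<mu> where \<mu>: "ev n orc t c s \<mu>" "rel_pmf (\<lambda>(s', \<tau>) x. \<tau> \<le> B \<and> R s' x) \<mu> D"
    using assms(1) unfolding refines_def by blast
  have "rel_pmf (\<lambda>(s', \<tau>) x. \<tau> \<le> B \<and> R' s' x) \<mu> (map_pmf f D)"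
    unfolding pmf.rel_map using \<mu>(2) by (rule pmf.rel_mono_strong) (use assms(2) in auto)
  then show ?thesis using \<mu>(1) unfolding refines_def by blast
qed

abbreviation seq :: "com \<Rightarrow> com \<Rightarrow> com" (infixr ";;" 60) where "c ;; d \<equiv> Seq c d"

abbreviation iinc :: "nat \<Rightarrow> com" where "iinc r \<equiv> ISet r (IAdd (IReg r) (IConst 1))"

text \<open>
  Integer registers: 0 holds \<open>n\<close>, 2 the size of the current set in the main loop, 4 whether an element
  has just been removed, 5 and 6 the proposed element and the oracle's answer, 10 to 13 belong to the
  sampler; the others are loop variables. Real registers: 0 holds \<open>\<epsilon>\<close>, 1 the largest field, 4 and 5 the
  number of steps to make and made, 6 the probability \<open>rate\<close>. Integer memory: the current set at
  \<open>1..n\<close>, a permutation of the ground set that lists this set first at \<open>n + 1..2n\<close>, and \<open>i div 2\<close> at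
  \<open>-i\<close>, since there is no integer division. Real memory: at \<open>-i\<close> a copy of the field of \<open>i\<close>, erased
  once the greedy algorithm has considered \<open>i\<close>; the 1 at address 0 makes it ignore fields of at most 1.
\<close>

definition tables :: com where
  "tables = RStore (IConst 0) (OfInt (IConst 1)) ;;
    While (ILess (IReg 1) (IReg 0)) (
      iinc 1 ;;
      IStore (ISub (IConst 0) (IReg 1)) (ISub (ISub (IReg 1) (IConst 1)) (IMem (ISub (IConst 1) (IReg 1)))) ;;
      RStore (ISub (IConst 0) (IReg 1)) (RMem (IReg 1)) ;;
      Cond (RLess (RReg 1) (RMem (IReg 1))) (RSet 1 (RMem (IReg 1))) Skip)"

text \<open>In the integer memory only nonpositive addresses are constrained, whereas the set and
  the permutation are written at positive ones.\<close>

definition common :: "nat \<Rightarrow> (nat \<Rightarrow> real) \<Rightarrow> real \<Rightarrow> store \<Rightarrow> bool" where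
  "common n lam \<epsilon> s \<longleftrightarrow> ireg s 0 = int n \<and> rreg s 0 = \<epsilon> \<and> rreg s 1 = Max (lam ` {1..n}) \<and>
     (\<forall>i\<in>{1..n}. rmem s (int i) = lam i) \<and> (\<forall>i\<le>n. imem s (- int i) = int (i div 2))"

lemma det_tables:
  assumes n: "1 \<le> n" and lam: "\<And>i. i \<in> {1..n} \<Longrightarrow> 0 < lam i"
  shows "det n orc t tables (input n lam \<epsilon>) (10 * real n + 4)
    (\<lambda>s. common n lam \<epsilon> s \<and> (\<forall>a>0. imem s a = 0) \<and> rmem s 0 = 1 \<and>
       (\<forall>i\<in>{1..n}. rmem s (- int i) = lam i))"
proof -
  define I where "I j s \<longleftrightarrow> ireg s 0 = int n \<and> ireg s 1 = int j \<and> rreg s 0 = \<epsilon> \<and> (\<forall>a>0. imem s a = 0) \<and>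
      (\<forall>i\<le>j. imem s (- int i) = int (i div 2)) \<and> rmem s 0 = 1 \<and> (\<forall>i\<in>{1..n}. rmem s (int i) = lam i) \<and>
      (\<forall>i\<in>{1..j}. rmem s (- int i) = lam i \<and> lam i \<le> rreg s 1) \<and>
      (if j = 0 then rreg s 1 = 0 else rreg s 1 \<in> lam ` {1..j})" for j and s :: store
  have fin: "common n lam \<epsilon> s \<and> (\<forall>a>0. imem s a = 0) \<and> rmem s 0 = 1 \<and> (\<forall>i\<in>{1..n}. rmem s (- int i) = lam i)"
    if "I n s" for s :: store
  proof -
    have "rreg s 1 = Max (lam ` {1..n})"
      using that n by (intro Max_eqI[symmetric]) (auto simp: I_def)
    then show ?thesis using that unfolding I_def common_def by auto
  qed
  let ?s = "(input n lam \<epsilon>)\<lparr>rmem := (rmem (input n lam \<epsilon>))(0 := 1)\<rparr>"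
  have "det n orc t tables (input n lam \<epsilon>) (10 * real n + 4) (I n)"
    unfolding tables_def
  proof (rule det_RStore_Seq, rule det_mono[OF det_While_count[where N = n and I = I and B = 8]])
    fix j s assume j: "j < n" and I: "I j s"
    have half: "int j - int (j div 2) = int (Suc j div 2)" by presburger
    have a: "(- int i = - int j - 1) = (i = Suc j)" for i by auto
    have l: "lam (Suc j) > 0" "rmem s (int j + 1) = lam (Suc j)"
      using j I lam[of "Suc j"] unfolding I_def by (auto dest: bspec[of _ _ "Suc j"] simp: add.commute)
    show "bval (ILess (IReg 1) (IReg 0)) s \<and> det n orc t (iinc 1 ;;
      IStore (ISub (IConst 0) (IReg 1)) (ISub (ISub (IReg 1) (IConst 1)) (IMem (ISub (IConst 1) (IReg 1)))) ;;
      RStore (ISub (IConst 0) (IReg 1)) (RMem (IReg 1)) ;;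
      Cond (RLess (RReg 1) (RMem (IReg 1))) (RSet 1 (RMem (IReg 1))) Skip) s 8 (I (Suc j))"
    proof
      show "bval (ILess (IReg 1) (IReg 0)) s" using I j by (simp add: I_def)
    qed (intro det_rules, insert I j l half, simp_all add: I_def a le_Suc_eq image_iff,
        auto simp: a atLeastAtMostSuc_conv split: if_splits)
  qed (auto simp: I_def input_def)
  then show ?thesis by (rule det_mono) (use fin in auto)
qed

text \<open>Draws a uniform integer by halving an interval with left end in register 10 and length
  in register 11. The coin has the bias of the possibly unequal halves, so no rejection occurs and
  the number of rounds is at most logarithmic on every branch.\<close>

definition sampler :: com where
  "sampler = While (ILess (IConst 1) (IReg 11)) (
     ISet 12 (IMem (ISub (IConst 0) (IReg 11))) ;;
     Flip 13 (RDiv (OfInt (IReg 12)) (OfInt (IReg 11))) ;;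
     Cond (ILess (IConst 0) (IReg 13))
       (ISet 11 (IReg 12))
       (ISet 10 (IAdd (IReg 10) (IReg 12)) ;; ISet 11 (ISub (IReg 11) (IReg 12))))"

definition same_main :: "store \<Rightarrow> store \<Rightarrow> bool" where
  "same_main s s' \<longleftrightarrow> rreg s' = rreg s \<and> imem s' = imem s \<and> rmem s' = rmem s \<and> (\<forall>r<10. ireg s' r = ireg s r)"

lemma pmf_of_set_split:
  assumes "0 < h" "h < m"
  shows "pmf_of_set {0..<m} = bind_pmf (bernoulli_pmf (real h / real m))
    (\<lambda>b. if b then pmf_of_set {0..<h} else map_pmf ((+) h) (pmf_of_set {0..<m - h}))"
proof (rule pmf_eqI)
  fix x
  have m: "map_pmf ((+) h) (pmf_of_set {0..<m - h}) = pmf_of_set {h..<m}"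
    using assms by (subst map_pmf_of_set_inj) auto
  show "pmf (pmf_of_set {0..<m}) x = pmf (bind_pmf (bernoulli_pmf (real h / real m))
    (\<lambda>b. if b then pmf_of_set {0..<h} else map_pmf ((+) h) (pmf_of_set {0..<m - h}))) x"
    unfolding m pmf_bind using assms
    by (subst integral_bernoulli_pmf) (auto simp: indicator_def field_simps of_nat_diff)
qed

lemma refines_sampler:
  assumes "1 \<le> m" "m \<le> 2 ^ d" "ireg s 10 = l" "ireg s 11 = int m"
    "\<And>i. i \<le> m \<Longrightarrow> imem s (- int i) = int (i div 2)"
  shows "refines n orc t sampler s (10 * real d + 1)
    (\<lambda>s' x. ireg s' 10 = l + int x \<and> same_main s s') (pmf_of_set {0..<m})"
  using assms
proof (induction d arbitrary: m l s)
  case 0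
  then have m: "m = 1" by simp
  have "pmf_of_set {0..<m} = return_pmf 0" using m by (simp add: pmf_of_set_singleton)
  moreover have "{0..<m} = {0}" using m by auto
  ultimately show ?case
    unfolding sampler_def using 0 m
    by (simp only:) (intro refines_While_False, auto simp: same_main_def)
next
  case (Suc d)
  let ?flip = "ISet 12 (IMem (ISub (IConst 0) (IReg 11))) ;;
      Flip 13 (RDiv (OfInt (IReg 12)) (OfInt (IReg 11))) ;;
      Cond (ILess (IConst 0) (IReg 13))
      (ISet 11 (IReg 12))
      (ISet 10 (IAdd (IReg 10) (IReg 12)) ;; ISet 11 (ISub (IReg 11) (IReg 12)))"
  show ?case
  proof (cases "m = 1")
    case True
    then have "pmf_of_set {0..<m} = return_pmf 0" by (simp add: pmf_of_set_singleton)
    then show ?thesis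
      unfolding sampler_def using Suc.prems True
      by (simp only:) (intro refines_While_False, auto simp: same_main_def)
  next
    case False
    define h where "h = m div 2"
    have h: "0 < h" "h < m" "h \<le> 2 ^ d" "m - h \<le> 2 ^ d"
      using False Suc.prems(1,2) unfolding h_def by auto
    define R where "R s' b \<longleftrightarrow> ireg s' 10 = (if b then l else l + int h) \<and>
        ireg s' 11 = int (if b then h else m - h) \<and> same_main s s'" for s' b
    show ?thesis
      unfolding pmf_of_set_split[OF h(1,2)] sampler_def
    proof (rule refines_While_True[where R = R and ?B1.0 = 8])
      show "bval (ILess (IConst 1) (IReg 11)) s" using Suc.prems False by simp
      have "imem s (- ireg s 11) = int h" using Suc.prems h_def by simp
      have "refines n orc t (?flip) s 8 R
         (bind_pmf (bernoulli_pmf (real h / real m)) return_pmf)"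
      proof (rule refines_ISet_Seq, rule refines_Seq[where ?B1.0 = 1])
        show "refines n orc t (Flip 13 (RDiv (OfInt (IReg 12)) (OfInt (IReg 11))))
          (s\<lparr>ireg := (ireg s)(12 := ival (IMem (ISub (IConst 0) (IReg 11))) s)\<rparr>) 1
          (\<lambda>s' b. s' = s\<lparr>ireg := (ireg s)(12 := int h, 13 := of_bool b)\<rparr>) (bernoulli_pmf (real h / real m))"
          using h Suc.prems(4) \<open>imem s (- ireg s 11) = int h\<close> by (intro refines_Flip) auto
      next
        fix s' b
        assume "s' = s\<lparr>ireg := (ireg s)(12 := int h, 13 := of_bool b)\<rparr>"
        then show "refines n orc t (Cond (ILess (IConst 0) (IReg 13))
         (ISet 11 (IReg 12))
         (ISet 10 (IAdd (IReg 10) (IReg 12)) ;; ISet 11 (ISub (IReg 11) (IReg 12)))) s' (8 - 2 - 1 - 1) R (return_pmf b)"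
          using Suc.prems(3,4) h
          by (intro refines_CondI refines_ISet refines_ISet_Seq) (auto simp: R_def same_main_def of_nat_diff)
      qed
      then show "refines n orc t (?flip) s 8 R
         (bernoulli_pmf (real h / real m))"
        by (simp only: bind_return_pmf')
    next
      fix s' b assume R: "R s' b"
      have half: "imem s' (- int i) = int (i div 2)" if "i \<le> m" for i
        using R Suc.prems(5)[OF that] unfolding R_def same_main_def by simp
      have sm: "same_main s s''" if "same_main s' s''" for s''
        using R that unfolding R_def same_main_def by simp
      show "refines n orc t (While (ILess (IConst 1) (IReg 11)) (?flip)) s'
        (10 * real (Suc d) + 1 - 8 - 2) (\<lambda>s' x. ireg s' 10 = l + int x \<and> same_main s s')
        (if b then pmf_of_set {0..<h} else map_pmf ((+) h) (pmf_of_set {0..<m - h}))"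
      proof (cases b)
        case True
        have "refines n orc t sampler s' (10 * real d + 1)
           (\<lambda>s'' x. ireg s'' 10 = l + int x \<and> same_main s' s'') (pmf_of_set {0..<h})"
          by (rule Suc.IH) (use R True h half in \<open>auto simp: R_def\<close>)
        then show ?thesis unfolding sampler_def using True sm by (auto elim!: refines_mono)
      next
        case False
        have "refines n orc t sampler s' (10 * real d + 1)
           (\<lambda>s'' x. ireg s'' 10 = (l + int h) + int x \<and> same_main s' s'') (pmf_of_set {0..<m - h})"
          by (rule Suc.IH) (use R False h half in \<open>auto simp: R_def\<close>)
        then have "refines n orc t sampler s' (10 * real d + 1)
           (\<lambda>s'' x. ireg s'' 10 = l + int x \<and> same_main s s'') (map_pmf ((+) h) (pmf_of_set {0..<m - h}))"
          by (rule refines_map) (use sm in auto)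
        then show ?thesis unfolding sampler_def using False by (auto elim!: refines_mono)
      qed
    qed
  qed
qed

lemma refines_sampler_image:
  assumes m: "1 \<le> m" "m \<le> 2 ^ d" and l: "ireg s 10 = int l" "ireg s 11 = int m"
    and half: "\<And>i. i \<le> m \<Longrightarrow> imem s (- int i) = int (i div 2)"
    and q: "inj_on q {l..<l + m}"
  shows "refines n orc t sampler s (10 * real d + 1)
    (\<lambda>s' x. \<exists>r\<in>{l..<l + m}. q r = x \<and> ireg s' 10 = int r \<and> same_main s s') (pmf_of_set (q ` {l..<l + m}))"
proof -
  have "q ` {l..<l + m} = (\<lambda>x. q (l + x)) ` {0..<m}"
  proof -
    have "{l..<l + m} = (\<lambda>x. l + x) ` {0..<m}"
      by (auto simp: image_iff intro!: bexI[of _ "_ - l"])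
    then show ?thesis by (simp only: image_image)
  qed
  moreover have "inj_on (\<lambda>x. q (l + x)) {0..<m}"
  proof (rule inj_onI)
    fix x y assume "x \<in> {0..<m}" "y \<in> {0..<m}" "q (l + x) = q (l + y)"
    then show "x = y" using inj_onD[OF q, of "l + x" "l + y"] by simp
  qed
  ultimately have "pmf_of_set (q ` {l..<l + m}) = map_pmf (\<lambda>x. q (l + x)) (pmf_of_set {0..<m})"
    using m by (simp add: map_pmf_of_set_inj)
  moreover have "refines n orc t sampler s (10 * real d + 1)
    (\<lambda>s' x. (x < m \<and> ireg s' 10 = int l + int x) \<and> same_main s s') (pmf_of_set {0..<m})"
  proof -
    obtain \<mu> where \<mu>: "ev n orc t sampler s \<mu>"
      "rel_pmf (\<lambda>(s', \<tau>) x. \<tau> \<le> 10 * real d + 1 \<and> ireg s' 10 = int l + int x \<and> same_main s s') \<mu> (pmf_of_set {0..<m})"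
      using refines_sampler[OF m l half] unfolding refines_def by blast
    have "rel_pmf (\<lambda>(s', \<tau>) x. \<tau> \<le> 10 * real d + 1 \<and> (x < m \<and> ireg s' 10 = int l + int x) \<and> same_main s s') \<mu> (pmf_of_set {0..<m})"
      using \<mu>(2) by (rule pmf.rel_mono_strong) (use m in \<open>auto simp: set_pmf_of_set\<close>)
    then show ?thesis using \<mu>(1) unfolding refines_def by blast
  qed
  ultimately show ?thesis
    by (simp only:) (erule refines_map, auto intro!: bexI[of _ "l + _"])
qed

section \<open>Sets and permutations in memory\<close>

definition holds :: "nat \<Rightarrow> store \<Rightarrow> nat set \<Rightarrow> bool" where
  "holds n s S \<longleftrightarrow> S \<subseteq> {1..n} \<and> (\<forall>i\<in>{1..n}. imem s (int i) = of_bool (i \<in> S))"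

lemma set_at_holds: "holds n s S \<Longrightarrow> set_at n 0 s = S"
  unfolding holds_def set_at_def by auto

text \<open>With the current set as a prefix, a uniform element of the ground set or of the
  complement is a uniform index from an interval, and insertion and deletion take one swap
  each.\<close>

definition permuted :: "nat \<Rightarrow> store \<Rightarrow> (nat \<Rightarrow> nat) \<Rightarrow> nat \<Rightarrow> bool" where
  "permuted n s \<pi> k \<longleftrightarrow> bij_betw \<pi> {1..n} {1..n} \<and> k \<le> n \<and> ireg s 2 = int k \<and>
     (\<forall>i\<in>{1..n}. imem s (int n + int i) = int (\<pi> i))"

definition arrange :: com where
  "arrange = ISet 1 (IConst 0) ;; ISet 2 (IConst 0) ;; ISet 3 (IReg 0) ;;
    While (ILess (IReg 1) (IReg 0)) (
      iinc 1 ;;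
      Cond (ILess (IConst 0) (IMem (IReg 1)))
        (iinc 2 ;; IStore (IAdd (IReg 0) (IReg 2)) (IReg 1))
        (IStore (IAdd (IReg 0) (IReg 3)) (IReg 1) ;; ISet 3 (ISub (IReg 3) (IConst 1))))"

lemma det_arrange:
  assumes s: "common n lam \<epsilon> s" "holds n s S"
  shows "det n orc t arrange s (8 * real n + 7)
    (\<lambda>s'. common n lam \<epsilon> s' \<and> holds n s' S \<and> (\<exists>\<pi> k. permuted n s' \<pi> k \<and> \<pi> ` {1..k} = S))"
proof -
  let ?body = "iinc 1 ;;
      Cond (ILess (IConst 0) (IMem (IReg 1)))
        (iinc 2 ;; IStore (IAdd (IReg 0) (IReg 2)) (IReg 1))
        (IStore (IAdd (IReg 0) (IReg 3)) (IReg 1) ;; ISet 3 (ISub (IReg 3) (IConst 1)))"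
  \<comment> \<open>Members are written from the front and the others from the back;
    \<open>b + j = n + k\<close> makes \<open>b\<close> the last free position, the
    \<open>j - k\<close> nonmembers seen so far lying behind it.\<close>
  define I where "I j s' \<longleftrightarrow> common n lam \<epsilon> s' \<and> holds n s' S \<and> ireg s' 1 = int j \<and>
     (\<exists>k b. ireg s' 2 = int k \<and> ireg s' 3 = int b \<and> b + j = n + k \<and> k \<le> j \<and>
       (\<lambda>i. imem s' (int n + int i)) ` {1..k} = int ` (S \<inter> {1..j}) \<and>
       (\<lambda>i. imem s' (int n + int i)) ` {b<..n} = int ` ({1..j} - S))" for j and s' :: store
  have fin: "\<exists>\<pi> k. permuted n s' \<pi> k \<and> \<pi> ` {1..k} = S" if I: "I n s'" for s'
  proof -
    obtain k where k: "ireg s' 2 = int k" "k \<le> n"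
       "(\<lambda>i. imem s' (int n + int i)) ` {1..k} = int ` (S \<inter> {1..n})"
       "(\<lambda>i. imem s' (int n + int i)) ` {k<..n} = int ` ({1..n} - S)"
      using I unfolding I_def by auto
    define \<pi> where "\<pi> i = nat (imem s' (int n + int i))" for i
    have nat_image: "nat ` int ` A = A" for A by (simp add: image_image)
    have "\<pi> ` {1..k} = nat ` (\<lambda>i. imem s' (int n + int i)) ` {1..k}" unfolding \<pi>_def image_image ..
    then have 1: "\<pi> ` {1..k} = S \<inter> {1..n}" unfolding k(3) nat_image .
    have "\<pi> ` {k<..n} = nat ` (\<lambda>i. imem s' (int n + int i)) ` {k<..n}" unfolding \<pi>_def image_image ..
    then have 2: "\<pi> ` {k<..n} = {1..n} - S" unfolding k(4) nat_image .
    have u: "{1..n} = {1..k} \<union> {k<..n}" using k(2) by auto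
    have "\<pi> ` {1..n} = {1..n}" unfolding u image_Un 1 2 using u by auto
    then have "bij_betw \<pi> {1..n} {1..n}"
      unfolding bij_betw_def by (auto intro: eq_card_imp_inj_on)
    moreover have "imem s' (int n + int i) = int (\<pi> i)" if "i \<in> {1..n}" for i
    proof -
      have "imem s' (int n + int i) \<in> (\<lambda>i. imem s' (int n + int i)) ` {1..k} \<union> (\<lambda>i. imem s' (int n + int i)) ` {k<..n}"
        using that u by (metis image_Un imageI)
      then have "0 \<le> imem s' (int n + int i)" unfolding k by auto
      then show ?thesis unfolding \<pi>_def by simp
    qed
    moreover have "S \<inter> {1..n} = S" using s(2) unfolding holds_def by auto
    ultimately show ?thesis using 1 k unfolding permuted_def by blast
  qed
  have "det n orc t arrange s (8 * real n + 7) (I n)"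
    unfolding arrange_def
  proof (rule det_ISet_Seq, rule det_ISet_Seq, rule det_ISet_Seq, rule det_mono[OF det_While_count[where N = n and I = I and B = 6]])
    fix j s' assume j: "j < n" and I: "I j s'"
    obtain k b where kb: "ireg s' 2 = int k" "ireg s' 3 = int b" "b + j = n + k" "k \<le> j"
       "(\<lambda>i. imem s' (int n + int i)) ` {1..k} = int ` (S \<inter> {1..j})"
       "(\<lambda>i. imem s' (int n + int i)) ` {b<..n} = int ` ({1..j} - S)"
      using I unfolding I_def by blast
    have c: "common n lam \<epsilon> s'" "holds n s' S" "ireg s' 0 = int n" "ireg s' 1 = int j"
      using I unfolding I_def common_def by auto
    have e: "imem s' (int j + 1) = of_bool (Suc j \<in> S)"
      using c(2) j unfolding holds_def by (auto dest: bspec[of _ _ "Suc j"] simp: add.commute)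
    have "det n orc t ?body s' 6 (I (Suc j))"
    proof (cases "Suc j \<in> S")
      case S: True
      define s'' where "s'' = s'\<lparr>ireg := (ireg s')(1 := int j + 1, 2 := int k + 1),
          imem := (imem s')(int n + (int k + 1) := int j + 1)\<rparr>"
      have "common n lam \<epsilon> s''" "holds n s'' S"
        using c unfolding s''_def common_def holds_def by auto
      moreover have "(\<lambda>i. imem s'' (int n + int i)) ` {1..Suc k} = int ` (S \<inter> {1..Suc j})"
      proof -
        have "(\<lambda>i. imem s'' (int n + int i)) ` {1..k} = (\<lambda>i. imem s' (int n + int i)) ` {1..k}"
          unfolding s''_def by (intro image_cong) auto
        moreover have "S \<inter> {1..Suc j} = insert (Suc j) (S \<inter> {1..j})" using S by auto
        moreover have "imem s'' (int n + int (Suc k)) = int (Suc j)" unfolding s''_def by simp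
        moreover have "{1..Suc k} = insert (Suc k) {1..k}" by auto
        ultimately show ?thesis using kb(5) by (simp only: image_insert)
      qed
      moreover have "(\<lambda>i. imem s'' (int n + int i)) ` {b<..n} = int ` ({1..Suc j} - S)"
      proof -
        have "(\<lambda>i. imem s'' (int n + int i)) ` {b<..n} = (\<lambda>i. imem s' (int n + int i)) ` {b<..n}"
          unfolding s''_def using kb(3) j by (intro image_cong) auto
        moreover have "{1..Suc j} - S = {1..j} - S" using S by (auto simp: le_Suc_eq)
        ultimately show ?thesis using kb(6) by simp
      qed
      moreover have "ireg s'' 1 = int (Suc j)" "ireg s'' 2 = int (Suc k)" "ireg s'' 3 = int b"
        using kb unfolding s''_def by auto
      ultimately have inv: "I (Suc j) s''"
        unfolding I_def using kb(3,4) by (intro conjI exI[of _ "Suc k"] exI[of _ b]) simp_all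
      show ?thesis
        by (intro det_rules) (use inv c(3,4) kb(1,2) e S in \<open>simp_all add: s''_def\<close>)
    next
      case S: False
      define s'' where "s'' = s'\<lparr>imem := (imem s')(int n + int b := int j + 1),
          ireg := (ireg s')(1 := int j + 1, 3 := int b - 1)\<rparr>"
      have b0: "b > k" using kb(3) j by simp
      have "common n lam \<epsilon> s''" "holds n s'' S"
        using c b0 unfolding s''_def common_def holds_def by auto
      moreover have "(\<lambda>i. imem s'' (int n + int i)) ` {1..k} = int ` (S \<inter> {1..Suc j})"
      proof -
        have "(\<lambda>i. imem s'' (int n + int i)) ` {1..k} = (\<lambda>i. imem s' (int n + int i)) ` {1..k}"
          unfolding s''_def using b0 by (intro image_cong) auto
        moreover have "S \<inter> {1..Suc j} = S \<inter> {1..j}" using S by (auto simp: le_Suc_eq)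
        ultimately show ?thesis using kb(5) by simp
      qed
      moreover have "(\<lambda>i. imem s'' (int n + int i)) ` {b - 1<..n} = int ` ({1..Suc j} - S)"
      proof -
        have "(\<lambda>i. imem s'' (int n + int i)) ` {b<..n} = (\<lambda>i. imem s' (int n + int i)) ` {b<..n}"
          unfolding s''_def by (intro image_cong) auto
        moreover have "{1..Suc j} - S = insert (Suc j) ({1..j} - S)" using S by (auto simp: le_Suc_eq)
        moreover have "imem s'' (int n + int b) = int (Suc j)" unfolding s''_def by simp
        moreover have "{b - 1<..n} = insert b {b<..n}" using b0 kb(3,4) by auto
        ultimately show ?thesis using kb(6) by (simp only: image_insert)
      qed
      moreover have "ireg s'' 1 = int (Suc j)" "ireg s'' 2 = int k" "ireg s'' 3 = int (b - 1)"
        using kb b0 unfolding s''_def by auto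
      ultimately have inv: "I (Suc j) s''"
        unfolding I_def using kb(3,4) b0 by (intro conjI exI[of _ k] exI[of _ "b - 1"]) simp_all
      show ?thesis
        by (intro det_rules) (use inv c(3,4) kb(1,2) e S in \<open>simp_all add: s''_def\<close>)
    qed
    then show "bval (ILess (IReg 1) (IReg 0)) s' \<and> det n orc t ?body s' 6 (I (Suc j))"
      using c j by simp
  qed (use s in \<open>auto simp: I_def common_def holds_def\<close>)
  then show ?thesis by (rule det_mono) (use fin in \<open>auto simp: I_def\<close>)
qed

section \<open>A set of maximal weight by the greedy algorithm\<close>

definition argmax :: com where
  "argmax = While (ILess (IReg 1) (IReg 0)) (
     iinc 1 ;;
     Cond (RLess (RMem (ISub (IConst 0) (IReg 3))) (RMem (ISub (IConst 0) (IReg 1)))) (ISet 3 (IReg 1)) Skip)"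

lemma det_argmax:
  assumes "ireg s 0 = int m" "ireg s 1 = 0" "ireg s 3 = 0" "rmem s 0 = 1"
  shows "det n orc t argmax s (6 * real m + 1)
    (\<lambda>s'. rreg s' = rreg s \<and> imem s' = imem s \<and> rmem s' = rmem s \<and>
       (\<forall>r. r \<noteq> 1 \<and> r \<noteq> 3 \<longrightarrow> ireg s' r = ireg s r) \<and>
       (\<exists>b\<le>m. ireg s' 3 = int b \<and> (\<forall>i\<le>m. rmem s (- int i) \<le> rmem s (- int b)) \<and> (b = 0 \<or> 1 < rmem s (- int b))))"
proof -
  let ?body = "iinc 1 ;;
     Cond (RLess (RMem (ISub (IConst 0) (IReg 3))) (RMem (ISub (IConst 0) (IReg 1)))) (ISet 3 (IReg 1)) Skip"
  define I where "I j s' \<longleftrightarrow> rreg s' = rreg s \<and> imem s' = imem s \<and> rmem s' = rmem s \<and>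
       (\<forall>r. r \<noteq> 1 \<and> r \<noteq> 3 \<longrightarrow> ireg s' r = ireg s r) \<and> ireg s' 1 = int j \<and>
       (\<exists>b\<le>j. ireg s' 3 = int b \<and> (\<forall>i\<le>j. rmem s (- int i) \<le> rmem s (- int b)) \<and> (b = 0 \<or> 1 < rmem s (- int b)))"
    for j and s' :: store
  have "det n orc t argmax s (6 * real m + 1) (I m)"
    unfolding argmax_def
  proof (rule det_mono[OF det_While_count[where N = m and I = I and B = 4]])
    fix j s' assume j: "j < m" and I: "I j s'"
    obtain b where b: "b \<le> j" "ireg s' 3 = int b" "\<And>i. i \<le> j \<Longrightarrow> rmem s (- int i) \<le> rmem s (- int b)"
        "b = 0 \<or> 1 < rmem s (- int b)"
      using I unfolding I_def by blast
    have s': "rreg s' = rreg s" "imem s' = imem s" "rmem s' = rmem s" "ireg s' 0 = int m" "ireg s' 1 = int j"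
        "\<And>r. r \<noteq> 1 \<Longrightarrow> r \<noteq> 3 \<Longrightarrow> ireg s' r = ireg s r"
      using I assms unfolding I_def by auto
    have b1: "1 \<le> rmem s (- int b)" using b(3)[of 0] assms by simp
    have "det n orc t ?body s' 4 (I (Suc j))"
    proof (cases "rmem s (- int b) < rmem s (- int j - 1)")
      case True
      define s'' where "s'' = s'\<lparr>ireg := (ireg s')(1 := int j + 1, 3 := int j + 1)\<rparr>"
      have eq: "- int (Suc j) = - int j - 1" by simp
      have gt: "1 < rmem s (- int (Suc j))" unfolding eq using True b1 by linarith
      have "\<forall>i\<le>Suc j. rmem s (- int i) \<le> rmem s (- int (Suc j))"
      proof (intro allI impI)
        fix i assume "i \<le> Suc j"
        show "rmem s (- int i) \<le> rmem s (- int (Suc j))"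
          using \<open>i \<le> Suc j\<close> b(3)[of i] True unfolding eq by (cases "i = Suc j") (auto simp: eq simp del: of_nat_Suc)
      qed
      then have "I (Suc j) s''"
        unfolding I_def using s' gt by (intro conjI exI[of _ "Suc j"]) (auto simp: s''_def)
      then show ?thesis using True s' b(2)
        by (intro det_rules) (simp_all add: s''_def)
    next
      case False
      define s'' where "s'' = s'\<lparr>ireg := (ireg s')(1 := int j + 1)\<rparr>"
      have "\<forall>i\<le>Suc j. rmem s (- int i) \<le> rmem s (- int b)"
      proof (intro allI impI)
        fix i assume "i \<le> Suc j"
        have eq: "- int (Suc j) = - int j - 1" by simp
        show "rmem s (- int i) \<le> rmem s (- int b)"
          using \<open>i \<le> Suc j\<close> b(3)[of i] False by (cases "i = Suc j") (auto simp: eq simp del: of_nat_Suc)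
      qed
      then have "I (Suc j) s''"
        unfolding I_def using s' b by (intro conjI exI[of _ b]) (auto simp: s''_def)
      then show ?thesis using False s' b(2)
        by (intro det_rules) (simp_all add: s''_def)
    qed
    then show "bval (ILess (IReg 1) (IReg 0)) s' \<and> det n orc t ?body s' 4 (I (Suc j))"
      using s' j by simp
  qed (use assms in \<open>auto simp: I_def\<close>)
  then show ?thesis by (rule det_mono) (auto simp: I_def)
qed

definition greedy :: com where
  "greedy = ISet 2 (IConst 0) ;; While (ILess (IReg 2) (IReg 0)) (
     iinc 2 ;; ISet 3 (IConst 0) ;; ISet 1 (IConst 0) ;; argmax ;;
     Cond (ILess (IConst 0) (IReg 3))
       (RStore (ISub (IConst 0) (IReg 3)) (OfInt (IConst 0)) ;;
        IStore (IReg 3) (IConst 1) ;; Query 4 (IConst 0) ;;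
        Cond (ILess (IConst 0) (IReg 4)) Skip (IStore (IReg 3) (IConst 0)))
       Skip)"

lemma holds_cong: "holds n s S \<Longrightarrow> imem s' = imem s \<Longrightarrow> holds n s' S"
  unfolding holds_def by simp

lemma set_at_insert:
  assumes "holds n s S" "b \<in> {1..n}" "imem s' = (imem s)(int b := 1)"
  shows "set_at n 0 s' = insert b S"
  using assms unfolding holds_def set_at_def by auto

locale matroid_instance = weighted_matroid "{1..m}" \<I> lam for m :: nat and \<I> lam +
  fixes \<epsilon> t :: real
  assumes m_pos: "1 \<le> m" and t_nonneg: "0 \<le> t"
begin

abbreviation "orc \<equiv> (\<lambda>S. S \<in> \<I>)"

lemma det_greedy:
  assumes s: "common m lam \<epsilon> s" "\<forall>a>0. imem s a = 0" "rmem s 0 = 1" "\<forall>i\<in>{1..m}. rmem s (- int i) = lam i"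
  shows "det m orc t greedy s (real m * (6 * real m + 19 + t) + 3)
    (\<lambda>s'. common m lam \<epsilon> s' \<and> (\<exists>S\<in>\<I>. holds m s' S \<and> (\<forall>T\<in>\<I>. wt T \<le> wt S)))"
proof -
  \<comment> \<open>The bound \<open>m - j\<close> on the number of open elements with field above 1
    shows that none is left after \<open>m\<close> rounds. A round that finds none changes neither
    \<open>U\<close> nor \<open>S\<close>.\<close>
  define I where "I j s' \<longleftrightarrow> common m lam \<epsilon> s' \<and> ireg s' 2 = int j \<and> rmem s' 0 = 1 \<and>
    (\<exists>U S. greedy_inv U S \<and> holds m s' S \<and> (\<forall>i\<in>{1..m}. rmem s' (- int i) = (if i \<in> U then lam i else 0)) \<and>
       card {i \<in> U. 1 < lam i} \<le> m - j)" for j and s' :: store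
  have fin: "\<exists>S\<in>\<I>. holds m s' S \<and> (\<forall>T\<in>\<I>. wt T \<le> wt S)" if I: "I m s'" for s'
  proof -
    obtain U S where US: "greedy_inv U S" "holds m s' S" "card {i \<in> U. 1 < lam i} = 0"
      using I unfolding I_def diff_self_eq_0 le_zero_eq by blast
    have "U \<subseteq> {1..m}" "S \<in> \<I>" using US(1) unfolding greedy_inv_def by auto
    then have "finite {i \<in> U. 1 < lam i}" using finite_subset by fastforce
    then have "{i \<in> U. 1 < lam i} = {}" using US(3) by simp
    then have "wt T \<le> wt S" if "T \<in> \<I>" for T
      using greedy_inv_dominant[OF US(1) _ that] by force
    then show ?thesis using US(2) \<open>S \<in> \<I>\<close> by blast
  qed
  let ?upd = "RStore (ISub (IConst 0) (IReg 3)) (OfInt (IConst 0)) ;;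
        IStore (IReg 3) (IConst 1) ;; Query 4 (IConst 0) ;;
        Cond (ILess (IConst 0) (IReg 4)) Skip (IStore (IReg 3) (IConst 0))"
  let ?body = "iinc 2 ;; ISet 3 (IConst 0) ;; ISet 1 (IConst 0) ;; argmax ;;
     Cond (ILess (IConst 0) (IReg 3)) ?upd Skip"
  have "det m orc t greedy s (real m * (6 * real m + 19 + t) + 3) (I m)"
    unfolding greedy_def
  proof (rule det_ISet_Seq, rule det_mono[OF det_While_count[where N = m and I = I and B = "6 * real m + 17 + t"]])
    fix j s' assume j: "j < m" and I: "I j s'"
    obtain U S where US: "greedy_inv U S" "holds m s' S" "card {i \<in> U. 1 < lam i} \<le> m - j"
        "\<And>i. i \<in> {1..m} \<Longrightarrow> rmem s' (- int i) = (if i \<in> U then lam i else 0)"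
      using I unfolding I_def by blast
    have s': "common m lam \<epsilon> s'" "ireg s' 2 = int j" "rmem s' 0 = 1" "ireg s' 0 = int m"
      using I unfolding I_def common_def by auto
    have U: "U \<subseteq> {1..m}" "finite U" using US(1) finite_subset unfolding greedy_inv_def by auto
    have final: "I (Suc j) s3"
      if b: "1 \<le> b" "b \<le> m" "1 < rmem s' (- int b)" "\<And>i. i \<le> m \<Longrightarrow> rmem s' (- int i) \<le> rmem s' (- int b)"
        and s3: "ireg s3 0 = int m" "ireg s3 2 = int j + 1" "rreg s3 = rreg s'" "rmem s3 = (rmem s')(- int b := 0)"
          "imem s3 = (imem s')(int b := of_bool (insert b S \<in> \<I>))" for s3 :: store and b
    proof -
      have bU: "b \<in> U" "rmem s' (- int b) = lam b" using US(4)[of b] b by (auto split: if_splits)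
      have lmax: "lam y \<le> lam b" if "y \<in> U" for y
        using that b(4)[of y] US(4)[of y] U(1) bU(2) by auto
      have bS: "b \<notin> S" using US(1) bU unfolding greedy_inv_def by auto
      let ?S = "if insert b S \<in> \<I> then insert b S else S"
      have "greedy_inv (U - {b}) ?S"
        by (rule greedy_inv_step[OF US(1) bU(1)]) (use lmax b(3) bU(2) in auto)
      moreover have "holds m s3 ?S" using US(2) bS b unfolding holds_def s3(5) by auto
      moreover have "\<forall>i\<in>{1..m}. rmem s3 (- int i) = (if i \<in> U - {b} then lam i else 0)"
        using US(4) unfolding s3(4) by auto
      moreover have "card {i \<in> U - {b}. 1 < lam i} \<le> m - Suc j"
      proof -
        have "{i \<in> U - {b}. 1 < lam i} = {i \<in> U. 1 < lam i} - {b}" by auto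
        then show ?thesis using US(3) U(2) bU b(3) by simp
      qed
      moreover have "common m lam \<epsilon> s3"
        using s'(1) s3 b unfolding common_def by auto
      moreover have "ireg s3 2 = int (Suc j)" "rmem s3 0 = 1" using s3 s'(3) b by auto
      ultimately show ?thesis unfolding I_def by blast
    qed
    have none: "I (Suc j) s3"
      if le1: "\<And>i. i \<le> m \<Longrightarrow> rmem s' (- int i) \<le> 1"
        and s3: "ireg s3 0 = int m" "ireg s3 2 = int j + 1" "rreg s3 = rreg s'" "rmem s3 = rmem s'" "imem s3 = imem s'" for s3 :: store
    proof -
      have "{i \<in> U. 1 < lam i} = {}" using le1 US(4) U(1) by force
      then have "card {i \<in> U. 1 < lam i} \<le> m - Suc j" by (simp only: card.empty)
      moreover have "common m lam \<epsilon> s3" "ireg s3 2 = int (Suc j)" "rmem s3 0 = 1"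
        using s'(1,3) s3 unfolding common_def by auto
      moreover have "holds m s3 S" using US(2) s3(5) by (rule holds_cong)
      moreover have "\<forall>i\<in>{1..m}. rmem s3 (- int i) = (if i \<in> U then lam i else 0)" using US(4) s3(4) by simp
      ultimately show ?thesis unfolding I_def using US(1) by blast
    qed
    let ?s0 = "s'\<lparr>ireg := (ireg s')(2 := int j + 1, 3 := 0, 1 := 0)\<rparr>"
    have am: "det m orc t argmax ?s0 (6 * real m + 1)
      (\<lambda>s2. rreg s2 = rreg s' \<and> imem s2 = imem s' \<and> rmem s2 = rmem s' \<and> ireg s2 0 = int m \<and> ireg s2 2 = int j + 1 \<and>
        (\<exists>b\<le>m. ireg s2 3 = int b \<and> (\<forall>i\<le>m. rmem s' (- int i) \<le> rmem s' (- int b)) \<and> (b = 0 \<or> 1 < rmem s' (- int b))))"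
      by (rule det_mono[OF det_argmax[where m = m]]) (use s' in auto)
    have "det m orc t (argmax ;; Cond (ILess (IConst 0) (IReg 3)) ?upd Skip) ?s0 (6 * real m + 11 + t) (I (Suc j))"
    proof (rule det_Seq[OF am])
      fix s2 :: store assume A: "rreg s2 = rreg s' \<and> imem s2 = imem s' \<and> rmem s2 = rmem s' \<and> ireg s2 0 = int m \<and> ireg s2 2 = int j + 1 \<and>
        (\<exists>b\<le>m. ireg s2 3 = int b \<and> (\<forall>i\<le>m. rmem s' (- int i) \<le> rmem s' (- int b)) \<and> (b = 0 \<or> 1 < rmem s' (- int b)))"
      then obtain b where b: "b \<le> m" "ireg s2 3 = int b" "\<And>i. i \<le> m \<Longrightarrow> rmem s' (- int i) \<le> rmem s' (- int b)"
         "b = 0 \<or> 1 < rmem s' (- int b)" by blast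
      show "det m orc t (Cond (ILess (IConst 0) (IReg 3)) ?upd Skip) s2 (6 * real m + 11 + t - (6 * real m + 1) - 1) (I (Suc j))"
      proof (cases "b = 0")
        case True
        then have "I (Suc j) s2" using A b(3) s'(3) by (intro none) auto
        then show ?thesis using True b(2) t_nonneg by (intro det_rules) auto
      next
        case False
        have sa: "set_at m 0 (s2\<lparr>rmem := (rmem s2)(- int b := 0), imem := (imem s2)(int b := 1)\<rparr>) = insert b S"
          using US(2) A False b(1) by (intro set_at_insert[where s = s']) auto
        have fin: "I (Suc j) s3"
          if "ireg s3 0 = int m" "ireg s3 2 = int j + 1" "rreg s3 = rreg s'" "rmem s3 = (rmem s')(- int b := 0)"
            "imem s3 = (imem s')(int b := of_bool (insert b S \<in> \<I>))" for s3 :: store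
          by (rule final[of b]) (use that b False in auto)
        show ?thesis
          by (rule det_CondI; (intro det_rules)?)
            (use A b(2) False t_nonneg sa in \<open>auto intro!: fin split: if_splits\<close>)
      qed
    qed
    then have "det m orc t ?body s' (6 * real m + 17 + t) (I (Suc j))"
      by (intro det_ISet_Seq) (use s' in \<open>simp add: algebra_simps\<close>)
    then show "bval (ILess (IReg 2) (IReg 0)) s' \<and> det m orc t ?body s' (6 * real m + 17 + t) (I (Suc j))"
      using s' j by simp
  next
    have "card {i \<in> {1..m}. 1 < lam i} \<le> card {1..m}" by (intro card_mono) auto
    then have card: "card {i \<in> {1..m}. 1 < lam i} \<le> m - 0" by simp
    have "common m lam \<epsilon> (s\<lparr>ireg := (ireg s)(2 := ival (IConst 0) s)\<rparr>)" using s(1) unfolding common_def by simp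
    moreover have "holds m (s\<lparr>ireg := (ireg s)(2 := ival (IConst 0) s)\<rparr>) {}" using s(2) unfolding holds_def by simp
    moreover note greedy_inv_init card
    ultimately show "I 0 (s\<lparr>ireg := (ireg s)(2 := ival (IConst 0) s)\<rparr>)"
      unfolding I_def using s(3,4)
      by (intro conjI exI[of _ "{1..m}"] exI[of _ "{}"]; (assumption | simp))
  next
    show "real m * (6 * real m + 17 + t + 2) + 1 \<le> real m * (6 * real m + 19 + t) + 3 - 2"
      by (simp add: algebra_simps)
  qed (auto simp: I_def common_def)
  then show ?thesis
  proof (rule det_mono)
    fix s' assume "I m s'"
    then show "common m lam \<epsilon> s' \<and> (\<exists>S\<in>\<I>. holds m s' S \<and> (\<forall>T\<in>\<I>. wt T \<le> wt S))"
      using fin unfolding I_def by blast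
  qed simp
qed

section \<open>One step of the chain in memory\<close>

lemma permuted_swap:
  assumes p: "permuted m s \<pi> k" and ab: "a \<in> {1..m}" "b \<in> {1..m}"
  shows "bij_betw (\<pi>(a := \<pi> b, b := \<pi> a)) {1..m} {1..m}"
proof -
  have bij: "bij_betw \<pi> {1..m} {1..m}" using p unfolding permuted_def by blast
  have "bij_betw (\<lambda>i. if i = a then b else if i = b then a else i) {1..m} {1..m}"
    using ab by (intro bij_betw_byWitness[where f' = "\<lambda>i. if i = a then b else if i = b then a else i"]) auto
  from bij_betw_trans[OF this bij]
  show ?thesis by (rule bij_betw_cong[THEN iffD1, rotated]) (auto simp: o_def)
qed

definition state_inv :: "(nat \<Rightarrow> real) \<Rightarrow> store \<Rightarrow> nat set \<Rightarrow> bool" where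
  "state_inv \<rho> s S \<longleftrightarrow> common m lam \<epsilon> s \<and> rreg s = \<rho> \<and> S \<in> \<I> \<and> holds m s S \<and>
     (\<exists>\<pi> k. permuted m s \<pi> k \<and> \<pi> ` {1..k} = S)"

text \<open>The state between removal and proposal. A removed element stands right behind the
  prefix, so that restoring it only lengthens the prefix by one.\<close>

definition removed :: "(nat \<Rightarrow> real) \<Rightarrow> store \<Rightarrow> nat set \<Rightarrow> nat \<Rightarrow> (nat \<Rightarrow> nat) \<Rightarrow> nat \<Rightarrow> bool" where
  "removed \<rho> s S e \<pi> k \<longleftrightarrow> common m lam \<epsilon> s \<and> rreg s = \<rho> \<and> S \<in> \<I> \<and> e \<in> {1..m} \<and> holds m s (S - {e}) \<and>
     permuted m s \<pi> k \<and> \<pi> ` {1..k} = S - {e} \<and> ireg s 4 = of_bool (e \<in> S) \<and> (e \<in> S \<longrightarrow> k < m \<and> \<pi> (Suc k) = e)"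

lemma lmax_Max: "lmax = Max (lam ` {1..m})" by (rule lmax_def)

end

text \<open>The set occupies the first positions, so the guard asks whether the drawn position
  belongs to it; otherwise the removed letter is a star and the set stays unchanged.\<close>

definition remove :: com where
  "remove = Cond (BNot (ILess (IReg 2) (IReg 10)))
     (ISet 4 (IConst 1) ;; ISet 5 (IMem (IAdd (IReg 0) (IReg 10))) ;;
      IStore (IAdd (IReg 0) (IReg 10)) (IMem (IAdd (IReg 0) (IReg 2))) ;;
      IStore (IAdd (IReg 0) (IReg 2)) (IReg 5) ;; IStore (IReg 5) (IConst 0) ;;
      ISet 2 (ISub (IReg 2) (IConst 1)))
     (ISet 4 (IConst 0))"

text \<open>On refusal the proposed element is cleared before the removed one is restored; the order
  matters, since both may be the same element.\<close>

definition decide :: com where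
  "decide = Cond (BAnd (ILess (IConst 0) (IReg 6)) (ILess (IConst 0) (IReg 13)))
     (iinc 2 ;; IStore (IAdd (IReg 0) (IReg 10)) (IMem (IAdd (IReg 0) (IReg 2))) ;;
      IStore (IAdd (IReg 0) (IReg 2)) (IReg 5))
     (IStore (IReg 5) (IConst 0) ;;
      Cond (ILess (IConst 0) (IReg 4)) (iinc 2 ;; IStore (IMem (IAdd (IReg 0) (IReg 2))) (IConst 1)) Skip)"

text \<open>The element is entered tentatively because the oracle reads the set from memory. As in
  \<open>kernel\<close>, the coin is tossed whatever the answer.\<close>

definition propose :: com where
  "propose = ISet 5 (IMem (IAdd (IReg 0) (IReg 10))) ;; IStore (IReg 5) (IConst 1) ;;
     Query 6 (IConst 0) ;; Flip 13 (RDiv (RMem (IReg 5)) (RReg 1)) ;; decide"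

definition chain_step :: com where
  "chain_step = ISet 10 (IConst 1) ;; ISet 11 (IReg 0) ;; sampler ;; remove ;;
     Flip 13 (RReg 6) ;;
     Cond (ILess (IConst 0) (IReg 13)) Skip
       (ISet 10 (IAdd (IReg 2) (IConst 1)) ;; ISet 11 (ISub (IReg 0) (IReg 2)) ;; sampler ;; propose)"

context matroid_instance
begin

lemma det_remove:
  assumes s: "common m lam \<epsilon> s" "rreg s = \<rho>" "S \<in> \<I>" "holds m s S"
    and p: "permuted m s \<pi> k" "\<pi> ` {1..k} = S" and r: "r \<in> {1..m}" "ireg s 10 = int r"
  shows "det m orc t remove s 12 (\<lambda>s'. \<exists>\<pi>' k'. removed \<rho> s' S (\<pi> r) \<pi>' k')"
proof -
  have bij: "bij_betw \<pi> {1..m} {1..m}" and k: "k \<le> m" "ireg s 2 = int k"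
    and mem: "\<And>i. i \<in> {1..m} \<Longrightarrow> imem s (int m + int i) = int (\<pi> i)"
    using p(1) unfolding permuted_def by auto
  have inj: "inj_on \<pi> {1..m}" and img: "\<And>i. i \<in> {1..m} \<Longrightarrow> \<pi> i \<in> {1..m}"
    using bij unfolding bij_betw_def by auto
  have m0: "ireg s 0 = int m" using s(1) unfolding common_def by auto
  have inS: "\<pi> r \<in> S \<longleftrightarrow> r \<le> k"
  proof -
    have "{1..k} \<subseteq> {1..m}" using k by auto
    from inj_on_image_mem_iff[OF inj r(1) this] show ?thesis using p(2) r(1) by auto
  qed
  show ?thesis
  proof (cases "r \<le> k")
    case False
    have "removed \<rho> s3 S (\<pi> r) \<pi> k"
      if "ireg s3 = (ireg s)(4 := 0)" "rreg s3 = rreg s" "imem s3 = imem s" "rmem s3 = rmem s" for s3 :: store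
      using s p inS False img[OF r(1)] that unfolding removed_def common_def permuted_def holds_def by simp
    then have "\<exists>\<pi>' k'. removed \<rho> s3 S (\<pi> r) \<pi>' k'"
      if "ireg s3 = (ireg s)(4 := 0)" "rreg s3 = rreg s" "imem s3 = imem s" "rmem s3 = rmem s" for s3 :: store
      using that by blast
    then show ?thesis
      unfolding remove_def using r k False by (intro det_rules) auto
  next
    case True
    then have kin: "k \<in> {1..m}" and k1: "1 \<le> k" using r k by auto
    define \<pi>' where "\<pi>' = \<pi>(r := \<pi> k, k := \<pi> r)"
    have "\<pi>' ` {1..k - 1} = S - {\<pi> r}"
    proof -
      have "\<pi>' ` {1..k - 1} = \<pi> ` ({1..k} - {r})"
      proof (cases "r = k")
        case True
        have "{1..k - 1} = {1..k} - {r}" using True k1 by auto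
        moreover have "\<pi>' i = \<pi> i" if "i \<in> {1..k - 1}" for i using that k1 True unfolding \<pi>'_def by auto
        ultimately show ?thesis by (intro image_cong) auto
      next
        case rk: False
        have "\<pi>' ` {1..k - 1} = insert (\<pi>' r) (\<pi>' ` ({1..k - 1} - {r}))"
          using True rk r by (subst image_insert[symmetric]) (auto intro!: arg_cong[of _ _ "image \<pi>'"])
        also have "\<pi>' ` ({1..k - 1} - {r}) = \<pi> ` ({1..k - 1} - {r})"
          using k1 unfolding \<pi>'_def by (intro image_cong) auto
        also have "insert (\<pi>' r) (\<pi> ` ({1..k - 1} - {r})) = \<pi> ` insert k ({1..k - 1} - {r})"
          using rk unfolding \<pi>'_def by simp
        also have "insert k ({1..k - 1} - {r}) = {1..k} - {r}" using k1 rk by auto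
        finally show ?thesis .
      qed
      also have "\<dots> = \<pi> ` {1..k} - \<pi> ` {r}"
        using inj r(1) k by (intro inj_on_image_set_diff[of \<pi> "{1..m}"]) auto
      finally show ?thesis using p(2) by simp
    qed
    then have rem: "removed \<rho> s3 S (\<pi> r) \<pi>' (k - 1)"
      if s3: "ireg s3 0 = int m" "ireg s3 2 = int k - 1" "ireg s3 4 = 1" "rreg s3 = rreg s" "rmem s3 = rmem s"
        "imem s3 = (imem s)(int m + int r := int (\<pi> k), int m + int k := int (\<pi> r), int (\<pi> r) := 0)" for s3 :: store
    proof -
      have "common m lam \<epsilon> s3" using s(1) s3 img[OF r(1)] r(1) k1 unfolding common_def by auto
      moreover have "permuted m s3 \<pi>' (k - 1)"
        unfolding permuted_def \<pi>'_def
        using permuted_swap[OF p(1) r(1) kin] k k1 s3(2) mem img[OF r(1)] by (auto simp: s3(6) of_nat_diff)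
      moreover have "holds m s3 (S - {\<pi> r})"
        using s(4) img[OF r(1)] r(1) k1 unfolding holds_def s3(6) by auto
      ultimately show ?thesis
        unfolding removed_def using s(2,3) s3 \<open>\<pi>' ` {1..k - 1} = S - {\<pi> r}\<close> img[OF r(1)] inS True k k1
        by (auto simp: \<pi>'_def)
    qed
    have rem': "\<exists>\<pi>' k'. removed \<rho> s3 S (\<pi> r) \<pi>' k'"
      if "ireg s3 0 = int m" "ireg s3 2 = int k - 1" "ireg s3 4 = 1" "rreg s3 = rreg s" "rmem s3 = rmem s"
        "imem s3 = (imem s)(int m + int r := int (\<pi> k), int m + int k := int (\<pi> r), int (\<pi> r) := 0)" for s3 :: store
      using rem[OF that] by blast
    show ?thesis
      unfolding remove_def
      by (intro det_rules) (use r k True m0 mem[OF r(1)] mem[OF kin] in \<open>auto intro!: rem'\<close>)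
  qed
qed

end

context matroid_instance
begin

text \<open>Since \<open>e\<close> is missing from the current set, the complement is never empty:
  this gives \<open>k < m\<close> and a nonempty range for the second draw.\<close>

lemma removed_facts:
  assumes "removed \<rho> s S e \<pi> k"
  shows "bij_betw \<pi> {1..m} {1..m}" "k < m" "ireg s 2 = int k" "ireg s 0 = int m"
    "\<And>i. i \<in> {1..m} \<Longrightarrow> imem s (int m + int i) = int (\<pi> i)"
    "\<And>i. i \<in> {1..m} \<Longrightarrow> \<pi> i \<in> {1..m}"
    "\<pi> ` {Suc k..m} = {1..m} - (S - {e})" "S - {e} \<in> \<I>" "S - {e} \<subseteq> {1..m}"
proof -
  have r: "permuted m s \<pi> k" "\<pi> ` {1..k} = S - {e}" "e \<in> {1..m}" "S \<in> \<I>" "common m lam \<epsilon> s"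
    using assms unfolding removed_def by auto
  show bij: "bij_betw \<pi> {1..m} {1..m}" and k2: "ireg s 2 = int k"
    and "\<And>i. i \<in> {1..m} \<Longrightarrow> imem s (int m + int i) = int (\<pi> i)"
    using r(1) unfolding permuted_def by auto
  have km: "k \<le> m" using r(1) unfolding permuted_def by auto
  show "ireg s 0 = int m" using r(5) unfolding common_def by auto
  have inj: "inj_on \<pi> {1..m}" and img: "\<pi> ` {1..m} = {1..m}" using bij unfolding bij_betw_def by auto
  show "\<And>i. i \<in> {1..m} \<Longrightarrow> \<pi> i \<in> {1..m}" using img by blast
  show "k < m"
  proof (rule ccontr)
    assume "\<not> k < m"
    then have "\<pi> ` {1..k} = {1..m}" using km img by simp
    then show False using r(2,3) by auto
  qed
  have "{Suc k..m} = {1..m} - {1..k}" using km by auto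
  then have "\<pi> ` {Suc k..m} = \<pi> ` {1..m} - \<pi> ` {1..k}"
    using inj_on_image_set_diff[OF inj, of "{1..m}" "{1..k}"] km by auto
  then show "\<pi> ` {Suc k..m} = {1..m} - (S - {e})" using img r(2) by simp
  show "S - {e} \<in> \<I>" using r(4) by (rule indep_mono) auto
  then show "S - {e} \<subseteq> {1..m}" by (rule indep_subset)
qed

lemma det_decide:
  assumes s0: "removed \<rho> s0 S e \<pi> k" and r: "r \<in> {Suc k..m}"
    and s: "imem s = (imem s0)(int (\<pi> r) := 1)" "rmem s = rmem s0" "rreg s = \<rho>"
      "ireg s 0 = int m" "ireg s 2 = int k" "ireg s 4 = ireg s0 4" "ireg s 5 = int (\<pi> r)"
      "ireg s 6 = of_bool (insert (\<pi> r) (S - {e}) \<in> \<I>)" "ireg s 10 = int r" "ireg s 13 = of_bool a"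
  shows "det m orc t decide s 8
    (\<lambda>s'. state_inv \<rho> s' (if insert (\<pi> r) (S - {e}) \<in> \<I> \<and> a then insert (\<pi> r) (S - {e}) else S))"
proof -
  note f = removed_facts[OF s0]
  have c: "common m lam \<epsilon> s0" "S \<in> \<I>" "e \<in> {1..m}" "holds m s0 (S - {e})" "permuted m s0 \<pi> k"
    "\<pi> ` {1..k} = S - {e}" "ireg s0 4 = of_bool (e \<in> S)" "e \<in> S \<Longrightarrow> \<pi> (Suc k) = e" "rreg s0 = \<rho>"
    using s0 unfolding removed_def by auto
  have rm: "r \<in> {1..m}" and k1: "Suc k \<in> {1..m}" using r f(2) by auto
  have e': "\<pi> r \<in> {1..m}" using f(6)[OF rm] .
  have e'T: "\<pi> r \<notin> S - {e}" using f(7) r by blast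
  have common: "common m lam \<epsilon> s3"
    if "ireg s3 0 = int m" "rreg s3 = \<rho>" "rmem s3 = rmem s0" "\<And>a. a \<le> 0 \<Longrightarrow> imem s3 a = imem s0 a" for s3 :: store
    using c(1,9) that unfolding common_def by auto
  have memk: "imem s (int m + (int k + 1)) = int (\<pi> (Suc k))"
    using f(5)[OF k1] e' unfolding s(1) by (auto simp: add_ac)
  show ?thesis
  proof (cases "insert (\<pi> r) (S - {e}) \<in> \<I> \<and> a")
    case True
    have fin: "state_inv \<rho> s3 (insert (\<pi> r) (S - {e}))"
      if s3: "ireg s3 0 = int m" "ireg s3 2 = int k + 1" "rreg s3 = rreg s" "rmem s3 = rmem s0"
        "imem s3 = (imem s0)(int (\<pi> r) := 1, int m + int r := int (\<pi> (Suc k)), int m + (int k + 1) := int (\<pi> r))" for s3 :: store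
    proof -
      define \<pi>' where "\<pi>' = \<pi>(r := \<pi> (Suc k), Suc k := \<pi> r)"
      have "common m lam \<epsilon> s3" by (rule common) (use s3 s(3) e' in auto)
      moreover have "holds m s3 (insert (\<pi> r) (S - {e}))"
        using c(4) e' r unfolding holds_def s3(5) by auto
      moreover have "permuted m s3 \<pi>' (Suc k)"
        unfolding permuted_def \<pi>'_def
        using permuted_swap[OF c(5) rm k1] k1 s3(2) f(5) e' r by (auto simp: s3(5))
      moreover have "\<pi>' ` {1..Suc k} = insert (\<pi> r) (S - {e})"
      proof -
        have "\<pi>' ` {1..k} = \<pi> ` {1..k}" using r unfolding \<pi>'_def by (intro image_cong) auto
        moreover have "{1..Suc k} = insert (Suc k) {1..k}" by auto
        moreover have "\<pi>' (Suc k) = \<pi> r" unfolding \<pi>'_def by simp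
        ultimately show ?thesis using c(6) by (simp only: image_insert)
      qed
      ultimately show ?thesis unfolding state_inv_def using True s3(3) s(3) by metis
    qed
    show ?thesis
      unfolding decide_def using True
      by (intro det_rules) (use s(1,2,4-10) memk in \<open>auto intro!: fin\<close>)
  next
    case False
    then have out: "(if insert (\<pi> r) (S - {e}) \<in> \<I> \<and> a then insert (\<pi> r) (S - {e}) else S) = S" by auto
    have guard: "\<not> bval (BAnd (ILess (IConst 0) (IReg 6)) (ILess (IConst 0) (IReg 13))) s"
      using False s by (auto split: if_splits)
    show ?thesis
    proof (cases "e \<in> S")
      case True
      have fin: "state_inv \<rho> s3 S"
        if s3: "ireg s3 0 = int m" "ireg s3 2 = int k + 1" "rreg s3 = rreg s" "rmem s3 = rmem s0"
          "imem s3 = (imem s0)(int (\<pi> r) := 0, int e := 1)" for s3 :: store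
      proof -
        have "common m lam \<epsilon> s3" by (rule common) (use s3 s(3) e' c(3) in auto)
        moreover have "holds m s3 S"
          using c(2-4) e' e'T True indep_subset[OF c(2)] unfolding holds_def s3(5) by auto
        moreover have "permuted m s3 \<pi> (Suc k)"
          unfolding permuted_def using f(1,2) s3(2) f(5) e' c(3) by (auto simp: s3(5))
        moreover have "\<pi> ` {1..Suc k} = S"
        proof -
          have "{1..Suc k} = insert (Suc k) {1..k}" by auto
          then have "\<pi> ` {1..Suc k} = insert e (S - {e})" using c(6,8) True by (simp only: image_insert)
          then show ?thesis using True by auto
        qed
        ultimately show ?thesis unfolding state_inv_def using c(2) s3(3) s(3) by metis
      qed
      have memk': "((imem s0)(int (\<pi> r) := 0)) (int m + (int k + 1)) = int e"
        using f(5)[OF k1] e' c(8)[OF True] by (auto simp: add_ac)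
      show ?thesis
        unfolding decide_def out
        by (intro det_rules) (use s(1,2,4-10) memk' guard True c(7) in \<open>auto intro!: fin\<close>)
    next
      case eS: False
      have fin: "state_inv \<rho> s3 S"
        if s3: "ireg s3 0 = int m" "ireg s3 2 = int k" "rreg s3 = rreg s" "rmem s3 = rmem s0"
          "imem s3 = (imem s0)(int (\<pi> r) := 0)" for s3 :: store
      proof -
        have "common m lam \<epsilon> s3" by (rule common) (use s3 s(3) e' in auto)
        moreover have "holds m s3 S"
          using c(4) e' e'T eS unfolding holds_def s3(5) by auto
        moreover have "permuted m s3 \<pi> k"
          unfolding permuted_def using f(1,2) s3(2) f(5) e' by (auto simp: s3(5))
        moreover have "\<pi> ` {1..k} = S" using c(6) eS by simp
        ultimately show ?thesis unfolding state_inv_def using c(2) s3(3) s(3) by metis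
      qed
      show ?thesis
        unfolding decide_def out
        by (intro det_rules) (use s(1,2,4-10) guard eS c(7) in \<open>auto intro!: fin\<close>)
    qed
  qed
qed

lemma refines_propose:
  assumes s: "removed \<rho> s S e \<pi> k" and r: "r \<in> {Suc k..m}" "ireg s 10 = int r"
  shows "refines m orc t propose s (16 + t) (state_inv \<rho>)
    (map_pmf (\<lambda>a. if insert (\<pi> r) (S - {e}) \<in> \<I> \<and> a then insert (\<pi> r) (S - {e}) else S)
      (bernoulli_pmf (lam (\<pi> r) / lmax)))"
proof -
  let ?out = "\<lambda>a. if insert (\<pi> r) (S - {e}) \<in> \<I> \<and> a then insert (\<pi> r) (S - {e}) else S"
  note f = removed_facts[OF s]
  have rm: "r \<in> {1..m}" using r by auto
  have e': "\<pi> r \<in> {1..m}" using f(6)[OF rm] .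
  have c: "common m lam \<epsilon> s" "holds m s (S - {e})" "rreg s = \<rho>" using s unfolding removed_def by auto
  have lm: "rreg s 1 = lmax" "rmem s (int (\<pi> r)) = lam (\<pi> r)"
    using c(1) e' unfolding common_def lmax_Max by auto
  define s1 where "s1 = s\<lparr>ireg := (ireg s)(5 := int (\<pi> r)), imem := (imem s)(int (\<pi> r) := 1)\<rparr>"
  have sa: "set_at m 0 s1 = insert (\<pi> r) (S - {e})"
    using c(2) e' by (rule set_at_insert) (simp add: s1_def)
  define s2 where "s2 = s1\<lparr>ireg := (ireg s1)(6 := of_bool (insert (\<pi> r) (S - {e}) \<in> \<I>))\<rparr>"
  have "refines m orc t (Flip 13 (RDiv (RMem (IReg 5)) (RReg 1)) ;; decide) s2 10 (state_inv \<rho>)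
    (bind_pmf (bernoulli_pmf (lam (\<pi> r) / lmax))
      (\<lambda>a. return_pmf (?out a)))"
  proof (rule refines_Seq[where ?B1.0 = 1])
    have lmp: "0 < lmax" "lam (\<pi> r) \<le> lmax" "0 < lam (\<pi> r)"
      using lam_le_lmax[OF e'] lam_pos[OF e'] by linarith+
    show "refines m orc t (Flip 13 (RDiv (RMem (IReg 5)) (RReg 1))) s2 1
      (\<lambda>s' a. s' = s2\<lparr>ireg := (ireg s2)(13 := of_bool a)\<rparr>) (bernoulli_pmf (lam (\<pi> r) / lmax))"
      by (rule refines_Flip) (use lmp lm in \<open>simp_all add: s2_def s1_def divide_le_eq\<close>)
  next
    fix s' a assume s': "s' = s2\<lparr>ireg := (ireg s2)(13 := of_bool a)\<rparr>"
    have "det m orc t decide s' 8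
      (\<lambda>s'. state_inv \<rho> s' (?out a))"
      by (rule det_decide[OF s r(1)]) (use s' f(3,4) r(2) c(3) in \<open>simp_all add: s2_def s1_def\<close>)
    then have "refines m orc t decide s' 8 (state_inv \<rho>)
      (return_pmf (?out a))"
      by (rule det_refines) simp
    then show "refines m orc t decide s' (10 - 1 - 1) (state_inv \<rho>)
      (return_pmf (?out a))"
      by simp
  qed
  then have main: "refines m orc t (Flip 13 (RDiv (RMem (IReg 5)) (RReg 1)) ;; decide) s2 10 (state_inv \<rho>)
    (map_pmf ?out
      (bernoulli_pmf (lam (\<pi> r) / lmax)))"
    unfolding map_pmf_def .
  show ?thesis
    unfolding propose_def
    by (intro refines_ISet_Seq refines_IStore_Seq refines_Query_Seq)
      (use main sa f(4) f(5)[OF rm] r(2) in \<open>simp add: s2_def s1_def\<close>)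
qed

end

section \<open>The number of steps and the main loop\<close>

lemma ex_power_of_two_ge:
  assumes "1 \<le> (x :: real)"
  shows "\<exists>d. x \<le> 2 ^ d \<and> real d \<le> log 2 x + 1"
proof -
  define d where "d = nat \<lceil>log 2 x\<rceil>"
  have "0 \<le> log 2 x" using assms by simp
  then have "log 2 x \<le> real d" "real d \<le> log 2 x + 1" unfolding d_def by linarith+
  moreover from this have "x \<le> 2 ^ d"
    using assms by (simp add: log_le_iff powr_realpow)
  ultimately show ?thesis by blast
qed

text \<open>
  Doubling \<open>\<epsilon>\<close> until it reaches \<open>n\<close> gives an integer \<open>L \<ge> ln (n / \<epsilon>)\<close>.
\<close>

definition schedule :: com where
  "schedule = RSet 2 (RReg 0) ;; RSet 3 (OfInt (IConst 0)) ;;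
     While (RLess (RReg 2) (OfInt (IReg 0)))
       (RSet 2 (RAdd (RReg 2) (RReg 2)) ;; RSet 3 (RAdd (RReg 3) (OfInt (IConst 1)))) ;;
     RSet 6 (RDiv (OfInt (IConst 1)) (RAdd (OfInt (IConst 1)) (RReg 1))) ;;
     RSet 4 (RMul (RMul (RMul (OfInt (IConst 2)) (RAdd (OfInt (IConst 1)) (RReg 1))) (OfInt (IReg 0))) (RReg 3)) ;;
     RSet 5 (OfInt (IConst 0))"

lemma det_schedule:
  assumes s: "rreg s 0 = \<epsilon>" "ireg s 0 = int m" "rreg s 1 = l" and \<epsilon>: "0 < \<epsilon>"
    and L: "real m \<le> \<epsilon> * 2 ^ L" "\<And>j. j < L \<Longrightarrow> \<epsilon> * 2 ^ j < real m"
  shows "det n orc t schedule s (5 * real L + 12)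
    (\<lambda>s'. ireg s' = ireg s \<and> imem s' = imem s \<and> rmem s' = rmem s \<and> rreg s' 0 = \<epsilon> \<and> rreg s' 1 = l \<and>
       rreg s' 6 = 1 / (1 + l) \<and> rreg s' 4 = 2 * (1 + l) * real m * real L \<and> rreg s' 5 = 0)"
proof -
  let ?post = "\<lambda>s'. ireg s' = ireg s \<and> imem s' = imem s \<and> rmem s' = rmem s \<and> rreg s' 0 = \<epsilon> \<and> rreg s' 1 = l \<and>
       rreg s' 6 = 1 / (1 + l) \<and> rreg s' 4 = 2 * (1 + l) * real m * real L \<and> rreg s' 5 = 0"
  let ?loop = "While (RLess (RReg 2) (OfInt (IReg 0)))
       (RSet 2 (RAdd (RReg 2) (RReg 2)) ;; RSet 3 (RAdd (RReg 3) (OfInt (IConst 1)))) ;;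
      RSet 6 (RDiv (OfInt (IConst 1)) (RAdd (OfInt (IConst 1)) (RReg 1))) ;;
      RSet 4 (RMul (RMul (RMul (OfInt (IConst 2)) (RAdd (OfInt (IConst 1)) (RReg 1))) (OfInt (IReg 0))) (RReg 3)) ;;
      RSet 5 (OfInt (IConst 0))"
  define I where "I j s' \<longleftrightarrow> ireg s' = ireg s \<and> imem s' = imem s \<and> rmem s' = rmem s \<and> rreg s' 0 = \<epsilon> \<and>
    rreg s' 1 = l \<and> rreg s' 2 = \<epsilon> * 2 ^ j \<and> rreg s' 3 = real j" for j and s' :: store
  have loop: "det n orc t (While (RLess (RReg 2) (OfInt (IReg 0)))
       (RSet 2 (RAdd (RReg 2) (RReg 2)) ;; RSet 3 (RAdd (RReg 3) (OfInt (IConst 1)))))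
     (s\<lparr>rreg := (rreg s)(2 := \<epsilon>, 3 := 0)\<rparr>) (real L * (3 + 2) + 1) (I L)"
  proof (rule det_While_count)
    fix j s' assume "j < L" "I j s'"
    moreover have "det n orc t (RSet 2 (RAdd (RReg 2) (RReg 2)) ;; RSet 3 (RAdd (RReg 3) (OfInt (IConst 1)))) s' 3 (I (Suc j))"
      using \<open>I j s'\<close> by (intro det_rules) (auto simp: I_def)
    ultimately show "bval (RLess (RReg 2) (OfInt (IReg 0))) s' \<and>
      det n orc t (RSet 2 (RAdd (RReg 2) (RReg 2)) ;; RSet 3 (RAdd (RReg 3) (OfInt (IConst 1)))) s' 3 (I (Suc j))"
      using L(2) s by (auto simp: I_def)
  qed (use L(1) s in \<open>auto simp: I_def\<close>)
  show ?thesis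
    unfolding schedule_def
  proof (rule det_RSet_Seq, rule det_RSet_Seq)
    have "det n orc t ?loop (s\<lparr>rreg := (rreg s)(2 := \<epsilon>, 3 := 0)\<rparr>) (5 * real L + 8)
      ?post"
      by (rule det_Seq[OF loop], intro det_rules) (use s in \<open>auto simp: I_def\<close>)
    then show "det n orc t ?loop
      (s\<lparr>rreg := (rreg s)(2 := rval (RReg 0) s),
         rreg := (rreg (s\<lparr>rreg := (rreg s)(2 := rval (RReg 0) s)\<rparr>))
          (3 := rval (OfInt (IConst 0)) (s\<lparr>rreg := (rreg s)(2 := rval (RReg 0) s)\<rparr>))\<rparr>) (5 * real L + 12 - 2 - 2)
      ?post"
      using s by (simp add: algebra_simps)
  qed
qed

text \<open>
  The initial entropy of the empty set, about \<open>n ln (1 + lmax)\<close>, may be too large for huge fields; but then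
  the quadratic time of a greedy search for a set of maximal weight is affordable.
\<close>

definition start :: com where
  "start = Cond (BNot (RLess (RReg 1) (OfInt (IReg 0)))) greedy Skip"

definition sweep :: com where
  "sweep = While (RLess (RReg 5) (RReg 4)) (RSet 5 (RAdd (RReg 5) (OfInt (IConst 1))) ;; chain_step)"

definition program :: com where
  "program = (tables ;; start ;; arrange ;; schedule) ;; sweep"

context matroid_instance
begin

lemma nonempty: "{1..m} \<noteq> {}" using m_pos by simp

lemmas rate_pos_m = rate_pos[OF nonempty] and rate_le_m = rate_le[OF nonempty]

lemma removed_same:
  assumes "removed \<rho> s S e \<pi> k" "rreg s' = rreg s" "imem s' = imem s" "rmem s' = rmem s"
    "ireg s' 0 = ireg s 0" "ireg s' 2 = ireg s 2" "ireg s' 4 = ireg s 4"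
  shows "removed \<rho> s' S e \<pi> k"
  using assms unfolding removed_def common_def holds_def permuted_def by auto

text \<open>The program makes its random choices in the order of the binds of \<open>kernel\<close>,
  so the coupling proceeds bind by bind. The two draws account for \<open>20 * d\<close>, the single
  query for \<open>t\<close>.\<close>

lemma refines_chain_step:
  assumes s: "state_inv \<rho> s S" and \<rho>: "\<rho> 6 = rate" and d: "m \<le> 2 ^ d"
  shows "refines m orc t chain_step s (20 * real d + 50 + t) (state_inv \<rho>) (kernel S)"
proof -
  obtain \<pi> k where c: "common m lam \<epsilon> s" "rreg s = \<rho>" "S \<in> \<I>" "holds m s S" "permuted m s \<pi> k" "\<pi> ` {1..k} = S"
    using s unfolding state_inv_def by blast
  have m0: "ireg s 0 = int m" and half: "\<And>i. i \<le> m \<Longrightarrow> imem s (- int i) = int (i div 2)"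
    using c(1) unfolding common_def by auto
  have bij: "inj_on \<pi> {1..<1 + m}" "\<pi> ` {1..<1 + m} = {1..m}"
    using c(5) unfolding permuted_def bij_betw_def by (auto simp: atLeastLessThanSuc_atLeastAtMost)
  define s1 where "s1 = s\<lparr>ireg := (ireg s)(10 := 1, 11 := int m)\<rparr>"
  let ?prop = "\<lambda>e. bind_pmf (pmf_of_set ({1..m} - (S - {e}))) (\<lambda>e'.
         map_pmf (\<lambda>a. if insert e' (S - {e}) \<in> \<I> \<and> a then insert e' (S - {e}) else S)
           (bernoulli_pmf (lam e' / lmax)))"
  let ?add = "ISet 10 (IAdd (IReg 2) (IConst 1)) ;; ISet 11 (ISub (IReg 0) (IReg 2)) ;; sampler ;; propose"
  have add: "refines m orc t ?add s3 (10 * real d + 22 + t) (state_inv \<rho>) (?prop e)"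
    if r: "removed \<rho> s3 S e \<pi>' k'" for s3 e \<pi>' k'
  proof -
    note f = removed_facts[OF r]
    have half3: "\<And>i. i \<le> m \<Longrightarrow> imem s3 (- int i) = int (i div 2)"
      using r unfolding removed_def common_def by auto
    define s4 where "s4 = s3\<lparr>ireg := (ireg s3)(10 := int k' + 1, 11 := int m - int k')\<rparr>"
    have range: "{Suc k'..<Suc k' + (m - k')} = {Suc k'..m}" using f(2) by auto
    have inj: "inj_on \<pi>' {Suc k'..<Suc k' + (m - k')}"
      unfolding range using f(1) by (rule inj_on_subset[OF bij_betw_imp_inj_on]) auto
    have "refines m orc t sampler s4 (10 * real d + 1)
      (\<lambda>s' e'. \<exists>r\<in>{Suc k'..<Suc k' + (m - k')}. \<pi>' r = e' \<and> ireg s' 10 = int r \<and> same_main s4 s')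
      (pmf_of_set (\<pi>' ` {Suc k'..<Suc k' + (m - k')}))"
      by (rule refines_sampler_image) (use f(2) d half3 inj in \<open>auto simp: s4_def\<close>)
    then have smp: "refines m orc t sampler s4 (10 * real d + 1)
      (\<lambda>s' e'. \<exists>r\<in>{Suc k'..m}. \<pi>' r = e' \<and> ireg s' 10 = int r \<and> same_main s4 s')
      (pmf_of_set ({1..m} - (S - {e})))"
      unfolding range f(7) .
    have "refines m orc t (sampler ;; propose) s4 (10 * real d + 18 + t) (state_inv \<rho>) (?prop e)"
    proof (rule refines_Seq[OF smp])
      fix s' e' assume "\<exists>r\<in>{Suc k'..m}. \<pi>' r = e' \<and> ireg s' 10 = int r \<and> same_main s4 s'"
      then obtain i where i: "i \<in> {Suc k'..m}" "\<pi>' i = e'" "ireg s' 10 = int i" "same_main s4 s'" by blast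
      have "removed \<rho> s' S e \<pi>' k'"
        using r by (rule removed_same) (use i(4) in \<open>auto simp: same_main_def s4_def\<close>)
      from refines_propose[OF this i(1,3)]
      show "refines m orc t propose s' (10 * real d + 18 + t - (10 * real d + 1) - 1) (state_inv \<rho>)
        (map_pmf (\<lambda>a. if insert e' (S - {e}) \<in> \<I> \<and> a then insert e' (S - {e}) else S)
           (bernoulli_pmf (lam e' / lmax)))"
        unfolding i(2) by simp
    qed
    then show ?thesis
      by (intro refines_ISet_Seq) (use f(3,4) in \<open>simp add: s4_def algebra_simps\<close>)
  qed
  have tail: "refines m orc t (Flip 13 (RReg 6) ;; Cond (ILess (IConst 0) (IReg 13)) Skip ?add) s2
      (10 * real d + 25 + t) (state_inv \<rho>)
      (bind_pmf (bernoulli_pmf rate) (\<lambda>b. if b then return_pmf (S - {e}) else ?prop e))"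
    if r: "removed \<rho> s2 S e \<pi>' k'" for s2 e \<pi>' k'
  proof (rule refines_Seq[where ?B1.0 = 1])
    have "rreg s2 6 = rate" using r \<rho> unfolding removed_def by auto
    then show "refines m orc t (Flip 13 (RReg 6)) s2 1 (\<lambda>s' b. s' = s2\<lparr>ireg := (ireg s2)(13 := of_bool b)\<rparr>) (bernoulli_pmf rate)"
      using rate_pos_m rate_le_m by (intro refines_Flip) auto
  next
    fix s' b assume s': "s' = s2\<lparr>ireg := (ireg s2)(13 := of_bool b)\<rparr>"
    have r': "removed \<rho> s' S e \<pi>' k'" using r by (rule removed_same) (auto simp: s')
    show "refines m orc t (Cond (ILess (IConst 0) (IReg 13)) Skip ?add) s' (10 * real d + 25 + t - 1 - 1)
      (state_inv \<rho>) (if b then return_pmf (S - {e}) else ?prop e)"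
    proof (cases b)
      case True
      have "state_inv \<rho> s' (S - {e})"
        using r' removed_facts(8)[OF r'] unfolding state_inv_def removed_def by blast
      then show ?thesis using True s' t_nonneg by (intro refines_CondI) (auto intro: refines_Skip)
    next
      case False
      then show ?thesis using add[OF r'] s' by (intro refines_CondI) (auto simp: algebra_simps)
    qed
  qed
  have "refines m orc t sampler s1 (10 * real d + 1)
      (\<lambda>s' e. \<exists>r\<in>{1..<1 + m}. \<pi> r = e \<and> ireg s' 10 = int r \<and> same_main s1 s') (pmf_of_set (\<pi> ` {1..<1 + m}))"
    by (rule refines_sampler_image) (use m_pos d half bij in \<open>auto simp: s1_def\<close>)
  then have smp: "refines m orc t sampler s1 (10 * real d + 1)
      (\<lambda>s' e. \<exists>r\<in>{1..<1 + m}. \<pi> r = e \<and> ireg s' 10 = int r \<and> same_main s1 s') (pmf_of_set {1..m})"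
    unfolding bij(2) .
  have "refines m orc t (sampler ;; remove ;; Flip 13 (RReg 6) ;; Cond (ILess (IConst 0) (IReg 13)) Skip ?add) s1
      (20 * real d + 46 + t) (state_inv \<rho>) (kernel S)"
    unfolding kernel_def
  proof (rule refines_Seq[OF smp])
    fix s' e assume "\<exists>r\<in>{1..<1 + m}. \<pi> r = e \<and> ireg s' 10 = int r \<and> same_main s1 s'"
    then obtain r where r0: "r \<in> {1..<1 + m}" "\<pi> r = e" "ireg s' 10 = int r" "same_main s1 s'" by blast
    have r: "r \<in> {1..m}" "\<pi> r = e" "ireg s' 10 = int r" "same_main s1 s'" using r0 by simp_all
    have eq: "rreg s' = rreg s" "imem s' = imem s" "rmem s' = rmem s" "ireg s' 0 = ireg s 0" "ireg s' 2 = ireg s 2"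
      using r(4) by (simp_all add: same_main_def s1_def)
    have c': "common m lam \<epsilon> s'" "rreg s' = \<rho>" "holds m s' S" "permuted m s' \<pi> k"
      using c unfolding common_def holds_def permuted_def eq by blast+
    have "det m orc t remove s' 12 (\<lambda>s''. \<exists>\<pi>' k'. removed \<rho> s'' S (\<pi> r) \<pi>' k')"
      by (rule det_remove[OF c'(1,2) c(3) c'(3,4) c(6) r(1,3)])
    then show "refines m orc t (remove ;; Flip 13 (RReg 6) ;; Cond (ILess (IConst 0) (IReg 13)) Skip ?add) s'
       (20 * real d + 46 + t - (10 * real d + 1) - 1) (state_inv \<rho>)
       (bind_pmf (bernoulli_pmf rate) (\<lambda>b. if b then return_pmf (S - {e}) else ?prop e))"
    proof (rule refines_det_Seq)
      fix s2 assume "\<exists>\<pi>' k'. removed \<rho> s2 S (\<pi> r) \<pi>' k'"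
      then obtain \<pi>' k' where "removed \<rho> s2 S e \<pi>' k'" using r(2) by blast
      from tail[OF this] show "refines m orc t (Flip 13 (RReg 6) ;; Cond (ILess (IConst 0) (IReg 13)) Skip ?add) s2
       (20 * real d + 46 + t - (10 * real d + 1) - 1 - 12 - 1) (state_inv \<rho>)
       (bind_pmf (bernoulli_pmf rate) (\<lambda>b. if b then return_pmf (S - {e}) else ?prop e))"
        by (rule refines_mono) auto
    qed
  qed
  then show ?thesis
    unfolding chain_step_def by (intro refines_ISet_Seq) (use m0 in \<open>simp add: s1_def algebra_simps\<close>)
qed

text \<open>The target \<open>T\<close> is real and cannot be rounded by the program, so the counter
  is a real register. For natural \<open>j\<close>, \<open>j < T\<close> holds exactly when
  \<open>j\<close> is below the rounded-up \<open>T\<close>.\<close>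

lemma refines_sweep:
  assumes s: "state_inv (rreg s) s S0" and \<rho>: "rreg s 6 = rate" "rreg s 5 = 0" "rreg s 4 = T"
    and d: "m \<le> 2 ^ d"
  shows "refines m orc t sweep s (real (nat \<lceil>T\<rceil>) * (20 * real d + 54 + t) + 1)
    (\<lambda>s' S. set_at m 0 s' = S) (iter_pmf kernel (nat \<lceil>T\<rceil>) S0)"
proof -
  define I where "I j s' S \<longleftrightarrow> state_inv ((rreg s)(5 := real j)) s' S" for j s' S
  have "refines m orc t sweep s (real (nat \<lceil>T\<rceil>) * ((20 * real d + 52 + t) + 2) + 1)
    (I (nat \<lceil>T\<rceil>)) (iter_pmf kernel (nat \<lceil>T\<rceil>) S0)"
    unfolding sweep_def
  proof (rule refines_While_count)
    fix j s' S assume j: "j < nat \<lceil>T\<rceil>" and I: "I j s' S"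
    have rr: "rreg s' = (rreg s)(5 := real j)" using I unfolding I_def state_inv_def by auto
    have "real j < T" using j by linarith
    then have "bval (RLess (RReg 5) (RReg 4)) s'" using rr \<rho> by simp
    moreover have "refines m orc t (RSet 5 (RAdd (RReg 5) (OfInt (IConst 1))) ;; chain_step) s' (20 * real d + 52 + t)
        (I (Suc j)) (kernel S)"
    proof -
      define s2 where "s2 = s'\<lparr>rreg := (rreg s)(5 := real j + 1)\<rparr>"
      have "state_inv ((rreg s)(5 := real (Suc j))) s2 S"
        using I unfolding I_def state_inv_def s2_def common_def holds_def permuted_def by (auto simp: add.commute)
      from refines_chain_step[OF this _ d]
      have "refines m orc t chain_step s2 (20 * real d + 50 + t) (I (Suc j)) (kernel S)"
        using \<rho>(1) unfolding I_def by simp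
      then show ?thesis
        by (intro refines_RSet_Seq) (simp add: s2_def rr algebra_simps)
    qed
    ultimately show "bval (RLess (RReg 5) (RReg 4)) s' \<and>
      refines m orc t (RSet 5 (RAdd (RReg 5) (OfInt (IConst 1))) ;; chain_step) s' (20 * real d + 52 + t) (I (Suc j)) (kernel S)"
      by blast
  next
    fix s' S assume "I (nat \<lceil>T\<rceil>) s' S"
    then have "rreg s' = (rreg s)(5 := real (nat \<lceil>T\<rceil>))" unfolding I_def state_inv_def by auto
    moreover have "T \<le> real (nat \<lceil>T\<rceil>)" by linarith
    ultimately show "\<not> bval (RLess (RReg 5) (RReg 4)) s'" using \<rho> by simp
  next
    have "(rreg s)(5 := real 0) = rreg s" using \<rho>(2) by auto
    then show "I 0 s S0" using s unfolding I_def by simp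
  qed
  then show ?thesis
    by (rule refines_mono) (auto simp: I_def state_inv_def set_at_holds algebra_simps)
qed

lemma det_start:
  assumes s: "common m lam \<epsilon> s" "\<forall>a>0. imem s a = 0" "rmem s 0 = 1" "\<forall>i\<in>{1..m}. rmem s (- int i) = lam i"
  shows "det m orc t start s (1 + (if real m \<le> lmax then real m * (6 * real m + 19 + t) + 3 else 0))
    (\<lambda>s'. common m lam \<epsilon> s' \<and> (\<exists>S\<in>\<I>. holds m s' S \<and> ln (Z / wt S) \<le> (real m)^2))"
proof -
  have r: "rreg s 1 = lmax" "ireg s 0 = int m" using s(1) unfolding common_def lmax_Max by auto
  show ?thesis
  proof (cases "real m \<le> lmax")
    case True
    have "det m orc t greedy s (real m * (6 * real m + 19 + t) + 3)
      (\<lambda>s'. common m lam \<epsilon> s' \<and> (\<exists>S\<in>\<I>. holds m s' S \<and> ln (Z / wt S) \<le> (real m)^2))"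
      using det_greedy[OF s]
    proof (rule det_mono)
      fix s' assume "common m lam \<epsilon> s' \<and> (\<exists>S\<in>\<I>. holds m s' S \<and> (\<forall>T\<in>\<I>. wt T \<le> wt S))"
      then show "common m lam \<epsilon> s' \<and> (\<exists>S\<in>\<I>. holds m s' S \<and> ln (Z / wt S) \<le> (real m)^2)"
        using warm_dominant[OF nonempty] by auto
    qed simp
    then show ?thesis unfolding start_def using True r by (intro det_CondI) (auto simp: algebra_simps)
  next
    case False
    have "holds m s {}" using s(2) unfolding holds_def by simp
    moreover have "ln (Z / wt {}) \<le> (real m)^2" using warm_empty[OF nonempty] False by simp
    ultimately have "common m lam \<epsilon> s \<and> (\<exists>S\<in>\<I>. holds m s S \<and> ln (Z / wt S) \<le> (real m)^2)"
      using s(1) indep_empty by blast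
    then show ?thesis unfolding start_def using False r by (intro det_CondI) (auto intro: det_Skip)
  qed
qed

text \<open>Of \<open>18 * m\<close>, the tables take \<open>10 * m\<close> and the arrangement
  \<open>8 * m\<close>; the doublings take \<open>5 * L\<close>, the conditional term is the greedy
  search, and the product is the main loop.\<close>

lemma refines_program:
  assumes \<epsilon>: "0 < \<epsilon>" "\<epsilon> < 1" and d: "m \<le> 2 ^ d"
    and L: "real m \<le> \<epsilon> * 2 ^ L" "\<And>j. j < L \<Longrightarrow> \<epsilon> * 2 ^ j < real m"
  shows "\<exists>S0\<in>\<I>. ln (Z / wt S0) \<le> (real m)^2 \<and>
    refines m orc t program (input m lam \<epsilon>)
      (18 * real m + 5 * real L + (if real m \<le> lmax then real m * (6 * real m + 19 + t) + 3 else 0) +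
        real (nat \<lceil>2 * (1 + lmax) * real m * real L\<rceil>) * (20 * real d + 54 + t) + 29)
      (\<lambda>s' S. set_at m 0 s' = S) (iter_pmf kernel (nat \<lceil>2 * (1 + lmax) * real m * real L\<rceil>) S0)"
proof -
  let ?G = "if real m \<le> lmax then real m * (6 * real m + 19 + t) + 3 else 0"
  let ?N = "nat \<lceil>2 * (1 + lmax) * real m * real L\<rceil>"
  define good where "good s \<longleftrightarrow> common m lam \<epsilon> s \<and> (\<exists>S\<in>\<I>. holds m s S \<and> ln (Z / wt S) \<le> (real m)^2 \<and>
    (\<exists>\<pi> k. permuted m s \<pi> k \<and> \<pi> ` {1..k} = S) \<and> rreg s 6 = rate \<and> rreg s 5 = 0 \<and>
     rreg s 4 = 2 * (1 + lmax) * real m * real L)" for s :: store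
  have sched: "det m orc t schedule s (5 * real L + 12) good"
    if s: "common m lam \<epsilon> s" "S \<in> \<I>" "holds m s S" "ln (Z / wt S) \<le> (real m)^2"
      "permuted m s \<pi> k" "\<pi> ` {1..k} = S" for s S \<pi> k
  proof (rule det_mono[OF det_schedule[where m = m and l = lmax]])
    show "rreg s 0 = \<epsilon>" "ireg s 0 = int m" "rreg s 1 = lmax"
      using s(1) unfolding common_def lmax_Max by auto
    fix s' :: store assume s': "ireg s' = ireg s \<and> imem s' = imem s \<and> rmem s' = rmem s \<and> rreg s' 0 = \<epsilon> \<and> rreg s' 1 = lmax \<and>
       rreg s' 6 = 1 / (1 + lmax) \<and> rreg s' 4 = 2 * (1 + lmax) * real m * real L \<and> rreg s' 5 = 0"
    have "common m lam \<epsilon> s'" "holds m s' S" "permuted m s' \<pi> k"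
      using s s' unfolding common_def holds_def permuted_def lmax_Max by auto
    then show "good s'" unfolding good_def rate_def using s s' by blast
  qed (use \<epsilon> L in auto)
  have arr: "det m orc t (arrange ;; schedule) s (8 * real m + 5 * real L + 20) good"
    if s: "common m lam \<epsilon> s" "S \<in> \<I>" "holds m s S" "ln (Z / wt S) \<le> (real m)^2" for s S
  proof (rule det_Seq[OF det_arrange[OF s(1,3)]])
    fix s' assume "common m lam \<epsilon> s' \<and> holds m s' S \<and> (\<exists>\<pi> k. permuted m s' \<pi> k \<and> \<pi> ` {1..k} = S)"
    moreover have "8 * real m + 5 * real L + 20 - (8 * real m + 7) - 1 = 5 * real L + 12" by simp
    ultimately show "det m orc t schedule s' (8 * real m + 5 * real L + 20 - (8 * real m + 7) - 1) good"
      using sched[of s' S] s(2,4) by metis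
  qed
  have "det m orc t (tables ;; start ;; arrange ;; schedule) (input m lam \<epsilon>) (18 * real m + 5 * real L + ?G + 27) good"
  proof (rule det_Seq[OF det_tables[OF m_pos lam_pos]])
    fix s assume s: "common m lam \<epsilon> s \<and> (\<forall>a>0. imem s a = 0) \<and> rmem s 0 = 1 \<and>
       (\<forall>i\<in>{1..m}. rmem s (- int i) = lam i)"
    have st: "det m orc t start s (1 + ?G) (\<lambda>s'. common m lam \<epsilon> s' \<and> (\<exists>S\<in>\<I>. holds m s' S \<and> ln (Z / wt S) \<le> (real m)^2))"
      by (rule det_start) (use s in auto)
    show "det m orc t (start ;; arrange ;; schedule) s (18 * real m + 5 * real L + ?G + 27 - (10 * real m + 4) - 1) good"
    proof (rule det_Seq[OF st])
      fix s' assume "common m lam \<epsilon> s' \<and> (\<exists>S\<in>\<I>. holds m s' S \<and> ln (Z / wt S) \<le> (real m)^2)"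
      then obtain S where "common m lam \<epsilon> s'" "S \<in> \<I>" "holds m s' S" "ln (Z / wt S) \<le> (real m)^2" by blast
      from arr[OF this]
      show "det m orc t (arrange ;; schedule) s'
          (18 * real m + 5 * real L + ?G + 27 - (10 * real m + 4) - 1 - (1 + ?G) - 1) good"
        by (rule det_mono) simp_all
    qed
  qed
  then obtain s1 where s1: "good s1" "refines m orc t (tables ;; start ;; arrange ;; schedule) (input m lam \<epsilon>)
      (18 * real m + 5 * real L + ?G + 27) (=) (return_pmf s1)"
    unfolding det_def by blast
  then obtain S0 where S0: "S0 \<in> \<I>" "ln (Z / wt S0) \<le> (real m)^2" "state_inv (rreg s1) s1 S0"
    unfolding good_def state_inv_def by blast
  have "refines m orc t sweep s1 (real ?N * (20 * real d + 54 + t) + 1) (\<lambda>s' S. set_at m 0 s' = S) (iter_pmf kernel ?N S0)"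
    by (rule refines_sweep[OF S0(3) _ _ _ d]) (use s1(1) in \<open>auto simp: good_def\<close>)
  then have "refines m orc t program (input m lam \<epsilon>)
      (18 * real m + 5 * real L + ?G + real ?N * (20 * real d + 54 + t) + 29)
      (\<lambda>s' S. set_at m 0 s' = S) (iter_pmf kernel ?N S0)"
    unfolding program_def by (intro refines_Seq_det[OF s1(2)]) (auto elim!: refines_mono)
  then show ?thesis using S0(1,2) by blast
qed

end

text \<open>Here \<open>P\<close> is \<open>1 + lmax\<close>, while \<open>q\<close> and
  \<open>w\<close> are multiples of \<open>ln (n / \<epsilon>)\<close> and \<open>ln n + t\<close>,
  or shifts of them by 1, that are at least 1. All terms are then absorbed by one product:
  \<open>561 = 18 + 10 + 29 + 29 + 475\<close>, where \<open>10\<close> comes from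
  \<open>5 * L\<close>, the first \<open>29 = 6 + 19 + 1 + 3\<close> from \<open>G\<close>, and
  \<open>475 = 5 * 95\<close> from the main loop.\<close>

lemma budget:
  fixes P m q w t L d N G :: real
  assumes ge1: "1 \<le> P" "1 \<le> m" "1 \<le> q" "1 \<le> w" and t: "0 \<le> t" "t \<le> w" and d: "0 \<le> d" "d \<le> 2 * w"
    and L: "L \<le> 2 * q" and N: "0 \<le> N" "N \<le> 2 * P * m * L + 1"
    and G: "G \<le> 0 \<or> m \<le> P \<and> G \<le> m * (6 * m + 19 + t) + 3"
  shows "18 * m + 5 * L + G + N * (20 * d + 54 + t) + 29 \<le> 561 * (P * m * q * w)"
proof -
  have up: "a \<le> a * b" "a \<le> b * a" if "0 \<le> a" "1 \<le> b" for a b :: real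
    using that mult_left_mono[of 1 b a] by (simp_all add: mult.commute)
  have Pm: "m \<le> P * m" "P \<le> P * m" using ge1 by (auto intro: up)
  then have Pm1: "1 \<le> P * m" using ge1 by linarith
  have Pmq: "P * m \<le> P * m * q" "q \<le> P * m * q" using Pm1 ge1 by (auto intro!: up)
  then have Pmq1: "1 \<le> P * m * q" using Pm1 by linarith
  have Y: "P * m * q \<le> P * m * q * w" "w \<le> P * m * q * w" using Pmq1 ge1 by (auto intro!: up)
  have mw: "m * w \<le> P * m * q * w"
  proof (rule mult_right_mono)
    show "m \<le> P * m * q" using Pm Pmq by linarith
  qed (use ge1 in simp)
  have "P * m * L \<le> P * m * (2 * q)" using L Pm1 by (intro mult_left_mono) auto
  then have "N \<le> 5 * (P * m * q)" using N Pmq1 by (simp add: mult_ac)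
  moreover have "20 * d + 54 + t \<le> 95 * w" using d t ge1 by linarith
  ultimately have "N * (20 * d + 54 + t) \<le> (5 * (P * m * q)) * (95 * w)"
    using N d t Pmq1 by (intro mult_mono) auto
  then have 1: "N * (20 * d + 54 + t) \<le> 475 * (P * m * q * w)" by (simp add: mult_ac)
  have 2: "G \<le> 29 * (P * m * q * w)"
    using G
  proof
    assume G: "m \<le> P \<and> G \<le> m * (6 * m + 19 + t) + 3"
    have "m * m \<le> P * m" using G ge1 by (intro mult_right_mono) auto
    moreover have "m * t \<le> m * w" using t ge1 by (intro mult_left_mono) auto
    moreover have "m * (6 * m + 19 + t) = 6 * (m * m) + 19 * m + m * t" by (simp add: algebra_simps)
    ultimately show ?thesis using G mw Pm Pmq Y Pmq1 by linarith
  qed (use Pmq1 Y in linarith)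
  show ?thesis using 1 2 L Pm Pmq Y Pmq1 by linarith
qed

lemma program_correct:
  fixes lam :: "nat \<Rightarrow> real"
  assumes m: "1 \<le> m" and mat: "matroid {1..m} \<I>" and lam: "\<forall>i\<in>{1..m}. lam i > 0"
    and \<epsilon>: "0 < \<epsilon>" "\<epsilon> < 1" and t: "0 \<le> t"
  shows "\<exists>\<nu>. output_law m (\<lambda>S. S \<in> \<I>) t program (input m lam \<epsilon>) \<nu> \<and> set_pmf \<nu> \<subseteq> \<I> \<and>
      tv_dist \<I> (pmf \<nu>) (indep_dist \<I> lam) \<le> \<epsilon>" (is ?law)
    and "2 \<le> m \<Longrightarrow> expected_time m (\<lambda>S. S \<in> \<I>) t program (input m lam \<epsilon>)
      \<le> ennreal (1300 * ((1 + Max (lam ` {1..m})) * real m * ln (real m / \<epsilon>) * (ln (real m) + t)))"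
    and "m = 1 \<Longrightarrow> expected_time m (\<lambda>S. S \<in> \<I>) t program (input m lam \<epsilon>)
      \<le> ennreal (1300 * ((1 + lam 1) * (1 + ln (1 / \<epsilon>)) * (1 + t)))"
proof -
  interpret matroid "{1..m}" \<I> by (rule mat)
  interpret matroid_instance m \<I> lam \<epsilon> t
    by unfold_locales (use lam m t in auto)
  define x where "x = real m / \<epsilon>"
  have x1: "1 \<le> x" unfolding x_def using m \<epsilon> by (simp add: le_divide_eq)
  obtain d where d: "real m \<le> 2 ^ d" "real d \<le> log 2 (real m) + 1" using ex_power_of_two_ge[of "real m"] m by auto
  have d': "m \<le> 2 ^ d" using d(1) by (metis of_nat_le_iff of_nat_numeral of_nat_power)
  obtain L0 where L0: "x \<le> 2 ^ L0" "real L0 \<le> log 2 x + 1" using ex_power_of_two_ge[OF x1] by blast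
  \<comment> \<open>\<open>L\<close> is the number of doublings that the program makes;
    \<open>L0\<close> only bounds it from above.\<close>
  define L where "L = (LEAST j. real m \<le> \<epsilon> * 2 ^ j)"
  have L0': "real m \<le> \<epsilon> * 2 ^ L0" using L0(1) \<epsilon> unfolding x_def by (simp add: divide_le_eq mult.commute)
  have L1: "real m \<le> \<epsilon> * 2 ^ L" unfolding L_def by (rule LeastI[of _ L0]) (rule L0')
  have L2: "\<epsilon> * 2 ^ j < real m" if "j < L" for j using not_less_Least[OF that[unfolded L_def]] by simp
  have "L \<le> L0" unfolding L_def using L0' by (rule Least_le)
  then have L3: "real L \<le> log 2 x + 1" using L0(2) by linarith
  have Lln: "ln x \<le> real L"
  proof -
    have "x \<le> 2 ^ L" using L1 \<epsilon> unfolding x_def by (simp add: divide_le_eq mult.commute)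
    then have "ln x \<le> ln (2 ^ L)" using x1 by (intro ln_mono) auto
    also have "\<dots> = real L * ln 2" by (simp add: ln_realpow)
    also have "\<dots> \<le> real L * 1" using ln_2_less_1 by (intro mult_left_mono) auto
    finally show ?thesis by simp
  qed
  define N where "N = nat \<lceil>2 * (1 + lmax) * real m * real L\<rceil>"
  have lp: "0 < lmax" by (rule lmax_pos[OF nonempty])
  have "0 \<le> 2 * (1 + lmax) * real m * real L" using lp by simp
  then have N: "2 * (1 + lmax) * real m * real L \<le> real N" "real N \<le> 2 * (1 + lmax) * real m * real L + 1"
    unfolding N_def by linarith+
  define G where "G = (if real m \<le> lmax then real m * (6 * real m + 19 + t) + 3 else 0)"
  obtain S0 where S0: "S0 \<in> \<I>" "ln (Z / wt S0) \<le> (real m)^2"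
    and ref: "refines m orc t program (input m lam \<epsilon>)
      (18 * real m + 5 * real L + G + real N * (20 * real d + 54 + t) + 29)
      (\<lambda>s' S. set_at m 0 s' = S) (iter_pmf kernel N S0)"
    using refines_program[OF \<epsilon> d' L1 L2] unfolding N_def G_def by blast
  have "2 * (1 + lmax) * real m * ln x \<le> 2 * (1 + lmax) * real m * real L"
    using Lln lp by (intro mult_left_mono) auto
  then have mix: "2 * (1 + lmax) * real m * ln (real m / \<epsilon>) \<le> real N" using N(1) unfolding x_def by linarith
  have "tv_dist \<I> (pmf (iter_pmf kernel N S0)) (indep_dist \<I> lam) \<le> \<epsilon>"
    by (rule iter_kernel_tv_dist[OF nonempty S0(1) _ \<epsilon>]) (use S0(2) mix in simp_all)
  then show ?law
    using refines_output_law[OF ref] set_pmf_iter_kernel[OF nonempty S0(1)] by blast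
  have time: "expected_time m orc t program (input m lam \<epsilon>) \<le>
      ennreal (18 * real m + 5 * real L + G + real N * (20 * real d + 54 + t) + 29)"
    by (rule refines_expected_time[OF ref t])
  have Gb: "G \<le> 0 \<or> real m \<le> 1 + lmax \<and> G \<le> real m * (6 * real m + 19 + t) + 3"
    unfolding G_def by auto
  have log_le: "log 2 y \<le> 3 / 2 * ln y" if "1 \<le> y" for y :: real
  proof -
    have "ln y * (1 / ln 2) \<le> ln y * (3 / 2)"
      using that ln2_ge_two_thirds by (intro mult_left_mono) (auto simp: divide_le_eq)
    then show ?thesis unfolding log_def by simp
  qed
  show "expected_time m orc t program (input m lam \<epsilon>)
      \<le> ennreal (1300 * ((1 + Max (lam ` {1..m})) * real m * ln (real m / \<epsilon>) * (ln (real m) + t)))" if m2: "2 \<le> m"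
  proof -
    have lnm: "2 / 3 \<le> ln (real m)"
    proof -
      have "ln 2 \<le> ln (real m)" using m2 by (intro ln_mono) auto
      then show ?thesis using ln2_ge_two_thirds by linarith
    qed
    have lnx: "2 / 3 \<le> ln x"
    proof -
      have "real m \<le> x" unfolding x_def using \<epsilon> m by (simp add: le_divide_eq)
      then have "ln (real m) \<le> ln x" using m by (intro ln_mono) auto
      then show ?thesis using lnm by linarith
    qed
    \<comment> \<open>\<open>budget\<close> with \<open>q = 3 / 2 * ln x\<close> and
      \<open>w = 3 / 2 * (ln m + t)\<close>: since \<open>ln 2 \<ge> 2 / 3\<close>, the factor
      \<open>3 / 2\<close> raises both to at least 1 and also turns \<open>ln\<close> into a bound
      for \<open>log 2\<close>. Then \<open>561 * 9 / 4 \<le> 1300\<close>.\<close>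
    have "18 * real m + 5 * real L + G + real N * (20 * real d + 54 + t) + 29 \<le>
        561 * ((1 + lmax) * real m * (3 / 2 * ln x) * (3 / 2 * (ln (real m) + t)))"
      by (rule budget)
        (use lp m lnm lnx t d(2) L3 N(2) Gb log_le[of "real m"] log_le[OF x1] in auto)
    also have "\<dots> = 561 * 9 / 4 * ((1 + lmax) * real m * ln x * (ln (real m) + t))" by simp
    also have "\<dots> \<le> 1300 * ((1 + lmax) * real m * ln x * (ln (real m) + t))"
      using lp lnm lnx t by (intro mult_right_mono) auto
    finally show ?thesis
      using time unfolding x_def lmax_Max[symmetric] by (meson ennreal_leI order_trans)
  qed
  show "expected_time m orc t program (input m lam \<epsilon>)
      \<le> ennreal (1300 * ((1 + lam 1) * (1 + ln (1 / \<epsilon>)) * (1 + t)))" if m1: "m = 1"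
  proof -
    have "Max (lam ` {1..m}) = lam 1" unfolding m1 by simp
    then have lm: "lmax = lam 1" by (rule trans[OF lmax_Max])
    have lnx: "0 \<le> ln x" using x1 by simp
    \<comment> \<open>Here \<open>ln m = 0\<close>, so \<open>q\<close> and \<open>w\<close> are
      made at least 1 by adding 1 instead of scaling.\<close>
    have "18 * real m + 5 * real L + G + real N * (20 * real d + 54 + t) + 29 \<le>
        561 * ((1 + lmax) * real m * (1 + ln x) * (1 + t))"
      by (rule budget)
        (use lp m1 lnx t d(2) L3 N(2) Gb log_le[OF x1] in auto)
    also have "\<dots> = 561 * ((1 + lam 1) * (1 + ln (1 / \<epsilon>)) * (1 + t))"
      unfolding lm unfolding x_def m1 by simp
    also have "\<dots> \<le> 1300 * ((1 + lam 1) * (1 + ln (1 / \<epsilon>)) * (1 + t))"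
      using lp[unfolded lm] lnx[unfolded x_def m1] t by (intro mult_right_mono) auto
    finally show ?thesis using time by (meson ennreal_leI order_trans)
  qed
qed

theorem theorem1p1:
  shows "\<exists>(prog :: com) (C :: real). C > 0 \<and>
    (\<forall>(n :: nat) (\<I> :: nat set set) (lam :: nat \<Rightarrow> real) (\<epsilon> :: real) (t :: real).
       n \<ge> 1 \<longrightarrow> matroid {1..n} \<I> \<longrightarrow> (\<forall>i\<in>{1..n}. lam i > 0) \<longrightarrow> 0 < \<epsilon> \<longrightarrow> \<epsilon> < 1 \<longrightarrow> t \<ge> 0 \<longrightarrow>
       (\<exists>\<nu> :: nat set pmf.
          output_law n (\<lambda>S. S \<in> \<I>) t prog (input n lam \<epsilon>) \<nu> \<and>
          set_pmf \<nu> \<subseteq> \<I> \<and>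
          tv_dist \<I> (pmf \<nu>) (indep_dist \<I> lam) \<le> \<epsilon>) \<and>
       (n \<ge> 2 \<longrightarrow>
          expected_time n (\<lambda>S. S \<in> \<I>) t prog (input n lam \<epsilon>)
          \<le> ennreal (C * ((1 + Max (lam ` {1..n})) * real n * ln (real n / \<epsilon>) * (ln (real n) + t)))) \<and>
       (n = 1 \<longrightarrow>
          expected_time n (\<lambda>S. S \<in> \<I>) t prog (input n lam \<epsilon>)
          \<le> ennreal (C * ((1 + lam 1) * (1 + ln (1 / \<epsilon>)) * (1 + t)))))"
  by (rule exI[of _ program], rule exI[of _ 1300], intro conjI allI impI)
    (simp, (rule program_correct; assumption)+)

end
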